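(* Let $\Omega\subset\mathbb{R}^{d}$ be open, let $T\in\mathcal{E}'(\Omega)$ be a distribution with compact support in $\Omega$, and let $T_{n}=T\ast\phi_{n}$, where $\phi_{n}(x)=n^{d}\phi(nx)$ and $\phi\in\mathcal{S}(\mathbb{R}^{d})$ is a fixed function with $\int_{\mathbb{R}^{d}}\phi(x)\,dx=1$. Let $\alpha\in\mathbb{R}_{+}\setminus\mathbb{N}$ and fix an integer $k>\alpha$. Then $T\in C^{\alpha}(\mathbb{R}^{d})$ if and only if for every multi-index $m\in\mathbb{N}^{d}$ with $|m|\leq k$, $$\sup_{x\in\Omega}|\partial^{m}T_{n}(x)|=O(n^{k-\alpha}),\qquad n\to\infty.$$
   Context: $\mathcal{E}'(\Omega)$ is the space of compactly supported distributions on $\Omega$. A distribution $T\in\mathcal{E}'(\Omega)$ is regarded as a distribution on $\mathbb{R}^{d}$ (extended by zero), so that $T\ast\phi_{n}$ is a smooth function on $\mathbb{R}^{d}$; here $n$ ranges over the positive integers. For $\alpha\in\mathbb{R}_{+}\setminus\mathbb{N}$, with $[\alpha]$ its integral part, the global Hölder space $C^{\alpha}(\mathbb{R}^{d})$ is the set of all $f\in C^{[\alpha]}(\mathbb{R}^{d})$ such that $\partial^{m}f\in L^{\infty}(\mathbb{R}^{d})$ for all $|m|\leq[\alpha]$ and $$\max_{|m|=[\alpha]}\ \sup_{x,t\in\mathbb{R}^{d},\,x\neq t}\frac{|\partial^{m}f(x)-\partial^{m}f(t)|}{|x-t|^{\alpha-[\alpha]}}<\infty.$$ $T\in C^{\alpha}(\mathbb{R}^{d})$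 means that the distribution $T$ is given by a function in this space. *)

theory Defs
  imports "HOL-Analysis.Analysis"
begin

section \<open>Multi-index derivatives and smooth functions\<close>

definition mi_order :: "('d::finite \<Rightarrow> nat) \<Rightarrow> nat" where
  "mi_order m = (\<Sum>i\<in>UNIV. m i)"

definition partial :: "'d::finite \<Rightarrow> (real^'d \<Rightarrow> complex) \<Rightarrow> real^'d \<Rightarrow> complex" where
  "partial i f x = frechet_derivative f (at x) (axis i 1)"

text \<open>The index type carries no order, so the coordinate directions are taken in some fixed
  enumeration. By the symmetry of mixed derivatives its choice is immaterial wherever
  \<open>mpartial m f\<close> is used, that is, for \<open>f\<close> of class \<open>C\<close> to the power \<open>mi_order m\<close>.\<close>

definition mpartial :: "('d::finite \<Rightarrow> nat) \<Rightarrow> (real^'d \<Rightarrow> complex) \<Rightarrow> real^'d \<Rightarrow> complex" where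
  "mpartial m f = foldr (\<lambda>i. partial i ^^ m i) (SOME is. distinct is \<and> set is = UNIV) f"

primrec Ck :: "nat \<Rightarrow> (real^'d::finite \<Rightarrow> complex) \<Rightarrow> bool" where
  "Ck 0 f \<longleftrightarrow> continuous_on UNIV f"
| "Ck (Suc k) f \<longleftrightarrow> f differentiable_on UNIV \<and> (\<forall>i. Ck k (partial i f))"

definition smooth :: "(real^'d::finite \<Rightarrow> complex) \<Rightarrow> bool" where
  "smooth f \<longleftrightarrow> (\<forall>k. Ck k f)"

section \<open>Function spaces\<close>

definition fun_support :: "(real^'d::finite \<Rightarrow> complex) \<Rightarrow> (real^'d) set" where
  "fun_support f = closure {x. f x \<noteq> 0}"

text \<open>An element of \<open>\<D>(U)\<close> is identified with its extension by zero to the whole space.\<close>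

definition test_functions :: "(real^'d::finite) set \<Rightarrow> (real^'d \<Rightarrow> complex) set" where
  "test_functions U = {f. smooth f \<and> compact (fun_support f) \<and> fun_support f \<subseteq> U}"

definition schwartz :: "(real^'d::finite \<Rightarrow> complex) set" where
  "schwartz = {f. smooth f \<and>
     (\<forall>N m. \<exists>C. \<forall>x. (1 + norm x) ^ N * norm (mpartial m f x) \<le> C)}"

text \<open>Essential boundedness of the derivatives is plain boundedness, as they are continuous.\<close>

definition hoelder :: "real \<Rightarrow> (real^'d::finite \<Rightarrow> complex) set" where
  "hoelder \<alpha> = {f. Ck (nat \<lfloor>\<alpha>\<rfloor>) f \<and>
     (\<forall>m. mi_order m \<le> nat \<lfloor>\<alpha>\<rfloor> \<longrightarrow> bounded (range (mpartial m f))) \<and>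
     (\<forall>m. mi_order m = nat \<lfloor>\<alpha>\<rfloor> \<longrightarrow>
        (\<exists>C. \<forall>x t. x \<noteq> t \<longrightarrow>
           norm (mpartial m f x - mpartial m f t) / norm (x - t) powr (\<alpha> - of_int \<lfloor>\<alpha>\<rfloor>) \<le> C))}"

section \<open>Distributions\<close>

text \<open>A distribution on \<open>\<Omega>\<close> is a functional on \<open>\<D>(\<Omega>)\<close>; being a total function in HOL, it also has
  values outside \<open>\<D>(\<Omega>)\<close>, which are arbitrary and never used.\<close>

definition distributions ::
  "(real^'d::finite) set \<Rightarrow> ((real^'d \<Rightarrow> complex) \<Rightarrow> complex) set" where
  "distributions \<Omega> = {T.
     (\<forall>f\<in>test_functions \<Omega>. \<forall>g\<in>test_functions \<Omega>. T (\<lambda>x. f x + g x) = T f + T g) \<and>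
     (\<forall>c. \<forall>f\<in>test_functions \<Omega>. T (\<lambda>x. c * f x) = c * T f) \<and>
     (\<forall>K. compact K \<and> K \<subseteq> \<Omega> \<longrightarrow>
        (\<exists>C N. \<forall>f\<in>test_functions K.
           norm (T f) \<le> C * (\<Sum>m | mi_order m \<le> N. SUP x. norm (mpartial m f x))))}"

definition dist_support ::
  "(real^'d::finite) set \<Rightarrow> ((real^'d \<Rightarrow> complex) \<Rightarrow> complex) \<Rightarrow> (real^'d) set" where
  "dist_support \<Omega> T = \<Omega> - \<Union>{U. open U \<and> U \<subseteq> \<Omega> \<and> (\<forall>f\<in>test_functions U. T f = 0)}"

definition compact_distributions ::
  "(real^'d::finite) set \<Rightarrow> ((real^'d \<Rightarrow> complex) \<Rightarrow> complex) set" where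
  "compact_distributions \<Omega> = {T \<in> distributions \<Omega>. compact (dist_support \<Omega> T)}"

definition cutoffs ::
  "(real^'d::finite) set \<Rightarrow> (real^'d) set \<Rightarrow> (real^'d \<Rightarrow> complex) set" where
  "cutoffs \<Omega> K = {\<eta> \<in> test_functions \<Omega>. \<exists>U. open U \<and> K \<subseteq> U \<and> (\<forall>x\<in>U. \<eta> x = 1)}"

text \<open>The extension by zero of \<open>T\<close> in \<open>\<E>'(\<Omega>)\<close> to the whole space, as a functional on all smooth
  functions \<open>f\<close>: the value \<open>T (\<eta> f)\<close> does not depend on the cutoff \<open>\<eta>\<close> that equals 1 near the
  support of \<open>T\<close>.\<close>

definition dist_ext ::
  "(real^'d::finite) set \<Rightarrow> ((real^'d \<Rightarrow> complex) \<Rightarrow> complex) \<Rightarrow> (real^'d \<Rightarrow> complex) \<Rightarrow> complex" where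
  "dist_ext \<Omega> T f = T (\<lambda>x. (SOME \<eta>. \<eta> \<in> cutoffs \<Omega> (dist_support \<Omega> T)) x * f x)"

definition dist_conv ::
  "(real^'d::finite) set \<Rightarrow> ((real^'d \<Rightarrow> complex) \<Rightarrow> complex) \<Rightarrow> (real^'d \<Rightarrow> complex)
     \<Rightarrow> real^'d \<Rightarrow> complex" where
  "dist_conv \<Omega> T \<psi> x = dist_ext \<Omega> T (\<lambda>y. \<psi> (x - y))"

definition given_by ::
  "((real^'d::finite \<Rightarrow> complex) \<Rightarrow> complex) \<Rightarrow> (real^'d \<Rightarrow> complex) \<Rightarrow> bool" where
  "given_by S f \<longleftrightarrow> (\<forall>\<psi>\<in>test_functions UNIV. S \<psi> = (LINT x|lborel. f x * \<psi> x))"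

definition dilation :: "(real^'d::finite \<Rightarrow> complex) \<Rightarrow> nat \<Rightarrow> real^'d \<Rightarrow> complex" where
  "dilation \<phi> n x = of_nat n ^ CARD('d) * \<phi> (real n *\<^sub>R x)"

end

theory Submission
  imports Defs
begin

text \<open>Write \<open>A\<^sub>e g = \<phi>\<^sub>e * g\<close> for the averaging operator at scale \<open>e\<close>, so that
  \<open>T\<^sub>n = A\<^sub>e T\<close> with \<open>e = 1/n\<close>, and fix a cutoff \<open>\<eta>\<close> with compact support \<open>K\<close> inside
  \<open>\<Omega>\<close> that equals \<open>1\<close> near the support of \<open>T\<close>. The functional \<open>S f = T (\<eta> f)\<close> is controlled
  by finitely many derivatives of \<open>f\<close> on \<open>K\<close> (\<open>dist_ext_finite_order\<close>). Only this
  bound is used, and that \<open>S f\<close> depends on \<open>f\<close> through \<open>\<eta> f\<close> alone.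

  If \<open>T\<close> is a function \<open>f\<close> of class \<open>C\<^sup>\<alpha>\<close>, let \<open>a = [\<alpha>]\<close>. For \<open>|m| \<le> a\<close> the derivatives
  \<open>\<partial>\<^sup>m T\<^sub>n = (\<partial>\<^sup>m f) * \<phi>\<^sub>n\<close> are bounded. For \<open>|m| > a\<close>, put \<open>a\<close> of the derivatives on \<open>f\<close> and the
  other \<open>|m| - a\<close> on \<open>\<phi>\<^sub>n\<close>, where each costs a factor \<open>n\<close>. A derivative of \<open>\<phi>\<close> has integral zero, so the Hoelder condition on the derivatives of order
  \<open>a\<close> gains \<open>n\<close> to the power \<open>-(\<alpha> - a)\<close>; altogether the order is \<open>n\<close> to the power \<open>|m| - \<alpha>\<close>
  (\<open>mollified_growth_of_hoelder\<close>).

  Conversely, only the derivatives of order \<open>k\<close> are needed. Their bound holds on the whole space,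
  since \<open>\<phi>\<close> decays rapidly and \<open>K\<close> has positive distance to the complement of \<open>\<Omega>\<close>
  (\<open>mollification_bounded_outside\<close>). A Littlewood-Paley argument would now need kernels with
  vanishing moments, which \<open>\<phi>\<close> does not provide. They are replaced by powers of the remainder
  \<open>R\<^sub>e = I - A\<^sub>e\<close>: by the mean value inequality each \<open>R\<^sub>e\<close> trades one derivative for one power of \<open>e\<close>
  (\<open>rem_pow_deriv_bound\<close>). Apply the truncated Neumann series \<open>I + R\<^sub>e + \<dots> + R\<^sub>e\<^sup>k\<^sup>-\<^sup>1\<close> to
  \<open>A\<^sub>e T\<close> and call the result \<open>G\<^sub>e\<close>; formally \<open>G\<^sub>e = (I - R\<^sub>e\<^sup>k) T\<close>. As all these operators
  commute, \<open>G\<^sub>e - G\<^sub>e\<^sub>' = R\<^sub>e\<^sub>'\<^sup>k G\<^sub>e - R\<^sub>e\<^sup>k G\<^sub>e\<^sub>'\<close> (\<open>neumann_difference\<close>). For \<open>e = 2\<^sup>-\<^sup>j\<close> and \<open>e' = e/2\<close> this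
  bounds the derivatives of order \<open>l \<le> k\<close> of the difference by a multiple of \<open>e\<close> to the power
  \<open>\<alpha> - l\<close>, so the \<open>G\<^sub>e\<close> converge to a function \<open>f\<close> of class \<open>C\<^sup>\<alpha>\<close>
  (\<open>hoelder_of_dyadic_differences\<close>). Finally \<open>A\<^sub>e f = A\<^sub>e T\<close> at every scale \<open>e = 1/n\<close>, because
  \<open>A\<^sub>e G\<^sub>e\<^sub>'\<close> is the Neumann series at scale \<open>e'\<close> applied to \<open>A\<^sub>e\<^sub>' A\<^sub>e T\<close> and so tends to \<open>A\<^sub>e T\<close>;
  letting \<open>e\<close> tend to \<open>0\<close> gives \<open>T = f\<close>.

  The commutation relations rest on a Fubini theorem for functionals of finite order
  (\<open>kconv_sconv\<close>): integrals are approximated by finite sums, uniformly over all bounded Lipschitz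
  integrands (\<open>uniform_quadrature\<close>), and a linear functional commutes with finite sums.\<close>

section \<open>Partial derivatives\<close>

abbreviation evec :: "'d::finite \<Rightarrow> real^'d" where
  "evec i \<equiv> axis i 1"

lemma differentiable_on_UNIV_at:
  "f differentiable_on UNIV \<Longrightarrow> f differentiable (at x)"
  by (simp add: differentiable_on_def)

lemma has_derivative_partial:
  fixes f :: "real^'d::finite \<Rightarrow> complex"
  assumes "f differentiable (at x)"
  shows "(f has_derivative (\<lambda>h. \<Sum>i\<in>UNIV. (h $ i) *\<^sub>R partial i f x)) (at x)"
proof -
  let ?D = "frechet_derivative f (at x)"
  have D: "(f has_derivative ?D) (at x)"
    using assms frechet_derivative_works by blast
  then have lin: "linear ?D" by (rule has_derivative_linear)
  have "?D h = (\<Sum>i\<in>UNIV. (h $ i) *\<^sub>R partial i f x)" for h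
  proof -
    have "?D h = ?D (\<Sum>i\<in>UNIV. (h $ i) *\<^sub>R axis i 1)"
      using basis_expansion[of h] by (simp add: scalar_mult_eq_scaleR)
    also have "\<dots> = (\<Sum>i\<in>UNIV. (h $ i) *\<^sub>R ?D (axis i 1))"
      by (simp add: linear_sum[OF lin] linear_scale[OF lin] o_def)
    finally show ?thesis by (simp add: partial_def)
  qed
  then have "?D = (\<lambda>h. \<Sum>i\<in>UNIV. (h $ i) *\<^sub>R partial i f x)" by blast
  then show ?thesis using D by simp
qed

lemma partial_eqI:
  fixes f :: "real^'d::finite \<Rightarrow> complex"
  assumes "(f has_derivative f') (at x)"
  shows "partial i f x = f' (axis i 1)"
  using frechet_derivative_at[OF assms] by (simp add: partial_def)

lemma partial_vector_derivative:
  fixes f :: "real^'d::finite \<Rightarrow> complex"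
  assumes "f differentiable_on UNIV"
  shows "((\<lambda>s. f (a + s *\<^sub>R evec i)) has_vector_derivative partial i f (a + s *\<^sub>R evec i)) (at s)"
proof -
  have D: "(f has_derivative frechet_derivative f (at (a + s *\<^sub>R evec i))) (at (a + s *\<^sub>R evec i))"
    using assms differentiable_on_UNIV_at frechet_derivative_works by blast
  have "((\<lambda>s. a + s *\<^sub>R evec i) has_derivative (\<lambda>t. t *\<^sub>R evec i)) (at s)"
    by (auto intro!: derivative_eq_intros)
  then have "((\<lambda>s. f (a + s *\<^sub>R evec i)) has_derivative
     (\<lambda>t. frechet_derivative f (at (a + s *\<^sub>R evec i)) (t *\<^sub>R evec i))) (at s)"
    by (rule has_derivative_compose) (rule D)
  then show ?thesis
    using linear_scale[OF has_derivative_linear[OF D]]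
    by (simp add: has_vector_derivative_def partial_def)
qed

lemma mean_value_bound:
  fixes g :: "real \<Rightarrow> 'b::real_normed_vector"
  assumes "h \<ge> 0"
    and "\<And>s. 0 \<le> s \<Longrightarrow> s \<le> h \<Longrightarrow> (g has_vector_derivative g' s) (at s)"
    and "\<And>s. 0 \<le> s \<Longrightarrow> s \<le> h \<Longrightarrow> norm (g' s) \<le> B"
  shows "norm (g h - g 0) \<le> B * h"
proof -
  have "norm (g h - g 0) \<le> B * norm (h - 0)"
  proof (rule differentiable_bound[where S="{0..h}" and f'="\<lambda>s t. t *\<^sub>R g' s"])
    fix s assume s: "s \<in> {0..h}"
    show "(g has_derivative (\<lambda>t. t *\<^sub>R g' s)) (at s within {0..h})"
      using assms(2)[of s] s by (simp add: has_vector_derivative_def has_derivative_at_withinI)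
    show "onorm (\<lambda>t. t *\<^sub>R g' s) \<le> B"
      using assms(3)[of s] s by (intro onorm_le) (simp add: mult.commute[of B] mult_left_mono)
  qed (use assms(1) in auto)
  then show ?thesis using assms(1) by simp
qed

section \<open>Smooth functions and iterated partial derivatives\<close>

text \<open>Iterated partial derivatives are indexed by words of coordinate directions, the last letter
  acting first. Unlike multi-indices, words can be cut anywhere and admit induction.\<close>

abbreviation pderivs :: "'d::finite list \<Rightarrow> (real^'d \<Rightarrow> complex) \<Rightarrow> real^'d \<Rightarrow> complex" where
  "pderivs w f \<equiv> foldr partial w f"

lemma Ck_SucD: "Ck (Suc k) f \<Longrightarrow> Ck k f"
  by (induction k arbitrary: f) (auto simp: differentiable_imp_continuous_on)

lemma Ck_mono: "Ck k f \<Longrightarrow> j \<le> k \<Longrightarrow> Ck j f"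
proof (induction k)
  case (Suc k)
  then show ?case using Ck_SucD le_Suc_eq by blast
qed simp

lemma Ck_continuous: "Ck k f \<Longrightarrow> continuous_on UNIV f"
  using Ck_mono[of k f 0] by simp

lemma Ck_pderivs: "Ck (k + length w) f \<Longrightarrow> Ck k (pderivs w f)"
  proof (induction w arbitrary: k)
  case (Cons i w)
  then have "Ck (Suc k + length w) f" by (simp del: Ck.simps)
  then have "Ck (Suc k) (pderivs w f)" by (rule Cons.IH)
  then show ?case by simp
qed simp

lemma smooth_Ck: "smooth f \<Longrightarrow> Ck k f"
  by (simp add: smooth_def)

lemma smooth_differentiable: "smooth f \<Longrightarrow> f differentiable_on UNIV"
  using smooth_Ck[of f 1] by simp

lemma smooth_continuous: "smooth f \<Longrightarrow> continuous_on UNIV f"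
  using smooth_Ck[of f 0] by simp

lemma smooth_pderivs: "smooth f \<Longrightarrow> smooth (pderivs w f)"
  unfolding smooth_def using Ck_pderivs by blast

lemma smooth_partial: "smooth f \<Longrightarrow> smooth (partial i f)"
  using smooth_pderivs[of f "[i]"] by simp

lemma partial_differentiable:
  fixes f :: "real^'d::finite \<Rightarrow> complex"
  assumes "f differentiable_on UNIV"
  shows "(f has_derivative (\<lambda>h. \<Sum>i\<in>UNIV. (h $ i) *\<^sub>R partial i f x)) (at x)"
  using assms differentiable_on_UNIV_at has_derivative_partial by blast

lemma Ck_SucI:
  fixes f :: "real^'d::finite \<Rightarrow> complex"
  assumes "\<And>x. (f has_derivative f' x) (at x)" and "\<And>i. Ck k (\<lambda>x. f' x (axis i 1))"
  shows "Ck (Suc k) f"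
proof -
  have "partial i f = (\<lambda>x. f' x (axis i 1))" for i
    using partial_eqI[OF assms(1)] by blast
  moreover have "f differentiable_on UNIV"
    using assms(1) by (auto simp: differentiable_on_def differentiable_def)
  ultimately show ?thesis using assms(2) by simp
qed

lemma axis_sum_simp:
  fixes v :: "'d::finite \<Rightarrow> complex"
  shows "(\<Sum>j\<in>UNIV. (axis i 1 :: real^'d) $ j *\<^sub>R v j) = v i"
proof -
  have "(\<Sum>j\<in>UNIV. (axis i 1 :: real^'d) $ j *\<^sub>R v j) = (\<Sum>j\<in>UNIV. if j = i then v j else 0)"
    by (intro sum.cong) (auto simp: axis_def)
  then show ?thesis by simp
qed

lemma Ck_const: "Ck k (\<lambda>x. c)"
proof (induction k arbitrary: c)
  case (Suc k)
  show ?case by (rule Ck_SucI[where f'="\<lambda>_ _. 0"]) (use Suc in auto)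
qed simp

lemma Ck_add: "Ck k f \<Longrightarrow> Ck k g \<Longrightarrow> Ck k (\<lambda>x. f x + g x)"
proof (induction k arbitrary: f g)
  case (Suc k)
  show ?case
  proof (rule Ck_SucI)
    show "((\<lambda>x. f x + g x) has_derivative (\<lambda>h. (\<Sum>i\<in>UNIV. (h $ i) *\<^sub>R partial i f x) +
       (\<Sum>i\<in>UNIV. (h $ i) *\<^sub>R partial i g x))) (at x)" for x
      using Suc.prems by (auto intro!: derivative_intros partial_differentiable)
    show "Ck k (\<lambda>x. (\<Sum>j\<in>UNIV. axis i 1 $ j *\<^sub>R partial j f x) + (\<Sum>j\<in>UNIV. axis i 1 $ j *\<^sub>R partial j g x))" for i
      using Suc by (simp add: axis_sum_simp)
  qed
qed (auto intro: continuous_intros)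

lemma Ck_sum: "(\<And>a. a \<in> A \<Longrightarrow> Ck k (f a)) \<Longrightarrow> Ck k (\<lambda>x. \<Sum>a\<in>A. f a x)"
  by (induction A rule: infinite_finite_induct) (auto intro: Ck_add Ck_const)

lemma Ck_mult: "Ck k f \<Longrightarrow> Ck k g \<Longrightarrow> Ck k (\<lambda>x. f x * g x)"
proof (induction k arbitrary: f g)
  case (Suc k)
  show ?case
  proof (rule Ck_SucI)
    show "((\<lambda>x. f x * g x) has_derivative (\<lambda>h. f x * (\<Sum>i\<in>UNIV. (h $ i) *\<^sub>R partial i g x) +
       (\<Sum>i\<in>UNIV. (h $ i) *\<^sub>R partial i f x) * g x)) (at x)" for x
      using Suc.prems by (auto intro!: has_derivative_mult partial_differentiable)
    show "Ck k (\<lambda>x. f x * (\<Sum>j\<in>UNIV. axis i 1 $ j *\<^sub>R partial j g x) + (\<Sum>j\<in>UNIV. axis i 1 $ j *\<^sub>R partial j f x) * g x)" for i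
      using Suc.IH[of f "partial i g"] Suc.IH[of "partial i f" g] Suc.prems Ck_SucD[of k f] Ck_SucD[of k g]
      by (simp add: axis_sum_simp Ck_add)
  qed
qed (auto intro: continuous_intros)

lemma has_derivative_affine:
  fixes f :: "real^'d::finite \<Rightarrow> complex"
  assumes "f differentiable_on UNIV"
  shows "((\<lambda>x. f (a + c *\<^sub>R x)) has_derivative
    (\<lambda>h. \<Sum>i\<in>UNIV. (h $ i) *\<^sub>R (of_real c * partial i f (a + c *\<^sub>R x)))) (at x)"
proof -
  have "((\<lambda>x. a + c *\<^sub>R x) has_derivative (\<lambda>h. c *\<^sub>R h)) (at x)"
    by (auto intro!: derivative_eq_intros)
  from has_derivative_compose[OF this partial_differentiable[OF assms]]
  show ?thesis by (simp add: scaleR_conv_of_real[where 'a=complex] mult.assoc mult.left_commute)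
qed

lemma Ck_affine: "Ck k f \<Longrightarrow> Ck k (\<lambda>x. f (a + c *\<^sub>R x))"
proof (induction k arbitrary: f)
  case 0
  then show ?case
    by (auto intro!: continuous_on_compose2[of UNIV f UNIV] continuous_intros)
next
  case (Suc k)
  show ?case
  proof (rule Ck_SucI)
    show "((\<lambda>x. f (a + c *\<^sub>R x)) has_derivative
      (\<lambda>h. \<Sum>i\<in>UNIV. (h $ i) *\<^sub>R (of_real c * partial i f (a + c *\<^sub>R x)))) (at x)" for x
      using Suc.prems by (auto intro: has_derivative_affine)
    show "Ck k (\<lambda>x. \<Sum>j\<in>UNIV. axis i 1 $ j *\<^sub>R (of_real c * partial j f (a + c *\<^sub>R x)))" for i
      using Suc by (auto simp: axis_sum_simp intro!: Ck_mult Ck_const)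
  qed
qed

lemma smooth_const: "smooth (\<lambda>x. b)"
  and smooth_add: "smooth f \<Longrightarrow> smooth g \<Longrightarrow> smooth (\<lambda>x. f x + g x)"
  and smooth_mult: "smooth f \<Longrightarrow> smooth g \<Longrightarrow> smooth (\<lambda>x. f x * g x)"
  and smooth_sum: "(\<And>a. a \<in> A \<Longrightarrow> smooth (F a)) \<Longrightarrow> smooth (\<lambda>x. \<Sum>a\<in>A. F a x)"
  and smooth_affine: "smooth f \<Longrightarrow> smooth (\<lambda>x. f (a + c *\<^sub>R x))"
  by (auto simp: smooth_def Ck_const Ck_add Ck_mult Ck_sum Ck_affine)

lemma partial_add:
  assumes "f differentiable_on UNIV" "g differentiable_on UNIV"
  shows "partial i (\<lambda>x. f x + g x) = (\<lambda>x. partial i f x + partial i g x)"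
  by (rule ext, subst partial_eqI[OF has_derivative_add[OF partial_differentiable partial_differentiable]])
     (use assms in \<open>auto simp: axis_sum_simp\<close>)

lemma partial_mult:
  assumes "f differentiable_on UNIV" "g differentiable_on UNIV"
  shows "partial i (\<lambda>x. f x * g x) = (\<lambda>x. f x * partial i g x + partial i f x * g x)"
  by (rule ext, subst partial_eqI[OF has_derivative_mult[OF partial_differentiable partial_differentiable]])
     (use assms in \<open>auto simp: axis_sum_simp\<close>)

lemma partial_affine:
  assumes "f differentiable_on UNIV"
  shows "partial i (\<lambda>x. f (a + c *\<^sub>R x)) = (\<lambda>x. of_real c * partial i f (a + c *\<^sub>R x))"
  by (rule ext, subst partial_eqI[OF has_derivative_affine[OF assms]]) (simp only: axis_sum_simp)

lemma partial_const: "partial i (\<lambda>x. c) = (\<lambda>x. 0)"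
  by (rule ext, subst partial_eqI[OF has_derivative_const]) simp

lemma pderivs_const: "pderivs w (\<lambda>x. c) = (\<lambda>x. if w = [] then c else 0)"
  by (induction w) (auto simp: partial_const)

lemma pderivs_add:
  assumes "smooth f" "smooth g"
  shows "pderivs w (\<lambda>x. f x + g x) = (\<lambda>x. pderivs w f x + pderivs w g x)"
  by (induction w) (auto simp: partial_add smooth_differentiable smooth_pderivs assms)

lemma partial_cmult:
  assumes "f differentiable_on UNIV"
  shows "partial i (\<lambda>x. c * f x) = (\<lambda>x. c * partial i f x)"
  using partial_mult[of "\<lambda>x. c" f i] assms by (simp add: partial_const)

lemma pderivs_cmult:
  assumes "smooth f"
  shows "pderivs w (\<lambda>x. c * f x) = (\<lambda>x. c * pderivs w f x)"
  by (induction w) (auto simp: partial_cmult smooth_differentiable smooth_pderivs assms)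

lemma pderivs_sum:
  assumes "\<And>a. a \<in> A \<Longrightarrow> smooth (f a)"
  shows "pderivs w (\<lambda>x. \<Sum>a\<in>A. f a x) = (\<lambda>x. \<Sum>a\<in>A. pderivs w (f a) x)"
  using assms
  by (induction A rule: infinite_finite_induct) (auto simp: pderivs_const pderivs_add smooth_sum)

lemma pderivs_affine:
  assumes "smooth f"
  shows "pderivs w (\<lambda>x. f (a + c *\<^sub>R x)) = (\<lambda>x. of_real c ^ length w * pderivs w f (a + c *\<^sub>R x))"
proof (induction w)
  case (Cons i w)
  have "smooth (\<lambda>x. pderivs w f (a + c *\<^sub>R x))"
    by (intro smooth_affine smooth_pderivs assms)
  then show ?case
    using Cons by (simp add: partial_cmult partial_affine smooth_differentiable smooth_pderivs assms mult_ac)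
qed simp

text \<open>The second difference in two coordinate directions approximates the mixed derivative; as
  it is symmetric in the two directions, so is the mixed derivative.\<close>

lemma second_difference_bound:
  fixes f :: "real^'d::finite \<Rightarrow> complex"
  assumes f: "Ck 2 f" and "e > 0"
  shows "\<exists>\<delta>>0. \<forall>h. 0 \<le> h \<and> h < \<delta> \<longrightarrow>
    norm (f (x + h *\<^sub>R evec i + h *\<^sub>R evec j) - f (x + h *\<^sub>R evec i) - f (x + h *\<^sub>R evec j) + f x
      - of_real (h * h) * partial j (partial i f) x) \<le> e * h * h"
proof -
  let ?c = "partial j (partial i f) x"
  have df: "f differentiable_on UNIV" and dp: "partial i f differentiable_on UNIV"
    and cp: "continuous_on UNIV (partial j (partial i f))"
    using f by (auto simp: numeral_2_eq_2)
  have "isCont (partial j (partial i f)) x"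
    using cp by (simp add: continuous_on_eq_continuous_at)
  then obtain d where d: "d > 0" "\<And>y. dist y x < d \<Longrightarrow> dist (partial j (partial i f) y) ?c < e"
    using \<open>e > 0\<close> unfolding continuous_at_eps_delta by blast
  have near: "norm (partial j (partial i f) (x + s *\<^sub>R evec i + t *\<^sub>R evec j) - ?c) \<le> e"
    if "0 \<le> s" "s < d/2" "0 \<le> t" "t < d/2" for s t
  proof -
    have "norm (s *\<^sub>R evec i + t *\<^sub>R evec j) \<le> s + t"
      using that by (intro order_trans[OF norm_triangle_ineq]) auto
    then show ?thesis using d(2)[of "x + s *\<^sub>R evec i + t *\<^sub>R evec j"] that
      by (simp add: dist_norm add.assoc less_imp_le)
  qed
  show ?thesis
  proof (intro exI[of _ "d/2"] conjI allI impI)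
    fix h assume h: "0 \<le> h \<and> h < d/2"
    define g where "g s = f (x + h *\<^sub>R evec j + s *\<^sub>R evec i) - f (x + s *\<^sub>R evec i) - of_real (s * h) * ?c" for s
    define g' where "g' s = partial i f (x + h *\<^sub>R evec j + s *\<^sub>R evec i) - partial i f (x + s *\<^sub>R evec i) - of_real h * ?c" for s
    have gd: "(g has_vector_derivative g' s) (at s)" for s
      unfolding g_def g'_def
      by (intro has_vector_derivative_diff partial_vector_derivative df)
         (auto intro!: derivative_eq_intros simp: has_vector_derivative_def scaleR_conv_of_real)
    have "norm (g' s) \<le> e * h" if s: "0 \<le> s" "s \<le> h" for s
    proof -
      define q where "q t = partial i f (x + s *\<^sub>R evec i + t *\<^sub>R evec j) - of_real t * ?c" for t
      have "norm (q h - q 0) \<le> e * h"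
      proof (rule mean_value_bound)
        show "(q has_vector_derivative partial j (partial i f) (x + s *\<^sub>R evec i + t *\<^sub>R evec j) - ?c) (at t)" for t
          unfolding q_def
          by (intro has_vector_derivative_diff partial_vector_derivative dp)
             (auto intro!: derivative_eq_intros simp: has_vector_derivative_def scaleR_conv_of_real)
      qed (use h s near in auto)
      moreover have "q h - q 0 = g' s"
        by (simp add: q_def g'_def algebra_simps)
      ultimately show ?thesis by simp
    qed
    then have "norm (g h - g 0) \<le> e * h * h"
      using h gd by (intro mean_value_bound) auto
    moreover have "g h - g 0 = f (x + h *\<^sub>R evec i + h *\<^sub>R evec j) - f (x + h *\<^sub>R evec i)
      - f (x + h *\<^sub>R evec j) + f x - of_real (h * h) * ?c"
      by (simp add: g_def algebra_simps)
    ultimately show "norm (f (x + h *\<^sub>R evec i + h *\<^sub>R evec j) - f (x + h *\<^sub>R evec i)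
      - f (x + h *\<^sub>R evec j) + f x - of_real (h * h) * ?c) \<le> e * h * h" by simp
  qed (use d in simp)
qed

lemma partial_commute:
  fixes f :: "real^'d::finite \<Rightarrow> complex"
  assumes f: "Ck 2 f"
  shows "partial i (partial j f) = partial j (partial i f)"
proof (rule ext, rule ccontr)
  fix x
  let ?c = "partial j (partial i f) x" and ?c' = "partial i (partial j f) x"
  assume "?c' \<noteq> ?c"
  define e where "e = norm (?c - ?c') / 3"
  have e: "e > 0" using \<open>?c' \<noteq> ?c\<close> by (simp add: e_def)
  obtain d where d: "d > 0" and dd: "\<And>h. 0 \<le> h \<Longrightarrow> h < d \<Longrightarrow>
    norm (f (x + h *\<^sub>R evec i + h *\<^sub>R evec j) - f (x + h *\<^sub>R evec i) - f (x + h *\<^sub>R evec j) + f x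
      - of_real (h * h) * ?c) \<le> e * h * h"
    using second_difference_bound[OF f e, of x i j] by auto
  obtain d' where d': "d' > 0" and dd': "\<And>h. 0 \<le> h \<Longrightarrow> h < d' \<Longrightarrow>
    norm (f (x + h *\<^sub>R evec j + h *\<^sub>R evec i) - f (x + h *\<^sub>R evec j) - f (x + h *\<^sub>R evec i) + f x
      - of_real (h * h) * ?c') \<le> e * h * h"
    using second_difference_bound[OF f e, of x j i] by auto
  define h where "h = min d d' / 2"
  have h: "h > 0" "h < d" "h < d'" using d d' by (auto simp: h_def)
  define D where "D = f (x + h *\<^sub>R evec i + h *\<^sub>R evec j) - f (x + h *\<^sub>R evec i) - f (x + h *\<^sub>R evec j) + f x"
  have "norm (D - of_real (h * h) * ?c) \<le> e * h * h"
    unfolding D_def using dd[of h] h by simp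
  moreover have "norm (D - of_real (h * h) * ?c') \<le> e * h * h"
  proof -
    have "D = f (x + h *\<^sub>R evec j + h *\<^sub>R evec i) - f (x + h *\<^sub>R evec j) - f (x + h *\<^sub>R evec i) + f x"
      by (simp add: D_def add_ac)
    then show ?thesis using dd'[of h] h by simp
  qed
  ultimately have "norm ((D - of_real (h * h) * ?c') - (D - of_real (h * h) * ?c)) \<le> 2 * (e * h * h)"
    by (intro order_trans[OF norm_triangle_ineq4]) linarith
  also have "(D - of_real (h * h) * ?c') - (D - of_real (h * h) * ?c) = of_real (h * h) * (?c - ?c')"
    by (simp add: algebra_simps)
  finally have "(h * h) * norm (?c - ?c') \<le> (h * h) * (2 * e)"
    by (simp add: norm_mult power2_eq_square mult_ac)
  then have "norm (?c - ?c') \<le> 2 * e" using h by simp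
  then show False using e by (simp add: e_def)
qed

text \<open>For smooth functions the order of the letters is immaterial, so that bounds for multi-indices
  and for words are equivalent.\<close>

lemma pderivs_partial:
  "smooth f \<Longrightarrow> pderivs w (partial i f) = partial i (pderivs w f)"
  by (induction w) (auto simp: partial_commute smooth_Ck smooth_pderivs)

lemma pderivs_pderivs: "pderivs v (pderivs w f) = pderivs (v @ w) f"
  by simp

lemma pderivs_mset_cong:
  assumes "smooth f" "mset v = mset w"
  shows "pderivs v f = pderivs w f"
  using assms(2)
proof (induction v arbitrary: w)
  case (Cons i v)
  then have "i \<in> set w" by (metis list.set_intros(1) mset_eq_setD)
  then obtain w1 w2 where w: "w = w1 @ i # w2" by (meson split_list)
  then have "pderivs v f = pderivs (w1 @ w2) f" using Cons.prems by (intro Cons.IH) auto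
  then show ?case
    using w pderivs_partial[of "pderivs w2 f" w1 i] smooth_pderivs[OF assms(1)] by simp
qed simp

text \<open>The canonical word of a multi-index: the directions in which \<^const>\<open>mpartial\<close>
  differentiates, in the fixed enumeration of the coordinates.\<close>

definition mi_word :: "('d::finite \<Rightarrow> nat) \<Rightarrow> 'd list" where
  "mi_word m = concat (map (\<lambda>i. replicate (m i) i) (SOME is. distinct is \<and> set is = UNIV))"

lemma enum_SOME:
  "distinct (SOME is. distinct is \<and> set is = (UNIV::'d::finite set)) \<and>
   set (SOME is. distinct is \<and> set is = (UNIV::'d set)) = UNIV"
  using finite_distinct_list[OF finite[of "UNIV::'d set"]] by (intro someI_ex[of "\<lambda>is. distinct is \<and> set is = UNIV"]) blast

lemma mpartial_word: "mpartial m f = pderivs (mi_word m) f"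
proof -
  have "foldr (\<lambda>i. partial i ^^ m i) is f = pderivs (concat (map (\<lambda>i. replicate (m i) i) is)) f" for "is"
    by (induction "is") (auto simp: foldr_replicate)
  then show ?thesis by (simp add: mpartial_def mi_word_def)
qed

lemma count_concat_replicate:
  "distinct is \<Longrightarrow> count (mset (concat (map (\<lambda>i. replicate (m i) i) is))) j = (if j \<in> set is then m j else 0)"
  by (induction "is") auto

lemma count_mi_word: "count (mset (mi_word m)) j = m j"
  using enum_SOME[where 'd='a] by (simp add: mi_word_def count_concat_replicate del: count_mset)

lemma length_mi_word: "length (mi_word m) = mi_order m"
proof -
  have "length (mi_word m) = size (mset (mi_word m))" by simp
  also have "\<dots> = (\<Sum>i\<in>UNIV. count (mset (mi_word m)) i)"
    by (subst size_multiset_overloaded_eq, rule sum.mono_neutral_left) (auto simp: not_in_iff)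
  finally show ?thesis by (simp add: mi_order_def count_mi_word)
qed

lemma pderivs_eq_mpartial:
  assumes "smooth f"
  shows "pderivs w f = mpartial (count (mset w)) f"
  unfolding mpartial_word
  by (rule pderivs_mset_cong[OF assms]) (rule multiset_eqI, simp add: count_mi_word)

lemma mi_order_word: "mi_order (count (mset w)) = length w"
proof -
  have "mset (mi_word (count (mset w))) = mset w"
    by (rule multiset_eqI) (simp add: count_mi_word)
  then have "length (mi_word (count (mset w))) = length w" by (metis size_mset)
  then show ?thesis by (simp add: length_mi_word)
qed

text \<open>Every suffix of a canonical word is canonical. This is what allows the derivatives to be
  split between two factors of a convolution when one of them has only finite regularity.\<close>

lemma concat_replicate_suffix:
  "concat (map (\<lambda>i. replicate (m i) i) is) = p @ s \<Longrightarrow> distinct is \<Longrightarrow>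
   \<exists>m'. s = concat (map (\<lambda>i. replicate (m' i) i) is) \<and> (\<forall>i. i \<notin> set is \<longrightarrow> m' i = m i)"
proof (induction "is" arbitrary: p s)
  case Nil
  then show ?case by auto
next
  case (Cons a "is")
  from Cons.prems(1) have eq: "replicate (m a) a @ concat (map (\<lambda>i. replicate (m i) i) is) = p @ s"
    by simp
  then consider us where "replicate (m a) a @ us = p" "concat (map (\<lambda>i. replicate (m i) i) is) = us @ s"
    | us where "replicate (m a) a = p @ us" "us @ concat (map (\<lambda>i. replicate (m i) i) is) = s"
    by (auto simp: append_eq_append_conv2)
  then show ?case
  proof cases
    case (1 us)
    obtain m' where m': "s = concat (map (\<lambda>i. replicate (m' i) i) is)" "\<forall>i. i \<notin> set is \<longrightarrow> m' i = m i"
      using Cons.IH[OF 1(2)] Cons.prems by auto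
    have *: "concat (map (\<lambda>i. replicate ((m'(a := 0)) i) i) is) = concat (map (\<lambda>i. replicate (m' i) i) is)"
      using Cons.prems by (intro arg_cong[where f=concat] map_cong) auto
    have "s = concat (map (\<lambda>i. replicate ((m'(a := 0)) i) i) (a # is))"
      using m'(1) * by simp
    then show ?thesis using m'(2) by (intro exI[of _ "m'(a := 0)"]) auto
  next
    case (2 us)
    have "set (p @ us) \<subseteq> {a}"
      unfolding 2(1)[symmetric] by (auto simp: set_replicate_conv_if)
    then have "set us \<subseteq> {a}" by simp
    then have us: "replicate (length us) a = us"
      by (intro replicate_eqI[symmetric]) auto
    have *: "concat (map (\<lambda>i. replicate ((m(a := length us)) i) i) is) = concat (map (\<lambda>i. replicate (m i) i) is)"
      using Cons.prems by (intro arg_cong[where f=concat] map_cong) auto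
    have "s = concat (map (\<lambda>i. replicate ((m(a := length us)) i) i) (a # is))"
      using 2(2) us * by simp
    then show ?thesis
      by (intro exI[of _ "m(a := length us)"]) auto
  qed
qed

lemma mi_word_suffix:
  assumes "mi_word m = p @ s"
  shows "\<exists>m'. s = mi_word m'"
proof -
  have "distinct (SOME is. distinct is \<and> set is = (UNIV::'a set))"
    using enum_SOME by blast
  from concat_replicate_suffix[OF assms[unfolded mi_word_def] this]
  show ?thesis unfolding mi_word_def by blast
qed

section \<open>Bump functions and cutoffs\<close>

text \<open>A flat function is \<open>p (1/t) exp (-1/t)\<close> for positive \<open>t\<close> and \<open>0\<close> elsewhere, with
  a polynomial \<open>p\<close>. Differentiation maps this class into itself, replacing \<open>p\<close> by
  \<open>(p - p') X\<^sup>2\<close>.\<close>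

definition flat :: "real poly \<Rightarrow> real \<Rightarrow> real" where
  "flat p t = (if t > 0 then poly p (1/t) * exp (- (1/t)) else 0)"

definition flat_deriv :: "real poly \<Rightarrow> real poly" where
  "flat_deriv p = (p - pderiv p) * [:0, 0, 1:]"

lemma poly_exp_tendsto_0: "((\<lambda>u. poly p u * exp (- u :: real)) \<longlongrightarrow> 0) at_top"
proof -
  have "((\<lambda>u. \<Sum>i\<le>degree p. coeff p i * (u ^ i / exp u)) \<longlongrightarrow> (\<Sum>i\<le>degree p. coeff p i * 0)) at_top"
    by (intro tendsto_sum tendsto_mult tendsto_const tendsto_power_div_exp_0)
  then show ?thesis
    by (simp add: poly_altdef sum_distrib_right sum_divide_distrib exp_minus field_simps)
qed

lemma flat_tendsto_0: "(flat p \<longlongrightarrow> 0) (at 0)"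
proof -
  have "((\<lambda>t. poly p (inverse t) * exp (- inverse t)) \<longlongrightarrow> 0) (at_right (0::real))"
    using filterlim_compose[OF poly_exp_tendsto_0 filterlim_inverse_at_top_right] .
  then have r: "(flat p \<longlongrightarrow> 0) (at_right 0)"
    by (rule Lim_transform_eventually)
       (auto simp: flat_def eventually_at_right_field inverse_eq_divide intro!: exI[of _ 1])
  have "((\<lambda>_. 0) \<longlongrightarrow> (0::real)) (at_left (0::real))" by simp
  then have l: "(flat p \<longlongrightarrow> 0) (at_left 0)"
    by (rule Lim_transform_eventually)
       (auto simp: flat_def eventually_at_left_field intro!: exI[of _ "-1"])
  from r l show ?thesis by (simp add: filterlim_split_at)
qed

lemma flat_has_derivative: "(flat p has_real_derivative flat (flat_deriv p) t) (at t)"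
proof -
  consider "t > 0" | "t < 0" | "t = 0" by linarith
  then show ?thesis
  proof cases
    case 1
    have "((\<lambda>t. poly p (1/t) * exp (- (1/t))) has_real_derivative flat (flat_deriv p) t) (at t)"
      using 1 by (auto intro!: derivative_eq_intros poly_DERIV[THEN DERIV_chain2]
          simp: flat_def flat_deriv_def field_simps power2_eq_square)
    then show ?thesis
      by (rule has_field_derivative_transform_within_open[where S="{0<..}"])
         (use 1 in \<open>auto simp: flat_def\<close>)
  next
    case 2
    have "((\<lambda>t. 0) has_real_derivative flat (flat_deriv p) t) (at t)"
      using 2 by (simp add: flat_def)
    then show ?thesis
      by (rule has_field_derivative_transform_within_open[where S="{..<0}"])
         (use 2 in \<open>auto simp: flat_def\<close>)
  next
    case 3
    have "(\<lambda>h. (flat p (0 + h) - flat p 0) / h) = flat ([:0,1:] * p)"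
      by (rule ext) (auto simp: flat_def field_simps)
    then have "(\<lambda>h. (flat p (0 + h) - flat p 0) / h) \<midarrow>0\<rightarrow> 0"
      using flat_tendsto_0 by simp
    then show ?thesis using 3 by (simp add: DERIV_def flat_def)
  qed
qed

lemma Ck_of_real_Re: "Ck k q \<Longrightarrow> Ck k (\<lambda>x. of_real (Re (q x)))"
proof (induction k arbitrary: q)
  case (Suc k)
  show ?case
  proof (rule Ck_SucI)
    show "((\<lambda>x. of_real (Re (q x))) has_derivative
      (\<lambda>h. of_real (Re (\<Sum>i\<in>UNIV. (h $ i) *\<^sub>R partial i q x)))) (at x)" for x
      using Suc.prems
      by (intro has_derivative_of_real has_derivative_Re partial_differentiable) simp
    show "Ck k (\<lambda>x. of_real (Re (\<Sum>j\<in>UNIV. axis i 1 $ j *\<^sub>R partial j q x)))" for i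
      unfolding axis_sum_simp using Suc by auto
  qed
qed (auto intro: continuous_intros)

lemma Ck_flat_comp: "Ck k q \<Longrightarrow> Ck k (\<lambda>x. of_real (flat p (Re (q x))))"
proof (induction k arbitrary: p)
  case 0
  have "continuous_on UNIV (flat p)"
    using flat_has_derivative DERIV_isCont by (blast intro: continuous_at_imp_continuous_on)
  then show ?case using 0
    by (auto intro!: continuous_intros continuous_on_compose2[of UNIV "flat p" UNIV])
next
  case (Suc k)
  show ?case
  proof (rule Ck_SucI)
    fix x
    have "((\<lambda>x. Re (q x)) has_derivative (\<lambda>h. Re (\<Sum>i\<in>UNIV. (h $ i) *\<^sub>R partial i q x))) (at x)"
      using Suc.prems by (intro has_derivative_Re partial_differentiable) simp
    from has_derivative_compose[OF this flat_has_derivative[of p "Re (q x)", unfolded has_field_derivative_def]]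
    show "((\<lambda>x. of_real (flat p (Re (q x)))) has_derivative (\<lambda>h. of_real (flat (flat_deriv p) (Re (q x)))
        * of_real (Re (\<Sum>i\<in>UNIV. (h $ i) *\<^sub>R partial i q x)) :: complex)) (at x)"
      by (auto dest!: has_derivative_of_real[where 'a=complex])
  next
    fix i
    show "Ck k (\<lambda>x. of_real (flat (flat_deriv p) (Re (q x)))
        * of_real (Re (\<Sum>j\<in>UNIV. axis i 1 $ j *\<^sub>R partial j q x)))"
      unfolding axis_sum_simp
      using Suc.IH Ck_SucD[OF Suc.prems] Suc.prems
      by (auto intro!: Ck_mult Ck_of_real_Re)
  qed
qed

lemma Ck_coordinate: "Ck k (\<lambda>x. of_real (x $ j))"
proof (cases k)
  case (Suc l)
  show ?thesis unfolding Suc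
  proof (rule Ck_SucI)
    show "((\<lambda>x. of_real (x $ j)) has_derivative (\<lambda>h. of_real (h $ j))) (at x)" for x
      by (intro has_derivative_of_real bounded_linear.has_derivative[OF bounded_linear_vec_nth] has_derivative_ident)
    show "Ck l (\<lambda>x. of_real (axis i 1 $ j))" for i by (rule Ck_const)
  qed
qed (auto intro!: continuous_intros)

lemma Ck_norm_square: "Ck k (\<lambda>x. of_real ((norm (x - a))\<^sup>2))"
proof -
  have "(\<lambda>x. of_real ((norm (x - a))\<^sup>2) :: complex) =
     (\<lambda>x. \<Sum>j\<in>UNIV. (of_real (x $ j) + - of_real (a $ j)) * (of_real (x $ j) + - of_real (a $ j)))"
    by (rule ext) (simp add: power2_norm_eq_inner inner_vec_def)
  moreover have "Ck k (\<lambda>x. \<Sum>j\<in>UNIV. (of_real (x $ j) + - of_real (a $ j)) * (of_real (x $ j) + - of_real (a $ j)))"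
    by (intro Ck_sum Ck_mult Ck_add Ck_coordinate Ck_const)
  ultimately show ?thesis by simp
qed

lemma flat_1_mono: "s \<le> t \<Longrightarrow> flat 1 s \<le> flat 1 t"
  by (auto simp: flat_def field_simps)

text \<open>A plateau: equal to \<open>1\<close> on the closed ball of radius \<open>r\<close> and to \<open>0\<close> off the ball of
  radius \<open>2 r\<close>. With \<open>\<rho> = flat 1\<close> and \<open>c = \<rho> (3 r\<^sup>2)\<close>, the function \<open>\<rho> (c - \<rho> t)\<close> of \<open>t\<close> vanishes
  for \<open>t \<ge> 3 r\<^sup>2\<close> and is constant for \<open>t \<le> 0\<close>, so that a nested application of \<open>\<rho>\<close> gives a smooth
  step without any integration.\<close>

definition plateau :: "real^'d::finite \<Rightarrow> real \<Rightarrow> real^'d \<Rightarrow> real" where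
  "plateau a r x = flat 1 (flat 1 (3 * r\<^sup>2) - flat 1 ((norm (x - a))\<^sup>2 - r\<^sup>2)) / flat 1 (flat 1 (3 * r\<^sup>2))"

lemma plateau_smooth: "smooth (\<lambda>x. of_real (plateau a r x))"
  unfolding smooth_def
proof
  fix k
  have 1: "Ck k (\<lambda>x. of_real (flat 1 ((norm (x - a))\<^sup>2 - r\<^sup>2)))"
    using Ck_flat_comp[OF Ck_add[OF Ck_norm_square[of k a] Ck_const[of k "- of_real (r\<^sup>2)"]], of 1] by simp
  have "Ck k (\<lambda>x. of_real (flat 1 (flat 1 (3 * r\<^sup>2) - flat 1 ((norm (x - a))\<^sup>2 - r\<^sup>2))))"
    using Ck_flat_comp[OF Ck_add[OF Ck_const[of k "of_real (flat 1 (3 * r\<^sup>2))"]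
        Ck_mult[OF Ck_const[of k "- 1"] 1]], of 1] by simp
  from Ck_mult[OF this Ck_const[of k "of_real (1 / flat 1 (flat 1 (3 * r\<^sup>2)))"]]
  show "Ck k (\<lambda>x. of_real (plateau a r x))"
    by (simp add: plateau_def)
qed

lemma flat_1_pos: "t > 0 \<Longrightarrow> flat 1 t > 0" and flat_1_nonneg: "flat 1 t \<ge> 0"
  and flat_nonpos: "t \<le> 0 \<Longrightarrow> flat p t = 0"
  by (auto simp: flat_def)

lemma plateau_nonneg: "plateau a r x \<ge> 0"
  by (simp add: plateau_def flat_1_nonneg)

lemma plateau_eq_1:
  assumes "r > 0" "norm (x - a) \<le> r"
  shows "plateau a r x = 1"
proof -
  have "(norm (x - a))\<^sup>2 \<le> r\<^sup>2" using assms by (simp add: power_mono)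
  then show ?thesis using assms by (simp add: plateau_def flat_nonpos flat_1_pos less_imp_neq[symmetric])
qed

lemma plateau_eq_0:
  assumes "r > 0" "norm (x - a) \<ge> 2 * r"
  shows "plateau a r x = 0"
proof -
  have "(2 * r)\<^sup>2 \<le> (norm (x - a))\<^sup>2" using assms by (intro power_mono) auto
  then have "3 * r\<^sup>2 \<le> (norm (x - a))\<^sup>2 - r\<^sup>2" by (simp add: power2_eq_square)
  then show ?thesis using flat_1_mono by (simp add: plateau_def flat_nonpos)
qed

lemma fun_support_subsetI:
  assumes "closed K" "\<And>x. x \<notin> K \<Longrightarrow> f x = 0"
  shows "fun_support f \<subseteq> K"
  unfolding fun_support_def by (rule closure_minimal) (use assms in auto)

lemma fun_support_zero: "x \<notin> fun_support f \<Longrightarrow> f x = 0"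
  using closure_subset[of "{x. f x \<noteq> 0}"] by (auto simp: fun_support_def)

lemma test_functionsI:
  assumes "smooth f" "compact K" "K \<subseteq> U" "\<And>x. x \<notin> K \<Longrightarrow> f x = 0"
  shows "f \<in> test_functions U"
proof -
  have s: "fun_support f \<subseteq> K"
    using fun_support_subsetI[of K f] assms compact_imp_closed by blast
  then have "bounded (fun_support f)" using assms(2) compact_imp_bounded bounded_subset by blast
  then have "compact (fun_support f)"
    by (simp add: compact_eq_bounded_closed) (simp add: fun_support_def)
  then show ?thesis using s assms by (auto simp: test_functions_def)
qed

lemma plateau_test:
  assumes "r > 0" "cball a (2 * r) \<subseteq> U"
  shows "(\<lambda>x. of_real (plateau a r x)) \<in> test_functions U"
proof (rule test_functionsI[where K="cball a (2*r)"])
  show "of_real (plateau a r x) = (0::complex)" if "x \<notin> cball a (2*r)" for x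
    using that plateau_eq_0[of r x a] assms(1) by (simp add: dist_norm norm_minus_commute)
qed (simp_all add: plateau_smooth assms)

text \<open>For finitely many plateaus \<open>b\<close> that equal \<open>1\<close> on balls covering \<open>K\<close>, the function
  \<open>1 - \<Prod> (1 - b)\<close> equals \<open>1\<close> on the union of these balls.\<close>

lemma cutoff_exists:
  fixes \<Omega> :: "(real^'d::finite) set"
  assumes "open \<Omega>" "compact K" "K \<subseteq> \<Omega>"
  shows "\<exists>\<eta>. \<eta> \<in> cutoffs \<Omega> K"
proof -
  have "\<exists>r>0. cball x (2 * r) \<subseteq> \<Omega>" if "x \<in> K" for x
  proof -
    have "x \<in> \<Omega>" using assms(3) that by (rule subsetD)
    then obtain e where "e > 0" "cball x e \<subseteq> \<Omega>"
      using open_contains_cball_eq[OF assms(1)] by metis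
    then have "e / 2 > 0 \<and> cball x (2 * (e / 2)) \<subseteq> \<Omega>" by simp
    then show ?thesis by (rule exI)
  qed
  then obtain r where r: "\<And>x. x \<in> K \<Longrightarrow> r x > 0 \<and> cball x (2 * r x) \<subseteq> \<Omega>" by metis
  have "K \<subseteq> (\<Union>x\<in>K. ball x (r x))" using r by force
  then obtain Z where Z: "Z \<subseteq> K" "finite Z" "K \<subseteq> (\<Union>x\<in>Z. ball x (r x))"
    using compactE_image[OF assms(2), of K "\<lambda>x. ball x (r x)"] by auto
  define \<eta> where "\<eta> x = (1 - (\<Prod>z\<in>Z. (1 - of_real (plateau z (r z) x))) :: complex)" for x
  have "\<eta> \<in> test_functions \<Omega>"
  proof (rule test_functionsI[where K="\<Union>z\<in>Z. cball z (2 * r z)"])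
    have sm: "smooth (\<lambda>x. 1 + (- 1) * of_real (plateau z (r z) x))" for z
      by (intro smooth_add smooth_mult smooth_const plateau_smooth)
    have "smooth (\<lambda>x. \<Prod>z\<in>Z. (1 + (- 1) * of_real (plateau z (r z) x)))"
      by (induction Z rule: infinite_finite_induct) (simp_all only: prod.infinite prod.empty prod.insert smooth_const smooth_mult sm not_False_eq_True)
    from smooth_add[OF smooth_const[of 1] smooth_mult[OF smooth_const[of "-1"] this]]
    show "smooth \<eta>" by (simp add: \<eta>_def[abs_def])
    show "compact (\<Union>z\<in>Z. cball z (2 * r z))" using Z by auto
    show "(\<Union>z\<in>Z. cball z (2 * r z)) \<subseteq> \<Omega>" using Z r by blast
    fix x assume x: "x \<notin> (\<Union>z\<in>Z. cball z (2 * r z))"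
    have "plateau z (r z) x = 0" if "z \<in> Z" for z
      using x that Z r by (intro plateau_eq_0) (force simp: dist_norm norm_minus_commute)+
    then show "\<eta> x = 0" by (simp add: \<eta>_def)
  qed
  moreover have "\<forall>x\<in>(\<Union>z\<in>Z. ball z (r z)). \<eta> x = 1"
  proof
    fix x assume "x \<in> (\<Union>z\<in>Z. ball z (r z))"
    then obtain z where z: "z \<in> Z" "dist z x < r z" by auto
    then have "plateau z (r z) x = 1"
      using r Z by (intro plateau_eq_1) (auto simp: dist_norm norm_minus_commute less_imp_le)
    then have "(\<Prod>z\<in>Z. (1 - of_real (plateau z (r z) x) :: complex)) = 0"
      using z Z by (intro prod_zero) auto
    then show "\<eta> x = 1" by (simp add: \<eta>_def)
  qed
  ultimately show ?thesis
    unfolding cutoffs_def using Z by (auto intro!: exI[of _ \<eta>] exI[of _ "\<Union>z\<in>Z. ball z (r z)"])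
qed

section \<open>Functions with bounded derivatives\<close>

text \<open>Smooth functions all of whose partial derivatives are bounded on the whole space.\<close>

definition bsmooth :: "(real^'d::finite \<Rightarrow> complex) \<Rightarrow> bool" where
  "bsmooth f \<longleftrightarrow> smooth f \<and> (\<forall>w. \<exists>B. \<forall>x. norm (pderivs w f x) \<le> B)"

lemma bsmooth_smooth: "bsmooth f \<Longrightarrow> smooth f"
  by (simp add: bsmooth_def)

lemma finite_words: "finite {w :: 'd::finite list. length w \<le> l}"
  using finite_lists_length_le[of "UNIV :: 'd set" l] by simp

lemma bound_over_words:
  assumes "\<And>w :: 'd::finite list. \<exists>B. \<forall>x. g w x \<le> (B::real)"
  obtains B where "B \<ge> 0" "\<And>w x. length w \<le> l \<Longrightarrow> g w x \<le> B"
proof -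
  obtain b where b: "\<And>w x. g w x \<le> b w" using assms by metis
  show ?thesis
  proof (rule that[of "\<Sum>w | length w \<le> l. \<bar>b w\<bar>"])
    fix w :: "'d list" and x assume "length w \<le> l"
    then have "\<bar>b w\<bar> \<le> (\<Sum>w | length w \<le> l. \<bar>b w\<bar>)"
      using finite_words by (intro member_le_sum) auto
    then show "g w x \<le> (\<Sum>w | length w \<le> l. \<bar>b w\<bar>)" using b[of w x] by linarith
  qed (simp add: sum_nonneg)
qed

lemma bsmooth_bound_upto:
  assumes "bsmooth f"
  obtains B where "B \<ge> 0" "\<And>w x. length w \<le> l \<Longrightarrow> norm (pderivs w f x) \<le> B"
  by (rule bound_over_words[of "\<lambda>w x. norm (pderivs w f x)" l])
     (use assms in \<open>auto simp: bsmooth_def\<close>)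

lemma bsmooth_bound:
  assumes "bsmooth f"
  obtains B where "B \<ge> 0" "\<And>x. norm (f x) \<le> B"
  by (rule bsmooth_bound_upto[OF assms, of 0]) force

lemma bsmoothI:
  assumes "smooth f" "\<And>w x. norm (pderivs w f x) \<le> B w"
  shows "bsmooth f"
  using assms unfolding bsmooth_def by blast

lemma bsmooth_pderivs:
  assumes "bsmooth f" shows "bsmooth (pderivs w f)"
proof -
  have "\<exists>B. \<forall>x. norm (pderivs v (pderivs w f) x) \<le> B" for v
    using assms unfolding bsmooth_def pderivs_pderivs by blast
  then show ?thesis using assms smooth_pderivs unfolding bsmooth_def by blast
qed

lemma bsmooth_partial: "bsmooth f \<Longrightarrow> bsmooth (partial i f)"
  using bsmooth_pderivs[of f "[i]"] by simp

lemma bsmooth_const: "bsmooth (\<lambda>x. b)"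
  by (rule bsmoothI[where B="\<lambda>w. norm b"]) (auto simp: smooth_const pderivs_const)

lemma bsmooth_add:
  assumes "bsmooth f" "bsmooth g"
  shows "bsmooth (\<lambda>x. f x + g x)"
proof -
  obtain b where b: "\<And>w x. norm (pderivs w f x) \<le> b w"
    using assms(1) unfolding bsmooth_def by metis
  obtain c where c: "\<And>w x. norm (pderivs w g x) \<le> c w"
    using assms(2) unfolding bsmooth_def by metis
  show ?thesis
    by (rule bsmoothI[where B="\<lambda>w. b w + c w"])
       (use assms b c in \<open>auto simp: bsmooth_smooth smooth_add pderivs_add intro!: norm_triangle_mono\<close>)
qed

lemma bsmooth_cmult:
  assumes "bsmooth f"
  shows "bsmooth (\<lambda>x. c * f x)"
proof -
  obtain b where b: "\<And>w x. norm (pderivs w f x) \<le> b w"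
    using assms(1) unfolding bsmooth_def by metis
  show ?thesis
    by (rule bsmoothI[where B="\<lambda>w. norm c * b w"])
       (use assms b in \<open>auto simp: bsmooth_smooth smooth_mult smooth_const pderivs_cmult norm_mult mult_left_mono\<close>)
qed

lemma bsmooth_diff:
  assumes "bsmooth f" "bsmooth g"
  shows "bsmooth (\<lambda>x. f x - g x)"
  using bsmooth_add[OF assms(1) bsmooth_cmult[OF assms(2), of "-1"]] by simp

lemma pderivs_diff:
  assumes "smooth f" "smooth g"
  shows "pderivs w (\<lambda>x. f x - g x) = (\<lambda>x. pderivs w f x - pderivs w g x)"
  using pderivs_add[OF assms(1) smooth_mult[OF smooth_const[of "-1"] assms(2)], of w]
    pderivs_cmult[OF assms(2), of w "-1"] by simp

lemma bsmooth_sum: "(\<And>a. a \<in> A \<Longrightarrow> bsmooth (F a)) \<Longrightarrow> bsmooth (\<lambda>x. \<Sum>a\<in>A. F a x)"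
  by (induction A rule: infinite_finite_induct) (auto intro: bsmooth_add bsmooth_const)

lemma bsmooth_affine:
  assumes "bsmooth f"
  shows "bsmooth (\<lambda>x. f (a + c *\<^sub>R x))"
proof -
  obtain b where b: "\<And>w x. norm (pderivs w f x) \<le> b w"
    using assms(1) unfolding bsmooth_def by metis
  show ?thesis
    by (rule bsmoothI[where B="\<lambda>w. \<bar>c\<bar> ^ length w * b w"])
       (use assms b in \<open>auto simp: bsmooth_smooth smooth_affine pderivs_affine norm_mult norm_power mult_left_mono\<close>)
qed

lemma bsmooth_reflect:
  assumes "bsmooth f" shows "bsmooth (\<lambda>y. f (x - y))"
  using bsmooth_affine[OF assms, of x "-1"] by simp

lemma pderivs_reflect:
  assumes "smooth f"
  shows "pderivs w (\<lambda>y. f (x - y)) = (\<lambda>y. (-1) ^ length w * pderivs w f (x - y))"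
  using pderivs_affine[OF assms, of w x "-1"] by simp

lemma lipschitz_gradient_bound:
  fixes f :: "real^'d::finite \<Rightarrow> complex"
  assumes f: "f differentiable_on UNIV" and B: "\<And>i x. norm (partial i f x) \<le> B"
  shows "norm (f y - f x) \<le> real CARD('d) * B * norm (y - x)"
proof (rule differentiable_bound[where S=UNIV and f'="\<lambda>x h. \<Sum>i\<in>UNIV. (h $ i) *\<^sub>R partial i f x"])
  fix x
  show "(f has_derivative (\<lambda>h. \<Sum>i\<in>UNIV. (h $ i) *\<^sub>R partial i f x)) (at x within UNIV)"
    using partial_differentiable[OF f] by simp
  show "onorm (\<lambda>h. \<Sum>i\<in>UNIV. (h $ i) *\<^sub>R partial i f x) \<le> real CARD('d) * B"
  proof (rule onorm_le)
    fix h :: "real^'d"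
    have "norm (\<Sum>i\<in>UNIV. (h $ i) *\<^sub>R partial i f x) \<le> (\<Sum>i\<in>(UNIV::'d set). norm h * B)"
      by (intro order_trans[OF norm_sum] sum_mono)
         (simp add: mult_mono component_le_norm_cart B)
    then show "norm (\<Sum>i\<in>UNIV. (h $ i) *\<^sub>R partial i f x) \<le> real CARD('d) * B * norm h"
      by (simp add: mult_ac)
  qed
qed auto

lemma taylor_second_order:
  fixes f :: "real^'d::finite \<Rightarrow> complex"
  assumes f: "smooth f" and B: "\<And>i j x. norm (partial j (partial i f) x) \<le> B"
  shows "norm (f (x + h) - f x - (\<Sum>i\<in>UNIV. (h $ i) *\<^sub>R partial i f x)) \<le> real CARD('d) * (real CARD('d) * B) * (norm h)\<^sup>2"
proof -
  let ?D = "\<lambda>x h. \<Sum>i\<in>UNIV. (h $ i) *\<^sub>R partial i f x"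
  let ?n = "real CARD('d)"
  have "norm (f (x + h) - f x - ?D x (x + h - x)) \<le> norm (x + h - x) * (?n * (?n * B * norm h))"
  proof (rule differentiable_bound_linearization[where S="cball x (norm h)"])
    show "x + t *\<^sub>R (x + h - x) \<in> cball x (norm h)" if "t \<in> {0..1}" for t
      using that by (auto simp: dist_norm mult_left_le_one_le)
    show "(f has_derivative ?D z) (at z within cball x (norm h))" for z
      using partial_differentiable[OF smooth_differentiable[OF f]] has_derivative_at_withinI by blast
    show "x \<in> cball x (norm h)" by simp
    fix z assume z: "z \<in> cball x (norm h)"
    have *: "norm (partial i f z - partial i f x) \<le> ?n * B * norm h" for i
    proof -
      have "B \<ge> 0" using B norm_ge_zero order_trans by blast
      then have "?n * B * norm (z - x) \<le> ?n * B * norm h"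
        using z by (intro mult_left_mono) (auto simp: dist_norm norm_minus_commute)
      then show ?thesis
        using lipschitz_gradient_bound[OF smooth_differentiable[OF smooth_partial[OF f, of i]] B, where x=x and y=z]
        by linarith
    qed
    have "norm (?D z v - ?D x v) \<le> ?n * (?n * B * norm h) * norm v" for v
    proof -
      have "norm (?D z v - ?D x v) = norm (\<Sum>i\<in>UNIV. (v $ i) *\<^sub>R (partial i f z - partial i f x))"
        by (simp add: sum_subtractf scaleR_diff_right)
      also have "\<dots> \<le> (\<Sum>i\<in>(UNIV::'d set). norm v * (?n * B * norm h))"
        by (intro order_trans[OF norm_sum] sum_mono)
           (simp only: norm_scaleR, intro mult_mono component_le_norm_cart * abs_ge_zero norm_ge_zero)
      finally show ?thesis by (simp add: mult_ac)
    qed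
    then show "onorm (?D z - ?D x) \<le> ?n * (?n * B * norm h)"
      by (intro onorm_le) simp
  qed
  then show ?thesis by (simp add: power2_eq_square mult_ac)
qed

lemma has_derivative_quadratic:
  fixes f :: "'a::real_normed_vector \<Rightarrow> 'b::real_normed_vector"
  assumes "bounded_linear D" "\<And>h. norm (f (x + h) - f x - D h) \<le> M * (norm h)\<^sup>2"
  shows "(f has_derivative D) (at x)"
  unfolding has_derivative_at
proof (intro conjI assms(1))
  have lim: "((\<lambda>h::'a. M * norm h) \<longlongrightarrow> 0) (at 0)"
    by (auto intro!: tendsto_eq_intros)
  have le: "norm (f (x + h) - f x - D h) / norm h \<le> M * norm h" if "h \<noteq> 0" for h
    using assms(2)[of h] that by (simp add: divide_simps power2_eq_square mult_ac)
  show "((\<lambda>h. norm (f (x + h) - f x - D h) / norm h) \<longlongrightarrow> 0) (at 0)"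
    by (rule tendsto_sandwich[OF _ _ tendsto_const lim])
       (auto simp: eventually_at le intro!: exI[of _ 1])
qed

section \<open>Functionals of finite order and their convolutions\<close>

text \<open>Functionals that are linear on the functions with bounded derivatives and controlled by the
  derivatives of order up to \<open>N\<close> on a set \<open>K\<close>. Off this class of functions \<open>S\<close> is arbitrary.\<close>

locale finite_order =
  fixes S :: "(real^'d::finite \<Rightarrow> complex) \<Rightarrow> complex" and K :: "(real^'d) set"
    and N :: nat and C :: real
  assumes S_add: "\<And>f g. bsmooth f \<Longrightarrow> bsmooth g \<Longrightarrow> S (\<lambda>x. f x + g x) = S f + S g"
    and S_cmult: "\<And>c f. bsmooth f \<Longrightarrow> S (\<lambda>x. c * f x) = c * S f"
    and S_bound: "\<And>f B. bsmooth f \<Longrightarrow> B \<ge> 0 \<Longrightarrow>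
      (\<And>w x. length w \<le> N \<Longrightarrow> x \<in> K \<Longrightarrow> norm (pderivs w f x) \<le> B) \<Longrightarrow> norm (S f) \<le> C * B"
    and C_nonneg: "C \<ge> 0"

text \<open>The convolution of a functional with a function.\<close>

definition sconv :: "((real^'d::finite \<Rightarrow> complex) \<Rightarrow> complex) \<Rightarrow> (real^'d \<Rightarrow> complex) \<Rightarrow> real^'d \<Rightarrow> complex" where
  "sconv S g x = S (\<lambda>y. g (x - y))"

context finite_order
begin

lemma S_zero: "S (\<lambda>x. 0) = 0"
  using S_cmult[OF bsmooth_const, of 0 0] by simp

lemma S_sum:
  "(\<And>a. a \<in> A \<Longrightarrow> bsmooth (F a)) \<Longrightarrow> S (\<lambda>x. \<Sum>a\<in>A. F a x) = (\<Sum>a\<in>A. S (F a))"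
  by (induction A rule: infinite_finite_induct) (auto simp: S_zero S_add bsmooth_sum)

lemma S_diff:
  assumes "bsmooth f" "bsmooth g" shows "S (\<lambda>x. f x - g x) = S f - S g"
  using S_add[OF assms(1) bsmooth_cmult[OF assms(2), of "-1"]] S_cmult[OF assms(2), of "-1"] by simp

lemma sconv_add:
  "bsmooth f \<Longrightarrow> bsmooth g \<Longrightarrow> sconv S (\<lambda>x. f x + g x) = (\<lambda>x. sconv S f x + sconv S g x)"
  by (rule ext) (simp add: sconv_def S_add bsmooth_reflect)

lemma sconv_diff:
  "bsmooth f \<Longrightarrow> bsmooth g \<Longrightarrow> sconv S (\<lambda>x. f x - g x) = (\<lambda>x. sconv S f x - sconv S g x)"
  by (rule ext) (simp add: sconv_def S_diff bsmooth_reflect)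

lemma sconv_bound:
  assumes "bsmooth g" "B \<ge> 0"
    and "\<And>w y. length w \<le> N \<Longrightarrow> y \<in> K \<Longrightarrow> norm (pderivs w g (x - y)) \<le> B"
  shows "norm (sconv S g x) \<le> C * B"
  unfolding sconv_def
  using assms by (intro S_bound bsmooth_reflect)
    (auto simp: pderivs_reflect bsmooth_smooth norm_mult norm_power)

text \<open>The remainder of the first order Taylor expansion of \<open>g\<close>, together with its derivatives up to order \<open>N\<close>, is
  quadratic in the increment, uniformly in the base point; so \<open>S\<close> can be applied to it.\<close>

lemma sconv_has_derivative:
  assumes g: "bsmooth g"
  shows "(sconv S g has_derivative (\<lambda>h. \<Sum>i\<in>UNIV. (h $ i) *\<^sub>R sconv S (partial i g) x)) (at x)"
proof -
  obtain B where B: "B \<ge> 0" "\<And>w x. length w \<le> N + 2 \<Longrightarrow> norm (pderivs w g x) \<le> B"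
    using bsmooth_bound_upto[OF g] by blast
  let ?n = "real CARD('d)"
  show ?thesis
  proof (rule has_derivative_quadratic[where M="C * (?n * (?n * B))"])
    have "bounded_linear (\<lambda>h. (h $ i) *\<^sub>R sconv S (partial i g) x)" for i
      by (intro bounded_linear_scaleR_const bounded_linear_vec_nth)
    then show "bounded_linear (\<lambda>h. \<Sum>i\<in>UNIV. (h $ i) *\<^sub>R sconv S (partial i g) x)"
      by (intro bounded_linear_sum)
    fix h :: "real^'d"
    define r where "r u = (g (h + u) - g u) - (\<Sum>i\<in>UNIV. of_real (h $ i) * partial i g u)" for u
    have bs: "bsmooth (\<lambda>u. g (h + u))" "\<And>i. bsmooth (\<lambda>u. of_real (h $ i) * partial i g u)"
      "bsmooth (\<lambda>u. \<Sum>i\<in>UNIV. of_real (h $ i) * partial i g u)"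
      using bsmooth_affine[OF g, of h 1] g by (auto intro!: bsmooth_sum bsmooth_cmult bsmooth_partial)
    have br: "bsmooth r"
      unfolding r_def[abs_def] by (intro bsmooth_diff bs g)
    have "sconv S r x = sconv S g (x + h) - sconv S g x - (\<Sum>i\<in>UNIV. (h $ i) *\<^sub>R sconv S (partial i g) x)"
    proof -
      have "sconv S r x = S (\<lambda>y. g (x + h - y) - g (x - y) - (\<Sum>i\<in>UNIV. of_real (h $ i) * partial i g (x - y)))"
        by (simp add: sconv_def r_def algebra_simps)
      also have "\<dots> = S (\<lambda>y. g (x + h - y)) - S (\<lambda>y. g (x - y)) - S (\<lambda>y. \<Sum>i\<in>UNIV. of_real (h $ i) * partial i g (x - y))"
        using g by (subst S_diff, auto intro!: bsmooth_diff bsmooth_reflect bsmooth_sum bsmooth_cmult bsmooth_partial S_diff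
          bsmooth_reflect[of "partial _ g"])
      also have "S (\<lambda>y. \<Sum>i\<in>UNIV. of_real (h $ i) * partial i g (x - y)) = (\<Sum>i\<in>UNIV. (h $ i) *\<^sub>R S (\<lambda>y. partial i g (x - y)))"
        using bsmooth_reflect[OF bsmooth_partial[OF g]]
        by (subst S_sum) (auto simp: S_cmult scaleR_conv_of_real intro!: bsmooth_cmult)
      finally show ?thesis by (simp add: sconv_def)
    qed
    moreover have "norm (sconv S r x) \<le> C * (?n * (?n * B) * (norm h)\<^sup>2)"
    proof (rule sconv_bound[OF br])
      show "0 \<le> ?n * (?n * B) * (norm h)\<^sup>2" using B by simp
      fix w :: "'d list" and y assume w: "length w \<le> N"
      have "pderivs w r = (\<lambda>u. pderivs w g (h + u) - pderivs w g u - (\<Sum>i\<in>UNIV. of_real (h $ i) * partial i (pderivs w g) u))"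
        using g bs pderivs_affine[of g w h 1]
        by (simp add: r_def[abs_def] pderivs_diff pderivs_sum pderivs_cmult bsmooth_smooth bsmooth_diff bsmooth_partial pderivs_partial)
      then have "norm (pderivs w r (x - y)) = norm (pderivs w g ((x - y) + h) - pderivs w g (x - y)
         - (\<Sum>i\<in>UNIV. (h $ i) *\<^sub>R partial i (pderivs w g) (x - y)))"
        by (simp add: scaleR_conv_of_real add.commute)
      also have "\<dots> \<le> ?n * (?n * B) * (norm h)\<^sup>2"
      proof (rule taylor_second_order)
        show "smooth (pderivs w g)" using g by (intro smooth_pderivs bsmooth_smooth)
        show "norm (partial j (partial i (pderivs w g)) z) \<le> B" for i j z
          using B(2)[of "j # i # w" z] w by simp
      qed
      finally show "norm (pderivs w r (x - y)) \<le> ?n * (?n * B) * (norm h)\<^sup>2" .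
    qed
    ultimately show "norm (sconv S g (x + h) - sconv S g x - (\<Sum>i\<in>UNIV. (h $ i) *\<^sub>R sconv S (partial i g) x))
       \<le> C * (?n * (?n * B)) * (norm h)\<^sup>2" by (simp add: mult_ac)
  qed
qed

lemma partial_sconv:
  assumes "bsmooth g"
  shows "partial i (sconv S g) = sconv S (partial i g)"
  by (rule ext, subst partial_eqI[OF sconv_has_derivative[OF assms]]) (simp only: axis_sum_simp)

lemma pderivs_sconv:
  assumes "bsmooth g"
  shows "pderivs w (sconv S g) = sconv S (pderivs w g)"
  by (induction w) (auto simp: partial_sconv bsmooth_pderivs[OF assms])

lemma Ck_sconv: "bsmooth g \<Longrightarrow> Ck k (sconv S g)"
proof (induction k arbitrary: g)
  case 0
  then show ?case
    using has_derivative_continuous[OF sconv_has_derivative]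
    by (auto intro!: continuous_at_imp_continuous_on)
next
  case (Suc k)
  show ?case
    by (rule Ck_SucI[OF sconv_has_derivative[OF Suc.prems]])
       (simp only: axis_sum_simp Suc bsmooth_partial)
qed

lemma bsmooth_sconv:
  assumes "bsmooth g"
  shows "bsmooth (sconv S g)"
proof -
  have "\<exists>B. \<forall>x. norm (pderivs w (sconv S g) x) \<le> B" for w
  proof -
    obtain B where B: "B \<ge> 0" "\<And>v x. length v \<le> N \<Longrightarrow> norm (pderivs v (pderivs w g) x) \<le> B"
      using bsmooth_bound_upto[OF bsmooth_pderivs[OF assms]] by blast
    then show ?thesis
      unfolding pderivs_sconv[OF assms] using bsmooth_pderivs[OF assms] sconv_bound by blast
  qed
  then show ?thesis unfolding bsmooth_def smooth_def using Ck_sconv[OF assms] by blast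
qed

end

section \<open>Averaging against an integrable kernel\<close>

text \<open>Convolution of \<open>g\<close> with the kernel \<open>w\<close> rescaled to width \<open>e\<close>, after a change of variables
  that moves the scaling into the argument of \<open>g\<close>.\<close>

definition kconv :: "(real^'d::finite \<Rightarrow> complex) \<Rightarrow> real \<Rightarrow> (real^'d \<Rightarrow> complex) \<Rightarrow> real^'d \<Rightarrow> complex" where
  "kconv w e g x = (LINT z|lborel. w z * g (x - e *\<^sub>R z))"

abbreviation L1norm :: "(real^'d::finite \<Rightarrow> complex) \<Rightarrow> real" where
  "L1norm w \<equiv> (LINT z|lborel. norm (w z))"

lemma integrable_bounded_mult:
  fixes w g :: "real^'d::finite \<Rightarrow> complex"
  assumes "integrable lborel w" "continuous_on UNIV g" "\<And>x. norm (g x) \<le> B"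
  shows "integrable lborel (\<lambda>z. w z * g z)"
proof (rule Bochner_Integration.integrable_bound)
  show "integrable lborel (\<lambda>z. B * norm (w z))" using assms(1) by simp
  show "(\<lambda>z. w z * g z) \<in> borel_measurable lborel"
    using assms(1) borel_measurable_continuous_onI[OF assms(2)] by simp
  have "B \<ge> 0" using assms(3) norm_ge_zero order_trans by blast
  then show "AE z in lborel. norm (w z * g z) \<le> norm (B * norm (w z))"
    using assms(3) by (auto simp: norm_mult mult_left_mono mult.commute[of B])
qed

lemma continuous_affine:
  "continuous_on UNIV g \<Longrightarrow> continuous_on UNIV (\<lambda>z. g (x + c *\<^sub>R z))"
  "continuous_on UNIV g \<Longrightarrow> continuous_on UNIV (\<lambda>z. g (x - c *\<^sub>R z))"
  for g :: "real^'d::finite \<Rightarrow> complex"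
  by (auto intro!: continuous_on_compose2[of UNIV g UNIV] continuous_intros)

lemma integrable_kconv:
  fixes w g :: "real^'d::finite \<Rightarrow> complex"
  assumes "integrable lborel w" "continuous_on UNIV g" "\<And>x. norm (g x) \<le> B"
  shows "integrable lborel (\<lambda>z. w z * g (x - e *\<^sub>R z))"
  using assms by (intro integrable_bounded_mult[where B=B] continuous_affine) auto

lemma norm_integral_mult_le:
  fixes w g :: "real^'d::finite \<Rightarrow> complex"
  assumes "integrable lborel w" "\<And>x. norm (g x) \<le> B"
  shows "norm (LINT z|lborel. w z * g z) \<le> L1norm w * B"
proof -
  have "norm (LINT z|lborel. w z * g z) \<le> (LINT z|lborel. norm (w z * g z))"
    by (rule integral_norm_bound)
  moreover have "B \<ge> 0" using assms(2) norm_ge_zero order_trans by blast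
  then have "(LINT z|lborel. norm (w z * g z)) \<le> (LINT z|lborel. norm (w z) * B)"
    using assms by (intro integral_mono') (auto simp: norm_mult mult_left_mono)
  ultimately have "norm (LINT z|lborel. w z * g z) \<le> (LINT z|lborel. norm (w z) * B)"
    by linarith
  then show ?thesis by simp
qed

lemma bsmooth_continuous: "bsmooth g \<Longrightarrow> continuous_on UNIV g"
  using bsmooth_smooth smooth_continuous by blast

lemma integrable_bsmooth:
  assumes "integrable lborel w" "bsmooth g"
  shows "integrable lborel (\<lambda>z. w z * g z)"
  by (rule bsmooth_bound[OF assms(2)], rule integrable_bounded_mult)
     (use assms bsmooth_continuous in auto)

lemma finite_order_kernel:
  assumes w: "integrable lborel w"
  shows "finite_order (\<lambda>f. LINT z|lborel. w z * f (e *\<^sub>R z)) UNIV 0 (L1norm w)"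
proof
  have i: "integrable lborel (\<lambda>z. w z * f (e *\<^sub>R z))" if "bsmooth f" for f
    using integrable_bsmooth[OF w bsmooth_affine[OF that, of 0 e]] by simp
  show "(LINT z|lborel. w z * (f (e *\<^sub>R z) + g (e *\<^sub>R z))) =
      (LINT z|lborel. w z * f (e *\<^sub>R z)) + (LINT z|lborel. w z * g (e *\<^sub>R z))"
    if "bsmooth f" "bsmooth g" for f g
    using i that by (simp add: distrib_left)
  show "(LINT z|lborel. w z * (c * f (e *\<^sub>R z))) = c * (LINT z|lborel. w z * f (e *\<^sub>R z))" for c f
    by (simp add: mult.left_commute)
  show "norm (LINT z|lborel. w z * f (e *\<^sub>R z)) \<le> L1norm w * B"
    if "\<And>v x. length v \<le> 0 \<Longrightarrow> x \<in> UNIV \<Longrightarrow> norm (pderivs v f x) \<le> B" for f B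
    using that[of "[]"] w by (intro norm_integral_mult_le) auto
qed simp

lemma kconv_eq_sconv: "kconv w e g = sconv (\<lambda>f. LINT z|lborel. w z * f (e *\<^sub>R z)) g"
  by (rule ext) (simp add: kconv_def sconv_def)

lemma bsmooth_kconv:
  assumes "integrable lborel w" "bsmooth g" shows "bsmooth (kconv w e g)"
  unfolding kconv_eq_sconv using finite_order.bsmooth_sconv[OF finite_order_kernel] assms by blast

lemma pderivs_kconv:
  assumes "integrable lborel w" "bsmooth g"
  shows "pderivs v (kconv w e g) = kconv w e (pderivs v g)"
  unfolding kconv_eq_sconv using finite_order.pderivs_sconv[OF finite_order_kernel] assms by blast

lemma norm_integral_diff_le:
  fixes f g :: "real^'d::finite \<Rightarrow> complex"
  assumes f: "integrable lborel f" and g: "integrable lborel g" and h: "integrable lborel h"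
    and le: "\<And>x. norm (f x - g x) \<le> h x"
  shows "norm ((LINT x|lborel. f x) - (LINT x|lborel. g x)) \<le> (LINT x|lborel. h x)"
  unfolding Bochner_Integration.integral_diff[OF f g, symmetric]
  by (rule Bochner_Integration.integral_norm_bound_integral[OF Bochner_Integration.integrable_diff[OF f g] h le])

text \<open>The common estimate behind the gain of one power of \<open>e\<close> from a gradient bound and of the
  Hoelder exponent from a Hoelder bound.\<close>

lemma kconv_increment_bound:
  assumes w: "integrable lborel w" "integrable lborel (\<lambda>z. norm (w z) * \<rho> z)"
    and g: "continuous_on UNIV g" "\<And>x. norm (g x) \<le> B"
    and le: "\<And>z. norm (g x - g (x - e *\<^sub>R z)) \<le> c * \<rho> z"
  shows "norm ((LINT z|lborel. w z) * g x - kconv w e g x) \<le> c * (LINT z|lborel. norm (w z) * \<rho> z)"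
proof -
  have "norm ((LINT z|lborel. w z * g x) - (LINT z|lborel. w z * g (x - e *\<^sub>R z)))
    \<le> (LINT z|lborel. c * (norm (w z) * \<rho> z))"
  proof (rule norm_integral_diff_le)
    show "integrable lborel (\<lambda>z. w z * g (x - e *\<^sub>R z))" by (rule integrable_kconv[OF w(1) g])
    show "norm (w z * g x - w z * g (x - e *\<^sub>R z)) \<le> c * (norm (w z) * \<rho> z)" for z
      using mult_left_mono[OF le[of z] norm_ge_zero[of "w z"]]
      by (simp add: right_diff_distrib[symmetric] norm_mult mult.left_commute)
  qed (use w in auto)
  then show ?thesis by (simp add: kconv_def)
qed

lemma kconv_bound:
  assumes "integrable lborel w" "\<And>x. norm (g x) \<le> B"
  shows "norm (kconv w e g x) \<le> L1norm w * B"
  unfolding kconv_def using assms by (intro norm_integral_mult_le) auto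

section \<open>Approximating an integral by finite sums, uniformly over a class of functions\<close>

lemma integral_outside_ball_small:
  fixes w :: "real^'d::finite \<Rightarrow> complex"
  assumes w: "integrable lborel w" and "e > 0"
  shows "\<exists>n::nat. (LINT z|lborel. indicator (- cball 0 (real n)) z * norm (w z)) < e"
proof -
  have "(\<lambda>n. LINT z|lborel. indicator (- cball 0 (real n)) z * norm (w z)) \<longlonglongrightarrow> (LINT z|(lborel :: (real^'d) measure). 0)"
  proof (rule integral_dominated_convergence[where w="\<lambda>z. norm (w z)" and f="\<lambda>_. 0"
        and s="\<lambda>n z. indicator (- cball 0 (real n)) z * norm (w z)"])
    show "AE z in lborel. (\<lambda>n. indicator (- cball 0 (real n)) z * norm (w z)) \<longlonglongrightarrow> 0"
    proof (rule AE_I2, rule tendsto_eventually)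
      fix z :: "real^'d"
      show "\<forall>\<^sub>F n in sequentially. indicator (- cball 0 (real n)) z * norm (w z) = 0"
        using eventually_ge_at_top[of "nat \<lceil>norm z\<rceil>"]
        by eventually_elim (auto simp: indicator_def)
    qed
    show "AE z in lborel. norm (indicator (- cball 0 (real n)) z * norm (w z)) \<le> norm (w z)" for n
      by (auto simp: indicator_def)
  qed (use w in auto)
  then have "\<forall>\<^sub>F n in sequentially. (LINT z|lborel. indicator (- cball 0 (real n)) z * norm (w z)) < e"
    using \<open>e > 0\<close> by (intro order_tendstoD) auto
  then show ?thesis by (auto simp: eventually_sequentially)
qed

text \<open>One finite sum approximates the integral for all bounded Lipschitz functions at once. This
  is what lets a functional of finite order be interchanged with an integral.\<close>

lemma uniform_quadrature:
  fixes w :: "real^'d::finite \<Rightarrow> complex"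
  assumes w: "integrable lborel w" and e: "e > 0"
  shows "\<exists>(n::nat) z c. \<forall>h B. (\<forall>x. norm (h x) \<le> B) \<and> (\<forall>x y. norm (h x - h y) \<le> B * norm (x - y)) \<longrightarrow>
    norm ((LINT x|lborel. w x * h x) - (\<Sum>i<n. c i * h (z i))) \<le> e * B"
proof -
  let ?I = "L1norm w"
  have I0: "?I \<ge> 0" by simp
  have "\<exists>\<delta>>0. \<delta> * I \<le> e / 2" if "I \<ge> 0" for I :: real
    using that e by (intro exI[of _ "e / (2 * (I + 1))"]) (simp add: field_simps)
  then obtain \<delta> where \<delta>: "\<delta> > 0" and \<delta>I: "\<delta> * ?I \<le> e / 2" using I0 by blast
  obtain R :: nat where R: "(LINT z|lborel. indicator (- cball 0 (real R)) z * norm (w z)) < e / 2"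
    using integral_outside_ball_small[OF w, of "e/2"] e by auto
  let ?Q = "cball (0::real^'d) (real R)"
  have cover: "?Q \<subseteq> (\<Union>x\<in>?Q. ball x \<delta>)" using \<delta> by auto
  obtain Z where Z: "Z \<subseteq> ?Q" "finite Z" "?Q \<subseteq> (\<Union>x\<in>Z. ball x \<delta>)"
    by (rule compactE_image[OF compact_cball _ cover]) auto
  obtain n :: nat and z where nz: "Z = z ` {i. i < n}"
    using finite_imp_nat_seg_image_inj_on[OF Z(2)] by auto
  define D where "D i = ?Q \<inter> (ball (z i) \<delta> - (\<Union>j<i. ball (z j) \<delta>))" for i
  have Dm: "D i \<in> sets lborel" for i unfolding D_def by auto
  \<comment> \<open>The \<open>D i\<close> partition the large ball into pieces of radius at most \<open>\<delta>\<close>; the weights are the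
    masses of these pieces.\<close>
  define c where "c i = (LINT x|lborel. indicator (D i) x *\<^sub>R w x)" for i
  have pick: "\<exists>k<n. dist (z k) x < \<delta> \<and> (\<forall>i<n. x \<in> D i \<longleftrightarrow> i = k)" if x: "x \<in> ?Q" for x
  proof -
    have "\<exists>i. i < n \<and> dist (z i) x < \<delta>" using Z(3) x nz by fastforce
    define k where "k = (LEAST i. i < n \<and> dist (z i) x < \<delta>)"
    have k: "k < n \<and> dist (z k) x < \<delta>"
      unfolding k_def by (rule LeastI_ex) fact
    have km: "k \<le> i" if "i < n" "dist (z i) x < \<delta>" for i
      unfolding k_def using that by (intro Least_le) simp
    have "x \<in> D i \<longleftrightarrow> i = k" if i: "i < n" for i
    proof
      assume "x \<in> D i"
      then have "dist (z i) x < \<delta>" "\<not> k < i" using k by (auto simp: D_def)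
      then show "i = k" using km[OF i] by simp
    next
      assume "i = k"
      have "\<not> dist (z j) x < \<delta>" if "j < k" for j using km[of j] k that by auto
      then show "x \<in> D i" using \<open>i = k\<close> k x by (auto simp: D_def)
    qed
    then show ?thesis using k by blast
  qed
  show ?thesis
  proof (intro exI allI impI)
    fix h :: "real^'d \<Rightarrow> complex" and B :: real
    assume h: "(\<forall>x. norm (h x) \<le> B) \<and> (\<forall>x y. norm (h x - h y) \<le> B * norm (x - y))"
    have B0: "B \<ge> 0" using h norm_ge_zero order_trans by blast
    have "B-lipschitz_on UNIV h"
      using h B0 by (auto intro!: lipschitz_onI simp: dist_norm)
    then have hc: "continuous_on UNIV h" by (rule lipschitz_on_continuous_on)
    have iwh: "integrable lborel (\<lambda>x. w x * h x)"
      using h by (intro integrable_bounded_mult[OF w hc]) auto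
    have iD: "integrable lborel (\<lambda>x. (indicator (D i) x *\<^sub>R w x) * h (z i))" for i
      using integrable_mult_indicator[OF Dm w] by (intro integrable_mult_left) auto
    let ?g = "\<lambda>x. \<Sum>i<n. (indicator (D i) x *\<^sub>R w x) * h (z i)"
    have "(\<Sum>i<n. c i * h (z i)) = (\<Sum>i<n. LINT x|lborel. (indicator (D i) x *\<^sub>R w x) * h (z i))"
      unfolding c_def by (simp only: integral_mult_left_zero)
    also have "\<dots> = (LINT x|lborel. ?g x)"
      by (rule Bochner_Integration.integral_sum[symmetric, OF iD])
    finally have "norm ((LINT x|lborel. w x * h x) - (\<Sum>i<n. c i * h (z i))) =
      norm ((LINT x|lborel. w x * h x) - (LINT x|lborel. ?g x))" by (rule arg_cong)
    also have "\<dots> \<le> (LINT x|lborel. B * \<delta> * norm (w x) + B * (indicator (- ?Q) x * norm (w x)))"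
    proof (rule norm_integral_diff_le[OF iwh Bochner_Integration.integrable_sum[OF iD]])
      have "integrable lborel (\<lambda>x. indicator (- ?Q) x *\<^sub>R norm (w x))"
        using w by (intro integrable_mult_indicator) auto
      then show "integrable lborel (\<lambda>x. B * \<delta> * norm (w x) + B * (indicator (- ?Q) x * norm (w x)))"
        using w by auto
      fix x
      show "norm (w x * h x - ?g x) \<le> B * \<delta> * norm (w x) + B * (indicator (- ?Q) x * norm (w x))"
      proof (cases "x \<in> ?Q")
        case True
        obtain k where k: "k < n" "dist (z k) x < \<delta>" "\<And>i. i < n \<Longrightarrow> x \<in> D i \<longleftrightarrow> i = k"
          using pick[OF True] by blast
        have "?g x = (\<Sum>i<n. if i = k then w x * h (z k) else 0)"
          using k by (intro sum.cong) (auto simp: indicator_def)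
        also have "\<dots> = w x * h (z k)" using k by simp
        finally have "norm (w x * h x - ?g x) = norm (w x) * norm (h x - h (z k))"
          by (simp add: norm_mult right_diff_distrib[symmetric])
        also have "\<dots> \<le> norm (w x) * (B * \<delta>)"
        proof (intro mult_left_mono)
          have "norm (h x - h (z k)) \<le> B * norm (x - z k)" using h by blast
          also have "\<dots> \<le> B * \<delta>" using k B0 by (intro mult_left_mono) (auto simp: dist_norm norm_minus_commute)
          finally show "norm (h x - h (z k)) \<le> B * \<delta>" .
        qed simp
        finally show ?thesis using True by (simp add: mult_ac)
      next
        case False
        then have "x \<notin> D i" for i by (simp add: D_def)
        then have "?g x = 0" by simp
        moreover have "norm (w x * h x) \<le> B * norm (w x)"
          using h by (simp add: norm_mult mult.commute mult_right_mono)
        moreover have "0 \<le> B * \<delta> * norm (w x)" using B0 \<delta> by simp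
        ultimately show ?thesis using False by simp
      qed
    qed
    also have "\<dots> = B * (\<delta> * ?I) + B * (LINT x|lborel. indicator (- ?Q) x * norm (w x))"
    proof -
      have "integrable lborel (\<lambda>x. indicator (- ?Q) x *\<^sub>R norm (w x))"
        using w by (intro integrable_mult_indicator) auto
      then show ?thesis using w by simp
    qed
    also have "\<dots> \<le> B * (e/2) + B * (e/2)"
      using B0 \<delta>I R by (intro add_mono mult_left_mono) auto
    finally show "norm ((LINT x|lborel. w x * h x) - (\<Sum>i<n. c i * h (z i))) \<le> e * B"
      by (simp add: algebra_simps)
  qed
qed

lemma bsmooth_lipschitz:
  fixes g :: "real^'d::finite \<Rightarrow> complex"
  assumes "bsmooth g" "\<And>i x. norm (partial i g x) \<le> B"
  shows "norm (g x - g y) \<le> real CARD('d) * B * norm (x - y)"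
  using assms by (intro lipschitz_gradient_bound smooth_differentiable bsmooth_smooth)

text \<open>Associativity of the convolution, that is, a Fubini theorem for functionals of finite order.\<close>

theorem (in finite_order) kconv_sconv:
  assumes w: "integrable lborel w" and g: "bsmooth g"
  shows "kconv w e (sconv S g) = sconv S (kconv w e g)"
proof (rule ext)
  fix x
  let ?d = "real CARD('d)"
  obtain B0 where B0: "B0 \<ge> 0" "\<And>v x. length v \<le> Suc N \<Longrightarrow> norm (pderivs v g x) \<le> B0"
    using bsmooth_bound_upto[OF g] by blast
  \<comment> \<open>One constant that is a bound and a Lipschitz constant for the integrands before and after
    the application of \<open>S\<close>.\<close>
  define B where "B = (1 + C) * ((1 + ?d * \<bar>e\<bar>) * B0)"
  have B: "B \<ge> B0" "B \<ge> ?d * \<bar>e\<bar> * B0" "B \<ge> C * B0" "B \<ge> C * (?d * \<bar>e\<bar> * B0)" "B \<ge> 0"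
    using B0(1) C_nonneg unfolding B_def by (auto simp: algebra_simps)
  define H where "H z = (\<lambda>y. g ((x - e *\<^sub>R z) - y))" for z
  have H: "bsmooth (H z)" for z unfolding H_def by (intro bsmooth_reflect g)
  have pH: "pderivs v (H z) y = (-1) ^ length v * pderivs v g (x - e *\<^sub>R z - y)" for v z y
    unfolding H_def by (simp add: pderivs_reflect bsmooth_smooth[OF g])
  have lip: "norm (pderivs v g (x - e *\<^sub>R z - y) - pderivs v g (x - e *\<^sub>R z' - y)) \<le> ?d * \<bar>e\<bar> * B0 * norm (z - z')"
    if v: "length v \<le> N" for v z z' y
  proof -
    have "norm (pderivs v g (x - e *\<^sub>R z - y) - pderivs v g (x - e *\<^sub>R z' - y))
       \<le> ?d * B0 * norm ((x - e *\<^sub>R z - y) - (x - e *\<^sub>R z' - y))"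
    proof (rule bsmooth_lipschitz[OF bsmooth_pderivs[OF g]])
      show "norm (partial i (pderivs v g) x) \<le> B0" for i x
        using B0(2)[of "i # v" x] v by simp
    qed
    also have "(x - e *\<^sub>R z - y) - (x - e *\<^sub>R z' - y) = (- e) *\<^sub>R (z - z')"
      by (simp add: algebra_simps)
    finally show ?thesis by (simp add: mult_ac)
  qed
  have Sb: "norm (S (H z)) \<le> C * B0" for z
    by (rule S_bound[OF H B0(1)]) (auto simp: pH norm_mult norm_power B0)
  have Sl: "norm (S (H z) - S (H z')) \<le> B * norm (z - z')" for z z'
  proof -
    have "norm (S (\<lambda>y. H z y - H z' y)) \<le> C * (?d * \<bar>e\<bar> * B0 * norm (z - z'))"
    proof (rule S_bound)
      show "bsmooth (\<lambda>y. H z y - H z' y)" by (intro bsmooth_diff H)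
      show "norm (pderivs v (\<lambda>y. H z y - H z' y) y) \<le> ?d * \<bar>e\<bar> * B0 * norm (z - z')"
        if "length v \<le> N" for v y
        using lip[OF that]
        by (simp add: pderivs_diff bsmooth_smooth H pH right_diff_distrib[symmetric] norm_mult norm_power)
    qed (use B0 in auto)
    also have "\<dots> \<le> B * norm (z - z')"
      using mult_right_mono[OF B(4), of "norm (z - z')"] by (simp add: mult_ac)
    finally show ?thesis using S_diff[OF H H] by simp
  qed
  let ?A = "\<lambda>y. kconv w e g (x - y)"
  have A: "bsmooth ?A" by (intro bsmooth_reflect bsmooth_kconv w g)
  have "norm (kconv w e (sconv S g) x - sconv S (kconv w e g) x) \<le> \<epsilon>" if "\<epsilon> > 0" for \<epsilon>
  proof -
    define \<epsilon>' where "\<epsilon>' = \<epsilon> / ((1 + C) * (B + 1))"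
    have \<epsilon>': "\<epsilon>' > 0" using that B C_nonneg by (simp add: \<epsilon>'_def)
    obtain n :: nat and z c where q: "\<And>h B. (\<And>x. norm (h x) \<le> B) \<Longrightarrow> (\<And>x y. norm (h x - h y) \<le> B * norm (x - y)) \<Longrightarrow>
      norm ((LINT x|lborel. w x * h x) - (\<Sum>i<n. c i * h (z i))) \<le> \<epsilon>' * B"
      using uniform_quadrature[OF w \<epsilon>'] by blast
    have 1: "norm ((LINT z|lborel. w z * S (H z)) - (\<Sum>i<n. c i * S (H (z i)))) \<le> \<epsilon>' * B"
      using Sb Sl B(3) by (intro q) (auto intro: order_trans)
    have sm: "bsmooth (\<lambda>y. \<Sum>i<n. c i * H (z i) y)" by (intro bsmooth_sum bsmooth_cmult H)
    have 2: "norm (S (\<lambda>y. ?A y - (\<Sum>i<n. c i * H (z i) y))) \<le> C * (\<epsilon>' * B)"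
    proof (rule S_bound)
      show "bsmooth (\<lambda>y. ?A y - (\<Sum>i<n. c i * H (z i) y))" by (intro bsmooth_diff A sm)
      show "0 \<le> \<epsilon>' * B" using \<epsilon>' B by simp
      fix v :: "'d list" and y assume v: "length v \<le> N"
      have "pderivs v (\<lambda>y. ?A y - (\<Sum>i<n. c i * H (z i) y)) y =
        pderivs v ?A y - (\<Sum>i<n. c i * pderivs v (H (z i)) y)"
        by (subst pderivs_diff) (auto simp: bsmooth_smooth A sm pderivs_sum pderivs_cmult H bsmooth_cmult)
      also have "pderivs v ?A y = (-1) ^ length v * (LINT u|lborel. w u * pderivs v g (x - e *\<^sub>R u - y))"
        using w g by (simp add: pderivs_reflect bsmooth_smooth bsmooth_kconv pderivs_kconv)
          (simp add: kconv_def algebra_simps)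
      finally have "norm (pderivs v (\<lambda>y. ?A y - (\<Sum>i<n. c i * H (z i) y)) y) =
        norm ((-1) ^ length v * ((LINT u|lborel. w u * pderivs v g (x - e *\<^sub>R u - y))
         - (\<Sum>i<n. c i * pderivs v g (x - e *\<^sub>R z i - y))))"
        by (simp add: pH right_diff_distrib sum_distrib_left mult.left_commute)
      also have "\<dots> = norm ((LINT u|lborel. w u * pderivs v g (x - e *\<^sub>R u - y))
         - (\<Sum>i<n. c i * pderivs v g (x - e *\<^sub>R z i - y)))"
        by (simp add: norm_mult norm_power)
      also have "\<dots> \<le> \<epsilon>' * B"
      proof (rule q)
        show "norm (pderivs v g (x - e *\<^sub>R u - y)) \<le> B" for u
          using B0(2)[of v] v B(1) by (meson le_SucI order_trans)
        show "norm (pderivs v g (x - e *\<^sub>R u - y) - pderivs v g (x - e *\<^sub>R u' - y)) \<le> B * norm (u - u')" for u u'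
          using lip[OF v, of u y u'] mult_right_mono[OF B(2), of "norm (u - u')"] by simp
      qed
      finally show "norm (pderivs v (\<lambda>y. ?A y - (\<Sum>i<n. c i * H (z i) y)) y) \<le> \<epsilon>' * B" .
    qed
    have "S (\<lambda>y. ?A y - (\<Sum>i<n. c i * H (z i) y)) = S ?A - (\<Sum>i<n. c i * S (H (z i)))"
      using A sm by (simp add: S_diff S_sum S_cmult H bsmooth_cmult)
    then have 3: "norm (S ?A - (\<Sum>i<n. c i * S (H (z i)))) \<le> C * (\<epsilon>' * B)" using 2 by simp
    have "norm ((LINT z|lborel. w z * S (H z)) - S ?A) \<le> \<epsilon>' * B + C * (\<epsilon>' * B)"
      using norm_triangle_mono[OF 1 3[unfolded norm_minus_commute[of "S ?A"]]] by simp
    also have "\<dots> = \<epsilon>' * ((1 + C) * B)" by (simp add: algebra_simps)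
    also have "\<dots> \<le> \<epsilon>' * ((1 + C) * (B + 1))"
      using \<epsilon>' C_nonneg by (intro mult_left_mono) auto
    also have "\<dots> = \<epsilon>" using B C_nonneg by (simp add: \<epsilon>'_def)
    finally show ?thesis by (simp add: kconv_def sconv_def H_def)
  qed
  then have "norm (kconv w e (sconv S g) x - sconv S (kconv w e g) x) \<le> 0"
    by (rule field_le_epsilon) simp
  then show "kconv w e (sconv S g) x = sconv S (kconv w e g) x" by simp
qed

lemma kconv_commute:
  assumes "integrable lborel w" "integrable lborel w'" "bsmooth g"
  shows "kconv w e (kconv w' e' g) = kconv w' e' (kconv w e g)"
  unfolding kconv_eq_sconv[of w' e']
  using finite_order.kconv_sconv[OF finite_order_kernel[OF assms(2)] assms(1,3)] .

section \<open>Schwartz functions\<close>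

text \<open>The weight is dominated by a sum over \<open>j\<close> of multiples of the indicators of the balls of
  radius \<open>1 + j\<close>, whose integrals are of order \<open>1 / (1 + j)\<^sup>2\<close>.\<close>

lemma integrable_weight:
  "integrable lborel (\<lambda>x::real^'d::finite. 1 / (1 + norm x) ^ (CARD('d) + 2))"
proof (rule integrableI_nonneg)
  let ?d = "CARD('d)"
  let ?c = "unit_ball_vol (real ?d)"
  show "(\<lambda>x::real^'d. 1 / (1 + norm x) ^ (?d + 2)) \<in> borel_measurable lborel" by simp
  show "AE x in lborel. 0 \<le> 1 / (1 + norm (x::real^'d)) ^ (?d + 2)" by (simp add: add_nonneg_nonneg)
  have le: "ennreal (1 / (1 + norm x) ^ (?d + 2)) \<le>
     (\<Sum>j. ennreal (1 / (1 + real j) ^ (?d + 2)) * indicator (cball 0 (1 + real j)) x)" for x :: "real^'d"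
  proof -
    define j where "j = nat \<lfloor>norm x\<rfloor>"
    have j: "real j \<le> norm x" "norm x \<le> 1 + real j"
      unfolding j_def by (simp_all add: le_nat_floor) linarith
    have "ennreal (1 / (1 + norm x) ^ (?d + 2)) \<le> ennreal (1 / (1 + real j) ^ (?d + 2)) * indicator (cball 0 (1 + real j)) x"
    proof -
      have "(1 + real j) ^ (?d + 2) \<le> (1 + norm x) ^ (?d + 2)"
        using j by (intro power_mono) auto
      then have "1 / (1 + norm x) ^ (?d + 2) \<le> 1 / (1 + real j) ^ (?d + 2)"
        by (intro divide_left_mono mult_pos_pos zero_less_power add_pos_nonneg) auto
      then show ?thesis using j by (auto intro: ennreal_leI)
    qed
    also have "\<dots> = (\<Sum>j\<in>{j}. ennreal (1 / (1 + real j) ^ (?d + 2)) * indicator (cball 0 (1 + real j)) x)"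
      by (simp only: sum.insert sum.empty finite.emptyI empty_iff not_False_eq_True add_0_right)
    also have "\<dots> \<le> (\<Sum>j. ennreal (1 / (1 + real j) ^ (?d + 2)) * indicator (cball 0 (1 + real j)) x)"
      by (rule sum_le_suminf) auto
    finally show ?thesis .
  qed
  have "(\<integral>\<^sup>+x. ennreal (1 / (1 + norm (x::real^'d)) ^ (?d + 2)) \<partial>lborel) \<le>
     (\<integral>\<^sup>+x. (\<Sum>j. ennreal (1 / (1 + real j) ^ (?d + 2)) * indicator (cball 0 (1 + real j)) (x::real^'d)) \<partial>lborel)"
    using le by (intro nn_integral_mono) auto
  also have "\<dots> = (\<Sum>j. ennreal (1 / (1 + real j) ^ (?d + 2)) * emeasure lborel (cball (0::real^'d) (1 + real j)))"
    by (subst nn_integral_suminf)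
       (simp_all add: nn_integral_cmult_indicator borel_measurable_indicator borel_measurable_times_ennreal del: power_Suc)
  also have "\<dots> = (\<Sum>j. ennreal (?c * (1 / (1 + real j)\<^sup>2)))"
  proof (intro suminf_cong)
    fix j
    have "1 / r ^ (?d + 2) * (?c * r ^ ?d) = ?c * (1 / r\<^sup>2)" if "r > 0" for r :: real
      using that by (simp add: power2_eq_square)
    from this[of "1 + real j"]
    have "1 / (1 + real j) ^ (?d + 2) * (?c * (1 + real j) ^ ?d) = ?c * (1 / (1 + real j)\<^sup>2)" by simp
    then show "ennreal (1 / (1 + real j) ^ (?d + 2)) * emeasure lborel (cball (0::real^'d) (1 + real j)) =
       ennreal (?c * (1 / (1 + real j)\<^sup>2))"
      by (simp add: emeasure_cball ennreal_mult[symmetric])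
  qed
  also have "\<dots> < \<infinity>"
  proof -
    have "summable (\<lambda>j. 1 / (1 + real j)\<^sup>2)"
      using inverse_power_summable[of 2, where 'a=real] summable_Suc_iff[of "\<lambda>n. inverse (real n ^ 2)"]
      by (simp add: inverse_eq_divide add.commute)
    then have "summable (\<lambda>j. ?c * (1 / (1 + real j)\<^sup>2))" by (rule summable_mult)
    then show ?thesis by (subst suminf_ennreal2) auto
  qed
  finally show "(\<integral>\<^sup>+x. ennreal (1 / (1 + norm (x::real^'d)) ^ (?d + 2)) \<partial>lborel) < \<infinity>" .
qed

lemma integrable_decay:
  fixes f :: "real^'d::finite \<Rightarrow> 'b::{banach, second_countable_topology}"
  assumes "f \<in> borel_measurable borel"
    and "\<And>x. (1 + norm x) ^ (CARD('d) + 2) * norm (f x) \<le> C"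
  shows "integrable lborel f"
proof (rule Bochner_Integration.integrable_bound)
  show "integrable lborel (\<lambda>x::real^'d. C * (1 / (1 + norm x) ^ (CARD('d) + 2)))"
    using integrable_weight by (rule integrable_mult_right)
  have fb: "norm (f x) \<le> C / (1 + norm x) ^ (CARD('d) + 2)" for x
    using assms(2)[of x] by (simp add: pos_le_divide_eq zero_less_power add_pos_nonneg mult.commute)
  then show "AE x in lborel. norm (f x) \<le> norm (C * (1 / (1 + norm x) ^ (CARD('d) + 2)))"
  proof (intro AE_I2)
    fix x
    have "norm (f x) \<le> C * (1 / (1 + norm x) ^ (CARD('d) + 2))"
      using fb[of x] by (simp only: times_divide_eq_right mult_1_right)
    also have "\<dots> \<le> norm (C * (1 / (1 + norm x) ^ (CARD('d) + 2)))"
      by (simp only: real_norm_def abs_ge_self)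
    finally show "norm (f x) \<le> norm (C * (1 / (1 + norm x) ^ (CARD('d) + 2)))" .
  qed
qed (use assms(1) in simp)

lemma schwartz_smooth: "\<phi> \<in> schwartz \<Longrightarrow> smooth \<phi>"
  by (simp add: schwartz_def)

lemma schwartz_decay:
  assumes "\<phi> \<in> schwartz"
  obtains C where "C \<ge> 0" "\<And>x. (1 + norm x) ^ N * norm (pderivs w \<phi> x) \<le> C"
proof -
  obtain C where C: "\<And>x. (1 + norm x) ^ N * norm (pderivs w \<phi> x) \<le> C"
    using assms unfolding schwartz_def pderivs_eq_mpartial[OF schwartz_smooth[OF assms], of w] by blast
  have "0 \<le> (1 + norm (0::real^'a)) ^ N * norm (pderivs w \<phi> 0)" by simp
  then have "C \<ge> 0" using C[of 0] by linarith
  then show ?thesis using that C by blast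
qed

lemma schwartz_bsmooth:
  assumes "\<phi> \<in> schwartz" shows "bsmooth \<phi>"
proof -
  have "\<exists>B. \<forall>x. norm (pderivs w \<phi> x) \<le> B" for w
    using schwartz_decay[OF assms, of 0 w] by (metis mult_1 power_0)
  then show ?thesis using schwartz_smooth[OF assms] by (auto simp: bsmooth_def)
qed

lemma schwartz_pderivs:
  assumes "\<phi> \<in> schwartz" shows "pderivs w \<phi> \<in> schwartz"
  unfolding schwartz_def
proof (intro CollectI conjI allI)
  show "smooth (pderivs w \<phi>)" using assms schwartz_smooth smooth_pderivs by blast
  fix N m
  obtain C where "\<And>x. (1 + norm x) ^ N * norm (pderivs (mi_word m @ w) \<phi> x) \<le> C"
    using schwartz_decay[OF assms] by metis
  then show "\<exists>C. \<forall>x. (1 + norm x) ^ N * norm (mpartial m (pderivs w \<phi>) x) \<le> C"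
    by (auto simp: mpartial_word)
qed

lemma schwartz_measurable: "\<phi> \<in> schwartz \<Longrightarrow> \<phi> \<in> borel_measurable borel"
  by (intro borel_measurable_continuous_onI smooth_continuous schwartz_smooth)

lemma schwartz_integrable_weighted:
  fixes \<phi> :: "real^'d::finite \<Rightarrow> complex"
  assumes "\<phi> \<in> schwartz" and "r \<ge> 0"
  shows "integrable lborel (\<lambda>z. norm (\<phi> z) * norm z powr r)"
proof -
  define N where "N = nat \<lceil>r\<rceil>"
  obtain C where C: "\<And>x. (1 + norm x) ^ (CARD('d) + 2 + N) * norm (pderivs [] \<phi> x) \<le> C"
    using schwartz_decay[OF assms(1)] by metis
  show ?thesis
  proof (rule integrable_decay)
    show "(\<lambda>z. norm (\<phi> z) * norm z powr r) \<in> borel_measurable borel"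
      using schwartz_measurable[OF assms(1)] by measurable
    fix x :: "real^'d"
    have "norm x powr r \<le> (1 + norm x) powr r" using assms(2) by (intro powr_mono2) auto
    also have "\<dots> \<le> (1 + norm x) powr real N" unfolding N_def using real_nat_ceiling_ge[of r] by (intro powr_mono) auto
    also have "\<dots> = (1 + norm x) ^ N" by (simp add: powr_realpow add_pos_nonneg)
    finally have "(1 + norm x) ^ (CARD('d) + 2) * (norm (\<phi> x) * norm x powr r)
      \<le> (1 + norm x) ^ (CARD('d) + 2) * (norm (\<phi> x) * (1 + norm x) ^ N)"
      by (intro mult_left_mono) auto
    also have "\<dots> \<le> C" using C[of x] by (simp add: power_add mult_ac)
    finally show "(1 + norm x) ^ (CARD('d) + 2) * norm (norm (\<phi> x) * norm x powr r) \<le> C" by simp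
  qed
qed

lemma schwartz_integrable:
  fixes \<phi> :: "real^'d::finite \<Rightarrow> complex"
  assumes "\<phi> \<in> schwartz" shows "integrable lborel \<phi>"
proof -
  obtain C where "\<And>x. (1 + norm x) ^ (CARD('d) + 2) * norm (pderivs [] \<phi> x) \<le> C"
    using schwartz_decay[OF assms(1)] by metis
  then show ?thesis using schwartz_measurable[OF assms(1)] by (intro integrable_decay) auto
qed

section \<open>Dilations\<close>

lemma lborel_integral_affine:
  fixes f :: "real^'d::finite \<Rightarrow> complex"
  assumes "f \<in> borel_measurable borel" "c \<noteq> 0"
  shows "(LINT x|lborel. f x) = of_real (\<bar>c\<bar> ^ CARD('d)) * (LINT x|lborel. f (t + c *\<^sub>R x))"
proof -
  have "(LINT x|lborel. f x) =
     (LINT x|density (distr lborel borel (\<lambda>x. t + c *\<^sub>R x)) (\<lambda>_. ennreal (\<bar>c\<bar> ^ DIM(real^'d))). f x)"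
    by (subst lborel_affine[OF assms(2), of t]) (rule refl)
  also have "\<dots> = (LINT x|distr lborel borel (\<lambda>x. t + c *\<^sub>R x). (\<bar>c\<bar> ^ CARD('d)) *\<^sub>R f x)"
    using assms(1) by (subst integral_density) auto
  also have "\<dots> = (LINT x|lborel. (\<bar>c\<bar> ^ CARD('d)) *\<^sub>R f (t + c *\<^sub>R x))"
    using assms(1) by (subst integral_distr) auto
  finally show ?thesis by (simp add: scaleR_conv_of_real)
qed

lemma dilation_bsmooth: "bsmooth \<phi> \<Longrightarrow> bsmooth (dilation \<phi> n)"
  unfolding dilation_def[abs_def] using bsmooth_affine[of \<phi> 0 "real n"]
  by (intro bsmooth_cmult) simp

lemma pderivs_dilation:
  assumes "smooth \<phi>"
  shows "pderivs w (dilation \<phi> n) = (\<lambda>x. of_nat n ^ length w * dilation (pderivs w \<phi>) n x)"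
  using smooth_affine[OF assms, of 0 "real n"] pderivs_affine[OF assms, of w 0 "real n"]
  by (simp add: dilation_def[abs_def] pderivs_cmult mult_ac)

lemma convolution_commute:
  fixes u v :: "real^'d::finite \<Rightarrow> complex"
  assumes "u \<in> borel_measurable borel" "v \<in> borel_measurable borel"
  shows "(LINT y|lborel. u y * v (x - y)) = (LINT y|lborel. v y * u (x - y))"
proof -
  have "(\<lambda>y. u y * v (x - y)) \<in> borel_measurable borel" using assms by measurable
  from lborel_integral_affine[OF this, of "-1" x]
  show ?thesis by (simp add: mult.commute)
qed

lemma convolution_dilation:
  fixes \<phi> f :: "real^'d::finite \<Rightarrow> complex"
  assumes "\<phi> \<in> borel_measurable borel" "f \<in> borel_measurable borel" "n > 0"
  shows "(LINT y|lborel. dilation \<phi> n y * f (x - y)) = kconv \<phi> (1 / real n) f x"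
proof -
  have "dilation \<phi> n \<in> borel_measurable borel"
    unfolding dilation_def[abs_def] using assms by measurable
  then have "(\<lambda>y. dilation \<phi> n y * f (x - y)) \<in> borel_measurable borel" using assms by measurable
  from lborel_integral_affine[OF this, of "1 / real n" 0]
  have "(LINT y|lborel. dilation \<phi> n y * f (x - y)) =
    (LINT y|lborel. of_real ((1 / real n) ^ CARD('d)) * (dilation \<phi> n ((1 / real n) *\<^sub>R y) * f (x - (1 / real n) *\<^sub>R y)))"
    using assms(3) by simp
  also have "\<dots> = kconv \<phi> (1 / real n) f x"
    using assms(3) by (simp add: kconv_def dilation_def power_divide)
  finally show ?thesis .
qed

text \<open>Both sides are the convolution of the two dilations.\<close>

lemma kconv_dilation_swap:
  fixes \<phi> :: "real^'d::finite \<Rightarrow> complex"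
  assumes "\<phi> \<in> borel_measurable borel" "n > 0" "m > 0"
  shows "kconv \<phi> (1 / real m) (dilation \<phi> n) = kconv \<phi> (1 / real n) (dilation \<phi> m)"
proof (rule ext)
  fix x
  have d: "dilation \<phi> n \<in> borel_measurable borel" for n
    unfolding dilation_def[abs_def] using assms(1) by measurable
  show "kconv \<phi> (1 / real m) (dilation \<phi> n) x = kconv \<phi> (1 / real n) (dilation \<phi> m) x"
    using convolution_dilation[OF assms(1) d assms(3), of n x] convolution_dilation[OF assms(1) d assms(2), of m x]
      convolution_commute[OF d[of n] d[of m], of x] by simp
qed

section \<open>Mollifiers without moment conditions\<close>

text \<open>All partial derivatives of order exactly \<open>l\<close> are bounded by \<open>B\<close>.\<close>

definition deriv_bound :: "nat \<Rightarrow> real \<Rightarrow> (real^'d::finite \<Rightarrow> complex) \<Rightarrow> bool" where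
  "deriv_bound l B g \<longleftrightarrow> (\<forall>w x. length w = l \<longrightarrow> norm (pderivs w g x) \<le> B)"

lemma deriv_boundD: "deriv_bound l B g \<Longrightarrow> length w = l \<Longrightarrow> norm (pderivs w g x) \<le> B"
  by (simp add: deriv_bound_def)

lemma deriv_bound_add:
  "smooth f \<Longrightarrow> smooth g \<Longrightarrow> deriv_bound l B f \<Longrightarrow> deriv_bound l B' g \<Longrightarrow>
   deriv_bound l (B + B') (\<lambda>x. f x + g x)"
  unfolding deriv_bound_def by (auto simp: pderivs_add intro: norm_triangle_mono)

lemma deriv_bound_diff:
  "smooth f \<Longrightarrow> smooth g \<Longrightarrow> deriv_bound l B f \<Longrightarrow> deriv_bound l B' g \<Longrightarrow>
   deriv_bound l (B + B') (\<lambda>x. f x - g x)"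
  unfolding deriv_bound_def
  by (auto simp: pderivs_diff intro: order_trans[OF norm_triangle_ineq4 add_mono])

lemma bsmooth_deriv_bound:
  assumes "bsmooth g" obtains B where "B \<ge> 0" "deriv_bound l B g"
  by (rule bsmooth_bound_upto[OF assms, of l]) (auto simp: deriv_bound_def)

lemma kconv_add:
  "integrable lborel w \<Longrightarrow> bsmooth f \<Longrightarrow> bsmooth g \<Longrightarrow>
   kconv w e (\<lambda>x. f x + g x) = (\<lambda>x. kconv w e f x + kconv w e g x)"
  unfolding kconv_eq_sconv by (rule finite_order.sconv_add[OF finite_order_kernel])

lemma kconv_diff:
  "integrable lborel w \<Longrightarrow> bsmooth f \<Longrightarrow> bsmooth g \<Longrightarrow>
   kconv w e (\<lambda>x. f x - g x) = (\<lambda>x. kconv w e f x - kconv w e g x)"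
  unfolding kconv_eq_sconv by (rule finite_order.sconv_diff[OF finite_order_kernel])

text \<open>Kernels of total mass one with a finite first absolute moment. No moment of positive
  order has to vanish.\<close>

locale mollifier =
  fixes \<phi> :: "real^'d::finite \<Rightarrow> complex"
  assumes int\<phi>: "integrable lborel \<phi>"
    and int\<phi>1: "integrable lborel (\<lambda>z. norm (\<phi> z) * norm z)"
    and total: "(LINT z|lborel. \<phi> z) = 1"
begin

text \<open>The remainder \<open>I - A\<close> of the averaging operator \<open>A = kconv \<phi> e\<close>.\<close>

definition rem :: "real \<Rightarrow> (real^'d \<Rightarrow> complex) \<Rightarrow> real^'d \<Rightarrow> complex" where
  "rem e g = (\<lambda>x. g x - kconv \<phi> e g x)"

text \<open>The truncated Neumann series: \<open>I + (I - A) + \<dots> + (I - A) ^ (k - 1)\<close>, in Horner form.\<close>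

primrec neumann :: "real \<Rightarrow> nat \<Rightarrow> (real^'d \<Rightarrow> complex) \<Rightarrow> real^'d \<Rightarrow> complex" where
  "neumann e 0 g = (\<lambda>x. 0)"
| "neumann e (Suc k) g = (\<lambda>x. g x + rem e (neumann e k g) x)"

text \<open>A common constant for the two bounds on \<open>rem e\<close>: one without gain, and one that trades a
  derivative for a power of \<open>e\<close>.\<close>

definition mconst :: real where
  "mconst = 1 + L1norm \<phi> + real CARD('d) * (LINT z|lborel. norm (\<phi> z) * norm z)"

lemma mconst_ge: "mconst \<ge> 1 + L1norm \<phi>" "mconst \<ge> 1"
  "mconst \<ge> real CARD('d) * (LINT z|lborel. norm (\<phi> z) * norm z)"
proof -
  have "L1norm \<phi> \<ge> 0" "real CARD('d) * (LINT z|lborel. norm (\<phi> z) * norm z) \<ge> 0"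
    by (auto intro!: mult_nonneg_nonneg integral_nonneg_AE)
  then show "mconst \<ge> 1 + L1norm \<phi>" "mconst \<ge> 1"
    "mconst \<ge> real CARD('d) * (LINT z|lborel. norm (\<phi> z) * norm z)" unfolding mconst_def by linarith+
qed

lemma rem_bsmooth: "bsmooth g \<Longrightarrow> bsmooth (rem e g)"
  unfolding rem_def by (intro bsmooth_diff bsmooth_kconv int\<phi>)

lemma rem_pow_bsmooth: "bsmooth g \<Longrightarrow> bsmooth ((rem e ^^ n) g)"
  by (induction n) (auto intro: rem_bsmooth)

lemma neumann_bsmooth: "bsmooth g \<Longrightarrow> bsmooth (neumann e k g)"
  by (induction k) (auto intro!: bsmooth_add rem_bsmooth bsmooth_const)

lemma pderivs_rem: "bsmooth g \<Longrightarrow> pderivs w (rem e g) = rem e (pderivs w g)"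
  unfolding rem_def using int\<phi>
  by (subst pderivs_diff) (auto simp: bsmooth_smooth bsmooth_kconv pderivs_kconv)

lemma rem_bound_0:
  assumes "\<And>x. norm (g x) \<le> B"
  shows "norm (rem e g x) \<le> mconst * B"
proof -
  have "B \<ge> 0" using assms norm_ge_zero order_trans by blast
  have "norm (rem e g x) \<le> B + L1norm \<phi> * B"
    unfolding rem_def
    by (intro order_trans[OF norm_triangle_ineq4] add_mono assms kconv_bound int\<phi>)
  also have "\<dots> \<le> mconst * B"
    using mult_right_mono[OF mconst_ge(1) \<open>B \<ge> 0\<close>] by (simp add: distrib_right)
  finally show ?thesis .
qed

lemma rem_bound_1:
  assumes g: "bsmooth g" and B: "\<And>i x. norm (partial i g x) \<le> B"
  shows "norm (rem e g x) \<le> mconst * \<bar>e\<bar> * B"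
proof -
  let ?d = "real CARD('d)" and ?m = "LINT z|lborel. norm (\<phi> z) * norm z"
  have B0: "B \<ge> 0" using B norm_ge_zero order_trans by blast
  obtain b where b: "\<And>x. norm (g x) \<le> b" using bsmooth_bound[OF g] by blast
  have "norm (g x - g (x - e *\<^sub>R z)) \<le> ?d * B * \<bar>e\<bar> * norm z" for z
    using bsmooth_lipschitz[OF g B, of x "x - e *\<^sub>R z"] by simp
  from kconv_increment_bound[OF int\<phi> int\<phi>1 bsmooth_continuous[OF g] b this]
  have "norm (rem e g x) \<le> (?d * ?m) * (\<bar>e\<bar> * B)"
    by (simp add: total rem_def mult_ac)
  also have "\<dots> \<le> mconst * (\<bar>e\<bar> * B)"
    using B0 by (intro mult_right_mono mconst_ge) auto
  finally show ?thesis by (simp only: mult.assoc)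
qed

lemma rem_deriv_bound:
  assumes "bsmooth g"
  shows "deriv_bound l B g \<Longrightarrow> deriv_bound l (mconst * B) (rem e g)"
    and "deriv_bound (Suc l) B g \<Longrightarrow> deriv_bound l (mconst * \<bar>e\<bar> * B) (rem e g)"
proof -
  show "deriv_bound l B g \<Longrightarrow> deriv_bound l (mconst * B) (rem e g)"
    unfolding deriv_bound_def by (auto simp: pderivs_rem assms intro!: rem_bound_0)
  assume B: "deriv_bound (Suc l) B g"
  show "deriv_bound l (mconst * \<bar>e\<bar> * B) (rem e g)"
    unfolding deriv_bound_def
  proof (intro allI impI)
    fix w :: "'d list" and x assume w: "length w = l"
    show "norm (pderivs w (rem e g) x) \<le> mconst * \<bar>e\<bar> * B"
      unfolding pderivs_rem[OF assms]
    proof (rule rem_bound_1[OF bsmooth_pderivs[OF assms]])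
      show "norm (partial i (pderivs w g) x) \<le> B" for i x
        using deriv_boundD[OF B, of "i # w" x] w by simp
    qed
  qed
qed

text \<open>Out of \<open>k\<close> remainders, any number \<open>r \<le> k\<close> can be used to trade one derivative each for one
  power of \<open>e\<close>.\<close>

lemma rem_pow_deriv_bound:
  assumes "bsmooth g" "r \<le> k" "deriv_bound (l + r) B g"
  shows "deriv_bound l (mconst ^ k * \<bar>e\<bar> ^ r * B) ((rem e ^^ k) g)"
  using assms
proof (induction k arbitrary: r g B)
  case (Suc k)
  show ?case
  proof (cases r)
    case 0
    then have "deriv_bound l (mconst ^ k * \<bar>e\<bar> ^ 0 * (mconst * B)) ((rem e ^^ k) (rem e g))"
      using Suc.prems by (intro Suc.IH rem_bsmooth) (auto intro: rem_deriv_bound(1))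
    then show ?thesis using 0 by (simp add: funpow_Suc_right mult_ac del: funpow.simps)
  next
    case (Suc r')
    then have "deriv_bound l (mconst ^ k * \<bar>e\<bar> ^ r' * (mconst * \<bar>e\<bar> * B)) ((rem e ^^ k) (rem e g))"
      using Suc.prems by (intro Suc.IH rem_bsmooth) (auto intro: rem_deriv_bound(2))
    then show ?thesis using Suc by (simp add: funpow_Suc_right mult_ac del: funpow.simps)
  qed
qed simp

lemma neumann_deriv_bound:
  "\<exists>c\<ge>0. \<forall>e l B g. bsmooth g \<longrightarrow> B \<ge> 0 \<longrightarrow> deriv_bound l B g \<longrightarrow> deriv_bound l (c * B) (neumann e k g)"
proof (induction k)
  case 0
  show ?case by (intro exI[of _ 0]) (auto simp: deriv_bound_def pderivs_const)
next
  case (Suc k)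
  then obtain c where c: "c \<ge> 0" "\<And>e l B g. bsmooth g \<Longrightarrow> B \<ge> 0 \<Longrightarrow> deriv_bound l B g \<Longrightarrow> deriv_bound l (c * B) (neumann e k g)"
    by blast
  show ?case
  proof (intro exI[of _ "1 + mconst * c"] conjI allI impI)
    show "1 + mconst * c \<ge> 0" using c mconst_ge(2) by simp
    fix e l B and g :: "real^'d \<Rightarrow> complex" assume g: "bsmooth g" and "B \<ge> 0" "deriv_bound l B g"
    then have "deriv_bound l (B + mconst * (c * B)) (neumann e (Suc k) g)"
      using c by (auto intro!: deriv_bound_add bsmooth_smooth rem_bsmooth neumann_bsmooth rem_deriv_bound(1))
    then show "deriv_bound l ((1 + mconst * c) * B) (neumann e (Suc k) g)" by (simp add: algebra_simps)
  qed
qed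

lemma rem_add:
  "bsmooth f \<Longrightarrow> bsmooth g \<Longrightarrow> rem e (\<lambda>x. f x + g x) = (\<lambda>x. rem e f x + rem e g x)"
  by (simp add: rem_def kconv_add int\<phi> fun_eq_iff)

lemma rem_diff:
  "bsmooth f \<Longrightarrow> bsmooth g \<Longrightarrow> rem e (\<lambda>x. f x - g x) = (\<lambda>x. rem e f x - rem e g x)"
  by (simp add: rem_def kconv_diff int\<phi> fun_eq_iff)

lemma rem_kconv: "bsmooth g \<Longrightarrow> rem e (kconv \<phi> e' g) = kconv \<phi> e' (rem e g)"
  by (simp add: rem_def kconv_diff int\<phi> bsmooth_kconv kconv_commute[of \<phi> \<phi> g e e'])

lemma rem_commute: "bsmooth g \<Longrightarrow> rem e (rem e' g) = rem e' (rem e g)"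
  using rem_kconv[of g e e'] unfolding rem_def[of e'] 
  by (simp add: rem_diff bsmooth_kconv int\<phi>)

lemma neumann_kconv: "bsmooth g \<Longrightarrow> neumann e k (kconv \<phi> e' g) = kconv \<phi> e' (neumann e k g)"
proof (induction k)
  case 0
  then show ?case by (simp add: kconv_def fun_eq_iff)
next
  case (Suc k)
  then show ?case
    by (simp add: rem_kconv neumann_bsmooth kconv_add rem_bsmooth int\<phi>)
qed

lemma neumann_rem: "bsmooth g \<Longrightarrow> neumann e k (rem e' g) = rem e' (neumann e k g)"
proof (induction k)
  case 0
  then show ?case by (simp add: rem_def kconv_def fun_eq_iff)
next
  case (Suc k)
  then show ?case
    by (simp add: rem_commute[of _ e e'] neumann_bsmooth rem_add rem_bsmooth)
qed

lemma neumann_add: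
  "bsmooth f \<Longrightarrow> bsmooth g \<Longrightarrow> neumann e k (\<lambda>x. f x + g x) = (\<lambda>x. neumann e k f x + neumann e k g x)"
  by (induction k) (simp_all add: rem_add neumann_bsmooth add_ac)

lemma neumann_commute:
  "bsmooth g \<Longrightarrow> neumann e j (neumann e' k g) = neumann e' k (neumann e j g)"
proof (induction j)
  case 0
  have "neumann e' k (\<lambda>x. 0) = (\<lambda>x. 0)"
    by (induction k) (auto simp: rem_def kconv_def)
  then show ?case by simp
next
  case (Suc j)
  then show ?case
    by (simp add: neumann_add rem_bsmooth neumann_bsmooth neumann_rem)
qed

lemma neumann_inverts: "bsmooth g \<Longrightarrow> neumann e k (kconv \<phi> e g) = (\<lambda>x. g x - (rem e ^^ k) g x)"
proof (induction k)
  case (Suc k)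
  then have "neumann e (Suc k) (kconv \<phi> e g) = (\<lambda>x. kconv \<phi> e g x + (rem e g x - (rem e ^^ Suc k) g x))"
    by (simp add: rem_diff rem_pow_bsmooth)
  also have "\<dots> = (\<lambda>x. g x - (rem e ^^ Suc k) g x)"
    by (rule ext) (simp add: rem_def[of e g] del: funpow.simps)
  finally show ?case .
qed simp

text \<open>The key identity. If \<open>F\<close> and \<open>F'\<close> are the averages at scales \<open>e\<close> and \<open>e'\<close> of one
  distribution, so that averaging them crosswise gives the same function, then their corrected
  versions differ by two terms, each of which carries \<open>k\<close> remainders.\<close>

lemma neumann_difference:
  fixes k :: nat
  assumes F: "bsmooth F" "bsmooth F'" and eq: "kconv \<phi> e F' = kconv \<phi> e' F"
  defines "G \<equiv> neumann e k F" and "G' \<equiv> neumann e' k F'"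
  shows "G x - G' x = (rem e' ^^ k) G x - (rem e ^^ k) G' x"
proof -
  have G: "bsmooth G" "bsmooth G'" unfolding G_def G'_def by (intro neumann_bsmooth F)+
  have "(\<lambda>x. G x - (rem e' ^^ k) G x) = neumann e' k (kconv \<phi> e' G)"
    by (simp add: neumann_inverts G)
  also have "\<dots> = neumann e' k (neumann e k (kconv \<phi> e' F))"
    unfolding G_def by (simp add: neumann_kconv F)
  also have "\<dots> = neumann e k (neumann e' k (kconv \<phi> e F'))"
    using neumann_commute[OF bsmooth_kconv[OF int\<phi> F(1)]] eq by simp
  also have "\<dots> = neumann e k (kconv \<phi> e G')"
    unfolding G'_def by (simp add: neumann_kconv F)
  also have "\<dots> = (\<lambda>x. G' x - (rem e ^^ k) G' x)"
    by (simp add: neumann_inverts G)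
  finally have "G x - (rem e' ^^ k) G x = G' x - (rem e ^^ k) G' x" by (rule fun_cong)
  then show ?thesis by (simp add: algebra_simps)
qed

end

lemma schwartz_mollifier:
  assumes "\<phi> \<in> schwartz" "(LINT x|lborel. \<phi> x) = 1"
  shows "mollifier \<phi>"
proof
  have "(\<lambda>z::real^'d. norm z powr 1) = norm" by auto
  then show "integrable lborel (\<lambda>z. norm (\<phi> z) * norm z)"
    using schwartz_integrable_weighted[OF assms(1), of 1] by simp
qed (use assms schwartz_integrable in auto)

section \<open>Hoelder regularity from dyadic approximation\<close>

lemma uniform_limit_Ck:
  fixes G :: "nat \<Rightarrow> real^'d::finite \<Rightarrow> complex"
  assumes "\<And>j. smooth (G j)"
    and "\<And>w. length w \<le> l \<Longrightarrow> uniform_limit UNIV (\<lambda>j. pderivs w (G j)) (V w) sequentially"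
  shows "Ck l (V []) \<and> (\<forall>w. length w \<le> l \<longrightarrow> pderivs w (V []) = V w)"
  using assms
proof (induction l arbitrary: G V)
  case 0
  have "continuous_on UNIV (V [])"
  proof (rule uniform_limit_theorem)
    show "uniform_limit UNIV (\<lambda>j. pderivs [] (G j)) (V []) sequentially" by (rule 0) simp
    show "\<forall>\<^sub>F j in sequentially. continuous_on UNIV (pderivs [] (G j))"
      by (intro always_eventually allI smooth_continuous smooth_pderivs 0)
  qed simp
  then show ?case by simp
next
  case (Suc l)
  let ?D = "\<lambda>x h. \<Sum>i\<in>UNIV. (h $ i) *\<^sub>R V [i] x"
  have "\<exists>g. \<forall>x\<in>UNIV. (\<lambda>j. G j x) \<longlonglongrightarrow> g x \<and> (g has_derivative ?D x) (at x within UNIV)"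
  proof (rule has_derivative_sequence[where f'="\<lambda>j x h. \<Sum>i\<in>UNIV. (h $ i) *\<^sub>R partial i (G j) x"])
    show "(G j has_derivative (\<lambda>h. \<Sum>i\<in>UNIV. (h $ i) *\<^sub>R partial i (G j) x)) (at x within UNIV)" for j x
      using partial_differentiable[OF smooth_differentiable[OF Suc.prems(1)]] by simp
    show "(\<lambda>j. G j 0) \<longlonglongrightarrow> V [] 0"
      using tendsto_uniform_limitI[OF Suc.prems(2)[of "[]"], of 0] by simp
    fix e :: real assume e: "e > 0"
    define e' where "e' = e / real CARD('d)"
    have e': "e' > 0" using e by (simp add: e'_def)
    have "\<forall>\<^sub>F j in sequentially. \<forall>x\<in>UNIV. dist (pderivs [i] (G j) x) (V [i] x) < e'" for i
      using uniform_limitD[OF Suc.prems(2)[of "[i]"] e'] by simp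
    then have "\<forall>\<^sub>F j in sequentially. \<forall>i x. dist (partial i (G j) x) (V [i] x) < e'"
      by (simp add: eventually_all_finite)
    then show "\<forall>\<^sub>F j in sequentially. \<forall>x\<in>UNIV. \<forall>h.
      norm ((\<Sum>i\<in>UNIV. (h $ i) *\<^sub>R partial i (G j) x) - ?D x h) \<le> e * norm h"
    proof eventually_elim
      case (elim j)
      show ?case
      proof (intro ballI allI)
        fix x h :: "real^'d"
        have "norm ((\<Sum>i\<in>UNIV. (h $ i) *\<^sub>R partial i (G j) x) - ?D x h) =
          norm (\<Sum>i\<in>UNIV. (h $ i) *\<^sub>R (partial i (G j) x - V [i] x))"
          by (simp add: sum_subtractf scaleR_diff_right)
        also have "\<dots> \<le> (\<Sum>i\<in>(UNIV::'d set). norm h * e')"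
        proof (intro order_trans[OF norm_sum] sum_mono)
          fix i
          have "norm (partial i (G j) x - V [i] x) \<le> e'"
            using elim by (simp add: dist_norm less_imp_le)
          then show "norm ((h $ i) *\<^sub>R (partial i (G j) x - V [i] x)) \<le> norm h * e'"
            unfolding norm_scaleR by (intro mult_mono component_le_norm_cart abs_ge_zero) auto
        qed
        also have "\<dots> = e * norm h" by (simp add: e'_def)
        finally show "norm ((\<Sum>i\<in>UNIV. (h $ i) *\<^sub>R partial i (G j) x) - ?D x h) \<le> e * norm h" .
      qed
    qed
  qed auto
  then obtain g where g: "\<And>x. (\<lambda>j. G j x) \<longlonglongrightarrow> g x" "\<And>x. (g has_derivative ?D x) (at x)" by auto
  have "g = V []"
  proof
    fix x
    have "(\<lambda>j. G j x) \<longlonglongrightarrow> V [] x"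
      using tendsto_uniform_limitI[OF Suc.prems(2)[of "[]"], of x] by simp
    then show "g x = V [] x" using g(1) LIMSEQ_unique by blast
  qed
  then have D: "(V [] has_derivative ?D x) (at x)" for x using g(2) by simp
  have p: "partial i (V []) = V [i]" for i
    by (rule ext, subst partial_eqI[OF D]) (simp only: axis_sum_simp)
  have IH: "Ck l (V [i]) \<and> (\<forall>w. length w \<le> l \<longrightarrow> pderivs w (V [i]) = V (w @ [i]))" for i
  proof -
    have "Ck l ((\<lambda>w. V (w @ [i])) []) \<and>
      (\<forall>w. length w \<le> l \<longrightarrow> pderivs w ((\<lambda>w. V (w @ [i])) []) = (\<lambda>w. V (w @ [i])) w)"
    proof (rule Suc.IH)
      show "smooth (partial i (G j))" for j by (intro smooth_partial Suc.prems)
      show "uniform_limit UNIV (\<lambda>j. pderivs w (partial i (G j))) (V (w @ [i])) sequentially"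
        if "length w \<le> l" for w
        using Suc.prems(2)[of "w @ [i]"] that by simp
    qed
    then show ?thesis by simp
  qed
  have "Ck (Suc l) (V [])"
    by (rule Ck_SucI[OF D]) (simp only: axis_sum_simp IH)
  moreover have "pderivs w (V []) = V w" if "length w \<le> Suc l" for w
  proof (cases w rule: rev_cases)
    case (snoc v i)
    then show ?thesis using IH that by (simp add: p)
  qed simp
  ultimately show ?case by blast
qed

lemma geometric_telescope:
  fixes a :: "nat \<Rightarrow> complex"
  assumes "0 < q" "q < 1" and "\<And>j. norm (a j - a (Suc j)) \<le> E * q ^ j"
  shows "convergent a" and "norm (lim a - a j) \<le> E / (1 - q) * q ^ j"
proof -
  have gs: "summable (\<lambda>j. E * q ^ j)" using assms by (intro summable_mult summable_geometric) simp
  have "summable (\<lambda>j. a (Suc j) - a j)"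
    by (rule summable_comparison_test'[OF gs, of 0]) (use assms(3) in \<open>simp add: norm_minus_commute\<close>)
  then have "convergent (\<lambda>n. a n - a 0)" by (simp add: summable_iff_convergent sum_lessThan_telescope)
  from convergent_add[OF this convergent_const[of "a 0"]] show c: "convergent a" by simp
  have "norm (a (j + m) - a j) \<le> E / (1 - q) * q ^ j" for m
  proof -
    have E: "E \<ge> 0" using order_trans[OF norm_ge_zero assms(3)[of 0]] by simp
    have "norm (a (j + m) - a j) \<le> (\<Sum>i<m. E * q ^ j * q ^ i)"
    proof (induction m)
      case (Suc m)
      have "norm (a (j + Suc m) - a j) \<le> norm (a (j + m) - a j) + norm (a (j + m) - a (Suc (j + m)))"
        using norm_triangle_ineq4[of "a (j + m) - a j" "a (j + m) - a (Suc (j + m))"] by simp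
      then show ?case using Suc assms(3)[of "j + m"] by (simp add: power_add mult_ac)
    qed simp
    also have "\<dots> = E * q ^ j * (\<Sum>i<m. q ^ i)" by (simp add: sum_distrib_left)
    also have "\<dots> \<le> E * q ^ j * (1 / (1 - q))"
    proof (rule mult_left_mono)
      show "(\<Sum>i<m. q ^ i) \<le> 1 / (1 - q)"
        using assms by (subst sum_gp_strict) (auto simp: divide_right_mono)
      show "0 \<le> E * q ^ j" using E assms by simp
    qed
    finally show ?thesis by (simp add: mult_ac)
  qed
  moreover have "(\<lambda>m. norm (a (j + m) - a j)) \<longlonglongrightarrow> norm (lim a - a j)"
  proof -
    have "a \<longlonglongrightarrow> lim a" using c by (simp add: convergent_LIMSEQ_iff)
    then have "(\<lambda>m. a (j + m)) \<longlonglongrightarrow> lim a" using LIMSEQ_ignore_initial_segment[of a "lim a" j] by (simp add: add.commute)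
    then show ?thesis by (intro tendsto_intros)
  qed
  ultimately show "norm (lim a - a j) \<le> E / (1 - q) * q ^ j"
    by (intro LIMSEQ_le_const2) auto
qed

lemma geometric_growth:
  fixes a :: "nat \<Rightarrow> complex"
  assumes "p > 1" "E \<ge> 0" "B \<ge> 0" "norm (a 0) \<le> B" and "\<And>j. norm (a j - a (Suc j)) \<le> E * p ^ j"
  shows "norm (a j) \<le> (B + E / (p - 1)) * p ^ j"
proof -
  have "norm (a j) \<le> B + E / (p - 1) * (p ^ j - 1)"
  proof (induction j)
    case (Suc j)
    have "norm (a (Suc j)) \<le> norm (a j) + norm (a j - a (Suc j))"
      using norm_triangle_ineq4[of "a j" "a j - a (Suc j)"] by simp
    also have "\<dots> \<le> B + E / (p - 1) * (p ^ j - 1) + E * p ^ j"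
      using Suc assms(5)[of j] by linarith
    also have "\<dots> = B + E / (p - 1) * (p ^ Suc j - 1)"
      using assms(1) by (simp add: field_simps)
    finally show ?case .
  qed (use assms in simp)
  also have "\<dots> \<le> B * p ^ j + E / (p - 1) * p ^ j"
    using assms by (intro add_mono mult_left_mono) (auto simp: mult_le_cancel_left1 one_le_power)
  finally show ?thesis by (simp add: distrib_right)
qed

text \<open>Approximation of order \<open>2 powr (- \<sigma> j)\<close> by functions with Lipschitz constants of order
  \<open>2 powr ((1 - \<sigma>) j)\<close> gives Hoelder continuity of exponent \<open>\<sigma>\<close>.\<close>

lemma hoelder_from_approximation:
  fixes v :: "real^'d::finite \<Rightarrow> complex"
  assumes \<sigma>: "0 < \<sigma>" "\<sigma> < 1" and E: "E \<ge> 0" and b: "\<And>x. norm (v x) \<le> b"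
    and 1: "\<And>j x. norm (v x - u j x) \<le> E * (2 powr (- \<sigma>)) ^ j"
    and 2: "\<And>j x t. norm (u j x - u j t) \<le> E * (2 powr (1 - \<sigma>)) ^ j * norm (x - t)"
  shows "norm (v x - v t) \<le> (2 * b + 5 * E) * norm (x - t) powr \<sigma>"
proof -
  let ?r = "norm (x - t)"
  have b0: "b \<ge> 0" using b norm_ge_zero order_trans by blast
  consider "?r = 0" | "?r \<ge> 1" | "0 < ?r" "?r < 1" by fastforce
  then show ?thesis
  proof cases
    case 2
    have "norm (v x - v t) \<le> 2 * b"
      using norm_triangle_ineq4[of "v x" "v t"] b[of x] b[of t] by linarith
    also have "\<dots> \<le> (2 * b + 5 * E) * 1" using E by simp
    also have "\<dots> \<le> (2 * b + 5 * E) * ?r powr \<sigma>"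
      using 2 \<sigma> E b0 by (intro mult_left_mono ge_one_powr_ge_zero) auto
    finally show ?thesis .
  next
    case 3
    have "\<exists>n. (1/2::real) ^ Suc n < ?r"
    proof -
      obtain n where "(1/2::real) ^ n < ?r" using real_arch_pow_inv[of ?r "1/2"] 3 by auto
      moreover have "(1/2::real) ^ Suc n \<le> (1/2) ^ n" by simp
      ultimately show ?thesis by (intro exI[of _ n]) linarith
    qed
    \<comment> \<open>The scale \<open>j\<close> with \<open>2 powr (- j - 1) < norm (x - t) \<le> 2 powr (- j)\<close> balances the two
      bounds.\<close>
    define j where "j = (LEAST n. (1/2::real) ^ Suc n < ?r)"
    have j1: "(1/2::real) ^ Suc j < ?r" unfolding j_def by (rule LeastI_ex) fact
    have j2: "?r \<le> (1/2::real) ^ j"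
    proof (cases j)
      case 0 then show ?thesis using 3 by simp
    next
      case (Suc i)
      then have "\<not> (1/2::real) ^ Suc i < ?r"
        using not_less_Least[of i "\<lambda>n. (1/2::real) ^ Suc n < ?r"] by (simp add: j_def)
      then show ?thesis using Suc by simp
    qed
    have half: "(1/2::real) ^ j = 2 powr (- real j)"
      by (simp add: powr_minus powr_realpow power_divide inverse_eq_divide)
    have "(2 powr (- \<sigma>)) ^ j = ((1/2::real) ^ j) powr \<sigma>"
      unfolding half by (simp add: powr_powr powr_power mult.commute)
    also have "\<dots> \<le> (2 * ?r) powr \<sigma>" using j1 \<sigma> by (intro powr_mono2) auto
    also have "\<dots> = 2 powr \<sigma> * ?r powr \<sigma>" by (simp add: powr_mult)
    also have "\<dots> \<le> 2 * ?r powr \<sigma>"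
      using \<sigma> powr_mono[of \<sigma> 1 2] by (intro mult_right_mono) auto
    finally have e1: "(2 powr (- \<sigma>)) ^ j \<le> 2 * ?r powr \<sigma>" .
    have "(2 powr (1 - \<sigma>)) ^ j = ((2::real) ^ j) powr (1 - \<sigma>)"
      by (simp add: powr_powr powr_power powr_realpow[symmetric] mult.commute)
    also have "(2::real) ^ j = 1 / (1/2) ^ j" by (simp add: power_divide)
    finally have "(2 powr (1 - \<sigma>)) ^ j * ?r = (1 / (1/2::real) ^ j) powr (1 - \<sigma>) * ?r" by simp
    also have "\<dots> \<le> (1 / ?r) powr (1 - \<sigma>) * ?r"
      using j2 3 \<sigma> by (intro mult_right_mono powr_mono2 divide_left_mono) auto
    also have "\<dots> = ?r powr \<sigma>"
      using 3 by (simp add: powr_divide powr_diff)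
    finally have e2: "(2 powr (1 - \<sigma>)) ^ j * ?r \<le> ?r powr \<sigma>" .
    have "norm (v x - v t) = norm ((v x - u j x) + (u j x - u j t) - (v t - u j t))" by simp
    also have "\<dots> \<le> norm (v x - u j x) + norm (u j x - u j t) + norm (v t - u j t)"
      by (rule order_trans[OF norm_triangle_ineq4]) (rule add_mono[OF norm_triangle_ineq order_refl])
    also have "\<dots> \<le> E * (2 * ?r powr \<sigma>) + E * (?r powr \<sigma>) + E * (2 * ?r powr \<sigma>)"
    proof -
      have "norm (v y - u j y) \<le> E * (2 * ?r powr \<sigma>)" for y
        using 1[of y j] mult_left_mono[OF e1 E] by linarith
      moreover have "norm (u j x - u j t) \<le> E * (?r powr \<sigma>)"
        using 2[of j x t] mult_left_mono[OF e2 E] by (simp add: mult.assoc)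
      ultimately show ?thesis by (intro add_mono) auto
    qed
    also have "\<dots> = 5 * E * ?r powr \<sigma>" by simp
    also have "\<dots> \<le> (2 * b + 5 * E) * ?r powr \<sigma>" using b0 by (intro mult_right_mono) auto
    finally show ?thesis .
  qed auto
qed

text \<open>The sufficient half of the Littlewood-Paley description of Hoelder spaces. For orders
  \<open>l < \<alpha>\<close> the differences are summable and the derivatives converge; for the order \<open>[\<alpha>] + 1 > \<alpha>\<close>,
  which is still at most \<open>k\<close>, they grow geometrically and give the Lipschitz constants.\<close>

theorem hoelder_of_dyadic_differences:
  fixes G :: "nat \<Rightarrow> real^'d::finite \<Rightarrow> complex"
  assumes G: "\<And>j. bsmooth (G j)" and \<alpha>: "\<alpha> > 0" "\<alpha> \<notin> \<nat>" "real k > \<alpha>" and E: "E \<ge> 0"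
    and diff: "\<And>l w j x. l \<le> k \<Longrightarrow> length w = l \<Longrightarrow>
      norm (pderivs w (G j) x - pderivs w (G (Suc j)) x) \<le> E * (2 powr (real l - \<alpha>)) ^ j"
  obtains f where "f \<in> hoelder \<alpha>" "uniform_limit UNIV G f sequentially"
proof -
  define a where "a = nat \<lfloor>\<alpha>\<rfloor>"
  have a1: "real a < \<alpha>"
  proof -
    have "real a \<le> \<alpha>" using \<alpha> unfolding a_def by simp
    moreover have "real a \<noteq> \<alpha>" using \<alpha>(2) by (metis of_nat_in_Nats)
    ultimately show ?thesis by simp
  qed
  have a2: "\<alpha> < real a + 1" unfolding a_def using \<alpha> by linarith
  have ak: "Suc a \<le> k" using a1 \<alpha>(3) by simp
  have fl: "of_int \<lfloor>\<alpha>\<rfloor> = real a" unfolding a_def using \<alpha> by simp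
  define q where "q l = 2 powr (real l - \<alpha>)" for l
  have q: "0 < q l" "q l < 1" if "l \<le> a" for l
  proof -
    have "2 powr (real l - \<alpha>) < 2 powr 0" using that a1 by (intro powr_less_mono) auto
    then show "0 < q l" "q l < 1" by (simp_all add: q_def)
  qed
  define V where "V w x = lim (\<lambda>j. pderivs w (G j) x)" for w x
  have V: "norm (V w x - pderivs w (G j) x) \<le> E / (1 - q (length w)) * q (length w) ^ j"
    if "length w \<le> a" for w j x
    unfolding V_def
    using q[OF that] diff[of "length w" w _ x] that ak
    by (intro geometric_telescope) (auto simp: q_def)
  have ul: "uniform_limit UNIV (\<lambda>j. pderivs w (G j)) (V w) sequentially" if w: "length w \<le> a" for w
  proof (rule uniform_limitI)
    fix e :: real assume "e > 0"
    have "(\<lambda>j. E / (1 - q (length w)) * q (length w) ^ j) \<longlonglongrightarrow> E / (1 - q (length w)) * 0"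
      using q[OF w] by (intro tendsto_intros LIMSEQ_power_zero) simp
    then have "\<forall>\<^sub>F j in sequentially. E / (1 - q (length w)) * q (length w) ^ j < e"
      using \<open>e > 0\<close> by (intro order_tendstoD) auto
    then show "\<forall>\<^sub>F j in sequentially. \<forall>x\<in>UNIV. dist (pderivs w (G j) x) (V w x) < e"
    proof eventually_elim
      case (elim j)
      then show ?case using V[OF w] by (auto simp: dist_norm norm_minus_commute intro: le_less_trans)
    qed
  qed
  have VC: "Ck a (V [])" "\<And>w. length w \<le> a \<Longrightarrow> pderivs w (V []) = V w"
    using uniform_limit_Ck[of G a V] G bsmooth_smooth ul by blast+
  have Vb: "\<exists>b. \<forall>x. norm (V w x) \<le> b" if w: "length w \<le> a" for w
  proof -
    obtain B where B: "\<And>x. norm (pderivs w (G 0) x) \<le> B"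
      using bsmooth_bound[OF bsmooth_pderivs[OF G]] by metis
    have "norm (V w x) \<le> E / (1 - q (length w)) + B" for x
      using norm_triangle_ineq2[of "V w x" "pderivs w (G 0) x"] V[OF w, of x 0] B[of x] by simp
    then show ?thesis by blast
  qed
  have "V [] \<in> hoelder \<alpha>"
    unfolding hoelder_def a_def[symmetric] fl
  proof (intro CollectI conjI allI impI)
    show "Ck a (V [])" by (rule VC)
    show "bounded (range (mpartial m (V [])))" if "mi_order m \<le> a" for m
      using VC(2)[of "mi_word m"] Vb[of "mi_word m"] that
      by (auto simp: mpartial_word length_mi_word bounded_iff)
    fix m :: "'d \<Rightarrow> nat" assume "mi_order m = a"
    then have w: "length (mi_word m) = a" by (simp add: length_mi_word)
    define w where "w = mi_word m"
    have w: "length w = a" using w by (simp add: w_def)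
    define \<sigma> where "\<sigma> = \<alpha> - real a"
    have \<sigma>: "0 < \<sigma>" "\<sigma> < 1" using a1 a2 by (auto simp: \<sigma>_def)
    obtain b where b: "\<And>x. norm (V w x) \<le> b" using Vb w by blast
    obtain B where B: "B \<ge> 0" "\<And>v x. length v \<le> Suc a \<Longrightarrow> norm (pderivs v (G 0) x) \<le> B"
      using bsmooth_bound_upto[OF G] by blast
    define p where "p = 2 powr (1 - \<sigma>)"
    have p: "p > 1"
      using powr_less_mono[of 0 "1 - \<sigma>" 2] \<sigma> by (simp add: p_def)
    define E1 where "E1 = E / (1 - q a) + real CARD('d) * (B + E / (p - 1))"
    have E10: "E / (1 - q a) \<ge> 0" "real CARD('d) * (B + E / (p - 1)) \<ge> 0"
      using E q[of a] p B by auto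
    have "norm (V w x - V w t) \<le> (2 * b + 5 * E1) * norm (x - t) powr \<sigma>" for x t
    proof (rule hoelder_from_approximation[OF \<sigma> _ b, where u="\<lambda>j. pderivs w (G j)"])
      show "E1 \<ge> 0" unfolding E1_def using E10 by linarith
      fix j :: nat and x t :: "real^'d"
      have "norm (V w x - pderivs w (G j) x) \<le> E / (1 - q a) * q a ^ j" using V[of w x j] w by simp
      also have "\<dots> \<le> E1 * q a ^ j"
        using E10 q[of a] by (intro mult_right_mono) (auto simp: E1_def)
      finally show "norm (V w x - pderivs w (G j) x) \<le> E1 * (2 powr (- \<sigma>)) ^ j"
        by (simp add: q_def \<sigma>_def)
      have "norm (pderivs w (G j) x - pderivs w (G j) t) \<le> real CARD('d) * ((B + E / (p - 1)) * p ^ j) * norm (x - t)"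
      proof (rule bsmooth_lipschitz[OF bsmooth_pderivs[OF G]])
        fix i y
        have "norm ((\<lambda>j. pderivs (i # w) (G j) y) j) \<le> (B + E / (p - 1)) * p ^ j"
        proof (rule geometric_growth[OF p E B(1)])
          show "norm (pderivs (i # w) (G 0) y) \<le> B" using B(2)[of "i # w" y] w by simp
          show "norm (pderivs (i # w) (G j) y - pderivs (i # w) (G (Suc j)) y) \<le> E * p ^ j" for j
            using diff[of "Suc a" "i # w" j y] ak w by (simp add: p_def \<sigma>_def algebra_simps)
        qed
        then show "norm (partial i (pderivs w (G j)) y) \<le> (B + E / (p - 1)) * p ^ j" by simp
      qed
      also have "\<dots> \<le> E1 * p ^ j * norm (x - t)"
      proof -
        have "real CARD('d) * (B + E / (p - 1)) \<le> E1" using E10 by (simp add: E1_def)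
        then have "real CARD('d) * (B + E / (p - 1)) * p ^ j \<le> E1 * p ^ j" using p by (intro mult_right_mono) auto
        then show ?thesis by (intro mult_right_mono) (simp_all add: mult.assoc)
      qed
      finally show "norm (pderivs w (G j) x - pderivs w (G j) t) \<le> E1 * (2 powr (1 - \<sigma>)) ^ j * norm (x - t)"
        by (simp add: p_def)
    qed
    then have "norm (mpartial m (V []) x - mpartial m (V []) t) / norm (x - t) powr (\<alpha> - real a) \<le> 2 * b + 5 * E1"
      if "x \<noteq> t" for x t
      using that VC(2)[of w] w
      by (simp add: mpartial_word w_def[symmetric] \<sigma>_def pos_divide_le_eq)
    then show "\<exists>C. \<forall>x t. x \<noteq> t \<longrightarrow>
      norm (mpartial m (V []) x - mpartial m (V []) t) / norm (x - t) powr (\<alpha> - real a) \<le> C" by blast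
  qed
  moreover have "uniform_limit UNIV G (V []) sequentially" using ul[of "[]"] by simp
  ultimately show ?thesis using that by blast
qed

section \<open>Compactly supported functions and Hoelder functions\<close>

lemma partial_zero_off_closed:
  fixes f :: "real^'d::finite \<Rightarrow> complex"
  assumes "closed K" "\<And>x. x \<notin> K \<Longrightarrow> f x = 0" "x \<notin> K"
  shows "partial i f x = 0"
proof -
  have "((\<lambda>_. 0) has_derivative (\<lambda>_. 0)) (at x)" by simp
  then have "(f has_derivative (\<lambda>_. 0)) (at x)"
    by (rule has_derivative_transform_within_open[where s="- K"])
       (use assms in \<open>auto simp: closed_def\<close>)
  then show ?thesis by (rule partial_eqI)
qed

lemma pderivs_zero_off_closed:
  fixes f :: "real^'d::finite \<Rightarrow> complex"
  assumes "closed K" "\<And>x. x \<notin> K \<Longrightarrow> f x = 0"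
  shows "x \<notin> K \<Longrightarrow> pderivs w f x = 0"
proof (induction w arbitrary: x)
  case (Cons i w)
  then show ?case using partial_zero_off_closed[OF assms(1), of "pderivs w f"] by simp
qed (use assms in simp)

lemma bounded_of_compact_support:
  fixes f :: "real^'d::finite \<Rightarrow> complex"
  assumes "continuous_on UNIV f" "compact K" "\<And>x. x \<notin> K \<Longrightarrow> f x = 0"
  obtains B where "B \<ge> 0" "\<And>x. norm (f x) \<le> B"
proof -
  have "compact (f ` K)"
    using assms by (intro compact_continuous_image continuous_on_subset[OF assms(1)]) auto
  then have "bounded (f ` K)" by (rule compact_imp_bounded)
  then obtain B where B: "\<And>x. x \<in> K \<Longrightarrow> norm (f x) \<le> B"
    by (auto simp: bounded_iff)
  have "norm (f x) \<le> \<bar>B\<bar>" for x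
    using B[of x] assms(3)[of x] by (cases "x \<in> K") auto
  then show ?thesis using that[of "\<bar>B\<bar>"] by simp
qed

lemma integrable_of_compact_support:
  fixes f :: "real^'d::finite \<Rightarrow> complex"
  assumes "continuous_on UNIV f" "compact K" "\<And>x. x \<notin> K \<Longrightarrow> f x = 0"
  shows "integrable lborel f"
proof -
  have "integrable lborel (\<lambda>x. indicator K x *\<^sub>R f x)"
    using assms by (intro borel_integrable_compact continuous_on_subset[OF assms(1)]) auto
  moreover have "(\<lambda>x. indicator K x *\<^sub>R f x) = f"
    using assms(3) by (auto simp: indicator_def fun_eq_iff)
  ultimately show ?thesis by simp
qed

lemma test_functionsD:
  assumes "\<psi> \<in> test_functions U"
  shows "smooth \<psi>" "compact (fun_support \<psi>)" "fun_support \<psi> \<subseteq> U"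
  using assms by (auto simp: test_functions_def)

lemma test_functions_bsmooth:
  assumes "\<psi> \<in> test_functions U"
  shows "bsmooth \<psi>"
proof -
  have "\<exists>B. \<forall>x. norm (pderivs w \<psi> x) \<le> B" for w
  proof -
    have "closed (fun_support \<psi>)" by (simp add: fun_support_def)
    then have "pderivs w \<psi> x = 0" if "x \<notin> fun_support \<psi>" for x
      using fun_support_zero that by (rule pderivs_zero_off_closed)
    moreover have "continuous_on UNIV (pderivs w \<psi>)"
      using test_functionsD(1)[OF assms] by (intro smooth_continuous smooth_pderivs)
    ultimately show ?thesis
      using bounded_of_compact_support[OF _ test_functionsD(2)[OF assms], of "pderivs w \<psi>"] by metis
  qed
  then show ?thesis using test_functionsD(1)[OF assms] by (auto simp: bsmooth_def)
qed

lemma test_functions_integrable: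
  "\<psi> \<in> test_functions U \<Longrightarrow> integrable lborel \<psi>"
  by (rule integrable_of_compact_support[where K="fun_support \<psi>"])
     (auto simp: test_functionsD fun_support_zero intro: smooth_continuous test_functionsD)

lemma hoelder_continuous: "f \<in> hoelder \<alpha> \<Longrightarrow> continuous_on UNIV f"
  using Ck_continuous by (auto simp: hoelder_def)

lemma hoelder_bounded:
  assumes "f \<in> hoelder \<alpha>"
  obtains B where "B \<ge> 0" "\<And>x. norm (f x) \<le> B"
proof -
  have "mi_word (\<lambda>_. 0) = ([] :: 'a list)"
    using length_mi_word[of "\<lambda>_. 0 :: nat"] by (simp add: mi_order_def)
  then have "mpartial (\<lambda>_. 0) f = f" by (simp add: mpartial_word)
  moreover have "bounded (range (mpartial (\<lambda>_. 0) f))"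
    using assms unfolding hoelder_def by (simp add: mi_order_def)
  ultimately obtain B where "\<And>x. norm (f x) \<le> B" by (auto simp: bounded_iff)
  then have B: "\<And>x. norm (f x) \<le> \<bar>B\<bar>" by (meson abs_ge_self order_trans)
  show ?thesis by (rule that[of "\<bar>B\<bar>"]) (use B in auto)
qed

context mollifier
begin

lemma kconv_tendsto:
  assumes f: "continuous_on UNIV f" "\<And>x. norm (f x) \<le> B"
  shows "(\<lambda>n. kconv \<phi> (1 / real n) f x) \<longlonglongrightarrow> f x"
proof -
  have "(\<lambda>n. LINT z|lborel. \<phi> z * f (x - (1 / real n) *\<^sub>R z)) \<longlonglongrightarrow> (LINT z|lborel. \<phi> z * f x)"
  proof (rule integral_dominated_convergence[where w="\<lambda>z. norm (\<phi> z) * B"])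
    show "(\<lambda>z. \<phi> z * f x) \<in> borel_measurable lborel" using int\<phi> by auto
    show "(\<lambda>z. \<phi> z * f (x - (1 / real n) *\<^sub>R z)) \<in> borel_measurable lborel" for n
      using integrable_kconv[OF int\<phi> f, of x "1 / real n"] by (rule borel_measurable_integrable)
    show "integrable lborel (\<lambda>z. norm (\<phi> z) * B)" using int\<phi> by simp
    show "AE z in lborel. norm (\<phi> z * f (x - (1 / real n) *\<^sub>R z)) \<le> norm (\<phi> z) * B" for n
      using f(2) by (auto simp: norm_mult intro!: mult_left_mono)
    show "AE z in lborel. (\<lambda>n. \<phi> z * f (x - (1 / real n) *\<^sub>R z)) \<longlonglongrightarrow> \<phi> z * f x"
    proof (rule AE_I2)
      fix z
      have "(\<lambda>n. x - (1 / real n) *\<^sub>R z) \<longlonglongrightarrow> x - 0 *\<^sub>R z"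
        by (intro tendsto_intros lim_1_over_n)
      then have "(\<lambda>n. x - (1 / real n) *\<^sub>R z) \<longlonglongrightarrow> x" by simp
      moreover have "isCont f x" using f(1) by (simp add: continuous_on_eq_continuous_at)
      ultimately show "(\<lambda>n. \<phi> z * f (x - (1 / real n) *\<^sub>R z)) \<longlonglongrightarrow> \<phi> z * f x"
        by (intro tendsto_mult[OF tendsto_const] isCont_tendsto_compose[of x f])
    qed
  qed
  then show ?thesis using total by (simp add: kconv_def)
qed

text \<open>A distribution whose mollifications are the averages of a bounded continuous function is
  that function.\<close>

lemma represented_of_mollified:
  assumes S: "finite_order S K N C" and \<phi>: "bsmooth \<phi>"
    and f: "continuous_on UNIV f" "\<And>x. norm (f x) \<le> B"
    and eq: "\<And>n x. n > 0 \<Longrightarrow> sconv S (dilation \<phi> n) x = kconv \<phi> (1 / real n) f x"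
    and \<psi>: "\<psi> \<in> test_functions UNIV"
  shows "S \<psi> = (LINT x|lborel. f x * \<psi> x)"
proof -
  interpret finite_order S K N C by (rule S)
  have \<psi>b: "bsmooth \<psi>" and \<psi>i: "integrable lborel \<psi>"
    using \<psi> by (rule test_functions_bsmooth, rule test_functions_integrable)
  have B0: "B \<ge> 0" using f(2) norm_ge_zero order_trans by blast
  let ?F = "\<lambda>n. sconv S (dilation \<phi> n)"
  have dm: "dilation \<phi> n \<in> borel_measurable borel" for n
    by (intro borel_measurable_continuous_onI bsmooth_continuous dilation_bsmooth \<phi>)
  have pair: "(LINT x|lborel. ?F n x * \<psi> x) = S (kconv \<phi> (- (1 / real n)) \<psi>)" if n: "n > 0" for n
  proof -
    have "(LINT x|lborel. ?F n x * \<psi> x) = kconv \<psi> (-1) (?F n) 0"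
      by (simp add: kconv_def mult.commute)
    also have "\<dots> = sconv S (kconv \<psi> (-1) (dilation \<phi> n)) 0"
      using kconv_sconv[OF \<psi>i dilation_bsmooth[OF \<phi>]] by simp
    also have "\<dots> = S (\<lambda>y. kconv \<psi> (-1) (dilation \<phi> n) (0 - y))" by (simp add: sconv_def)
    also have "(\<lambda>y. kconv \<psi> (-1) (dilation \<phi> n) (0 - y)) = kconv \<phi> (- (1 / real n)) \<psi>"
    proof
      fix y
      have \<psi>m: "(\<lambda>v. \<psi> (- v)) \<in> borel_measurable borel"
        using \<psi>i by simp
      have "(\<lambda>z. \<psi> z * dilation \<phi> n (z - y)) \<in> borel_measurable borel"
        using \<psi>i dm by simp
      from lborel_integral_affine[OF this, of 1 y]
      have "kconv \<psi> (-1) (dilation \<phi> n) (0 - y) = (LINT u|lborel. dilation \<phi> n u * (\<lambda>v. \<psi> (- v)) (- y - u))"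
        by (simp add: kconv_def mult.commute add.commute)
      also have "\<dots> = kconv \<phi> (1 / real n) (\<lambda>v. \<psi> (- v)) (- y)"
        using int\<phi> by (intro convolution_dilation \<psi>m n) auto
      also have "\<dots> = kconv \<phi> (- (1 / real n)) \<psi> y" by (simp add: kconv_def add.commute)
      finally show "kconv \<psi> (-1) (dilation \<phi> n) (0 - y) = kconv \<phi> (- (1 / real n)) \<psi> y" .
    qed
    finally show ?thesis .
  qed
  have lim1: "(\<lambda>n. S (kconv \<phi> (- (1 / real n)) \<psi>)) \<longlonglongrightarrow> S \<psi>"
  proof -
    obtain b where b: "b \<ge> 0" "\<And>w x. length w \<le> Suc N \<Longrightarrow> norm (pderivs w \<psi> x) \<le> b"
      using bsmooth_bound_upto[OF \<psi>b] by blast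
    have le: "norm (S (kconv \<phi> (- (1 / real n)) \<psi>) - S \<psi>) \<le> C * (mconst * b) * (1 / real n)" for n
    proof -
      have "norm (S (rem (- (1 / real n)) \<psi>)) \<le> C * (mconst * \<bar>- (1 / real n)\<bar> * b)"
      proof (rule S_bound[OF rem_bsmooth[OF \<psi>b]])
        show "0 \<le> mconst * \<bar>- (1 / real n)\<bar> * b" using b mconst_ge(2) by simp
        fix w :: "'d list" and x assume w: "length w \<le> N"
        show "norm (pderivs w (rem (- (1 / real n)) \<psi>) x) \<le> mconst * \<bar>- (1 / real n)\<bar> * b"
          unfolding pderivs_rem[OF \<psi>b]
        proof (rule rem_bound_1[OF bsmooth_pderivs[OF \<psi>b]])
          show "norm (partial i (pderivs w \<psi>) y) \<le> b" for i y using b(2)[of "i # w" y] w by simp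
        qed
      qed
      moreover have "S (rem (- (1 / real n)) \<psi>) = S \<psi> - S (kconv \<phi> (- (1 / real n)) \<psi>)"
        unfolding rem_def by (rule S_diff[OF \<psi>b bsmooth_kconv[OF int\<phi> \<psi>b]])
      ultimately show ?thesis by (simp add: norm_minus_commute mult_ac)
    qed
    have "(\<lambda>n. C * (mconst * b) * (1 / real n)) \<longlonglongrightarrow> C * (mconst * b) * 0"
      by (intro tendsto_intros lim_1_over_n)
    then have "(\<lambda>n. S (kconv \<phi> (- (1 / real n)) \<psi>) - S \<psi>) \<longlonglongrightarrow> 0"
      using Lim_null_comparison[OF always_eventually, OF allI, OF le] by simp
    then show ?thesis by (simp add: LIM_zero_iff)
  qed
  have lim2: "(\<lambda>n. LINT x|lborel. kconv \<phi> (1 / real (Suc n)) f x * \<psi> x) \<longlonglongrightarrow> (LINT x|lborel. f x * \<psi> x)"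
  proof (rule integral_dominated_convergence[where w="\<lambda>x. (L1norm \<phi> * B) * norm (\<psi> x)"])
    show "(\<lambda>x. f x * \<psi> x) \<in> borel_measurable lborel"
      using borel_measurable_continuous_onI[OF f(1)] \<psi>i by simp
    show "(\<lambda>x. kconv \<phi> (1 / real (Suc n)) f x * \<psi> x) \<in> borel_measurable lborel" for n
    proof -
      have "kconv \<phi> (1 / real (Suc n)) f = ?F (Suc n)" using eq[of "Suc n"] by (simp add: fun_eq_iff)
      moreover have "?F (Suc n) \<in> borel_measurable borel"
        by (intro borel_measurable_continuous_onI bsmooth_continuous bsmooth_sconv dilation_bsmooth \<phi>)
      ultimately have "kconv \<phi> (1 / real (Suc n)) f \<in> borel_measurable lborel" by simp
      then show ?thesis using \<psi>i by (intro borel_measurable_times) auto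
    qed
    show "integrable lborel (\<lambda>x. (L1norm \<phi> * B) * norm (\<psi> x))" using \<psi>i by simp
    show "AE x in lborel. (\<lambda>n. kconv \<phi> (1 / real (Suc n)) f x * \<psi> x) \<longlonglongrightarrow> f x * \<psi> x"
      using LIMSEQ_Suc[OF kconv_tendsto[OF f]] by (intro AE_I2 tendsto_mult tendsto_const)
    show "AE x in lborel. norm (kconv \<phi> (1 / real (Suc n)) f x * \<psi> x) \<le> (L1norm \<phi> * B) * norm (\<psi> x)" for n
      by (intro AE_I2) (simp only: norm_mult, intro mult_right_mono kconv_bound int\<phi> f norm_ge_zero)
  qed
  have "(\<lambda>n. LINT x|lborel. kconv \<phi> (1 / real (Suc n)) f x * \<psi> x) = (\<lambda>n. S (kconv \<phi> (- (1 / real (Suc n))) \<psi>))"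
    using pair[of "Suc _"] eq[of "Suc _"] by (simp only: zero_less_Suc)
  with lim2 have "(\<lambda>n. S (kconv \<phi> (- (1 / real (Suc n))) \<psi>)) \<longlonglongrightarrow> (LINT x|lborel. f x * \<psi> x)"
    by simp
  from LIMSEQ_unique[OF LIMSEQ_Suc[OF lim1] this] show ?thesis .
qed

section \<open>From growth of the mollifications to Hoelder regularity\<close>

text \<open>The functions \<open>G j\<close> are the mollifications at scale \<open>2\<^sup>-\<^sup>j\<close>, corrected by the truncated
  Neumann series.\<close>

theorem hoelder_of_mollified_growth:
  assumes S: "finite_order S K N C" and \<phi>: "bsmooth \<phi>"
    and \<alpha>: "\<alpha> > 0" "\<alpha> \<notin> \<nat>" "real k > \<alpha>" and A: "A \<ge> 0"
    and growth: "\<And>n w x. n > 0 \<Longrightarrow> length w = k \<Longrightarrow>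
      norm (pderivs w (sconv S (dilation \<phi> n)) x) \<le> A * real n powr (real k - \<alpha>)"
  shows "\<exists>f\<in>hoelder \<alpha>. \<forall>\<psi>\<in>test_functions UNIV. S \<psi> = (LINT x|lborel. f x * \<psi> x)"
proof -
  interpret finite_order S K N C by (rule S)
  define F where "F n = sconv S (dilation \<phi> n)" for n
  have F: "bsmooth (F n)" for n unfolding F_def by (intro bsmooth_sconv dilation_bsmooth \<phi>)
  have swap: "kconv \<phi> (1 / real m) (F n) = kconv \<phi> (1 / real n) (F m)" if "n > 0" "m > 0" for n m
    unfolding F_def using kconv_sconv[OF int\<phi> dilation_bsmooth[OF \<phi>]] kconv_dilation_swap[of \<phi> n m] int\<phi> that
    by simp
  define e where "e j = 1 / real (2 ^ j)" for j :: nat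
  define G where "G j = neumann (e j) k (F (2 ^ j))" for j
  have G: "bsmooth (G j)" for j unfolding G_def by (intro neumann_bsmooth F)
  define p where "p = 2 powr (real k - \<alpha>)"
  have p0: "p > 0" by (simp add: p_def)
  obtain c where c: "c \<ge> 0" "\<And>e l B g. bsmooth g \<Longrightarrow> B \<ge> 0 \<Longrightarrow> deriv_bound l B g \<Longrightarrow> deriv_bound l (c * B) (neumann e k g)"
    using neumann_deriv_bound[of k] by blast
  have Gk: "deriv_bound k (c * (A * p ^ j)) (G j)" for j
    unfolding G_def
  proof (rule c(2)[OF F])
    show "0 \<le> A * p ^ j" using A p0 by simp
    have "real (2 ^ j) powr (real k - \<alpha>) = p ^ j"
      by (simp add: p_def powr_powr powr_power powr_realpow[symmetric] mult.commute)
    then show "deriv_bound k (A * p ^ j) (F (2 ^ j))"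
      using growth[of "2 ^ j"] by (simp add: deriv_bound_def F_def)
  qed
  define E where "E = mconst ^ k * c * A * (1 + p)"
  have E: "E \<ge> 0" unfolding E_def using A c p0 mconst_ge(2) by simp
  have diff: "norm (pderivs w (G j) x - pderivs w (G (Suc j)) x) \<le> E * (2 powr (real l - \<alpha>)) ^ j"
    if l: "l \<le> k" and w: "length w = l" for l w j x
  proof -
    \<comment> \<open>The \<open>r\<close> derivatives that are missing to the order \<open>k\<close> are traded for powers of the scale.\<close>
    define r where "r = k - l"
    have r: "r \<le> k" "l + r = k" using l by (auto simp: r_def)
    have "kconv \<phi> (e j) (F (2 ^ Suc j)) = kconv \<phi> (e (Suc j)) (F (2 ^ j))"
      unfolding e_def by (rule swap) auto
    then have "(\<lambda>x. G j x - G (Suc j) x) =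
       (\<lambda>x. (rem (e (Suc j)) ^^ k) (G j) x - (rem (e j) ^^ k) (G (Suc j)) x)"
      unfolding G_def using neumann_difference[OF F F] by blast
    moreover have "deriv_bound l (mconst ^ k * \<bar>e (Suc j)\<bar> ^ r * (c * (A * p ^ j)) + mconst ^ k * \<bar>e j\<bar> ^ r * (c * (A * p ^ Suc j)))
       (\<lambda>x. (rem (e (Suc j)) ^^ k) (G j) x - (rem (e j) ^^ k) (G (Suc j)) x)"
      by (intro deriv_bound_diff bsmooth_smooth rem_pow_bsmooth rem_pow_deriv_bound G)
         (use Gk[of j] Gk[of "Suc j"] r in auto)
    ultimately have "norm (pderivs w (\<lambda>x. G j x - G (Suc j) x) x) \<le>
       mconst ^ k * \<bar>e (Suc j)\<bar> ^ r * (c * (A * p ^ j)) + mconst ^ k * \<bar>e j\<bar> ^ r * (c * (A * p ^ Suc j))"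
      using w by (simp add: deriv_boundD)
    also have "\<dots> \<le> mconst ^ k * e j ^ r * (c * (A * p ^ j)) + mconst ^ k * e j ^ r * (c * (A * p ^ Suc j))"
    proof (rule add_mono)
      have "\<bar>e (Suc j)\<bar> ^ r \<le> e j ^ r" by (intro power_mono) (auto simp: e_def field_simps)
      then show "mconst ^ k * \<bar>e (Suc j)\<bar> ^ r * (c * (A * p ^ j)) \<le> mconst ^ k * e j ^ r * (c * (A * p ^ j))"
        using c A p0 mconst_ge(2) by (intro mult_right_mono mult_left_mono) auto
    qed (simp add: e_def)
    also have "\<dots> = E * (e j ^ r * p ^ j)" by (simp add: E_def algebra_simps)
    also have "e j ^ r * p ^ j = (2 powr (real l - \<alpha>)) ^ j"
    proof -
      have "e j ^ r * p ^ j = ((1/2) ^ r * p) ^ j"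
        by (simp add: e_def power_mult_distrib power_divide power_mult[symmetric] mult.commute)
      also have "(1/2) ^ r * p = 2 powr (- real r) * p"
        by (simp add: powr_minus powr_realpow inverse_eq_divide power_divide)
      also have "\<dots> = 2 powr (real l - \<alpha>)"
      proof -
        have "real k = real l + real r" using r(2) by simp
        then show ?thesis by (simp add: p_def powr_add[symmetric])
      qed
      finally show ?thesis .
    qed
    finally show ?thesis by (simp add: pderivs_diff bsmooth_smooth G)
  qed
  obtain f where f: "f \<in> hoelder \<alpha>" and lim: "uniform_limit UNIV G f sequentially"
    using hoelder_of_dyadic_differences[OF G \<alpha> E diff] by blast
  have fc: "continuous_on UNIV f" using f by (rule hoelder_continuous)
  obtain B where B: "\<And>x. norm (f x) \<le> B" using hoelder_bounded[OF f] by blast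
  \<comment> \<open>The average of \<open>G j\<close> at a fixed scale is \<open>F n\<close> up to \<open>k\<close> remainders at scale \<open>2\<^sup>-\<^sup>j\<close>.\<close>
  have "F n x = kconv \<phi> (1 / real n) f x" if n: "n > 0" for n x
  proof -
    have "kconv \<phi> (1 / real n) (G j) x = F n x - (rem (e j) ^^ k) (F n) x" for j
    proof -
      have "kconv \<phi> (1 / real n) (G j) = neumann (e j) k (kconv \<phi> (1 / real n) (F (2 ^ j)))"
        unfolding G_def by (simp add: neumann_kconv F)
      also have "\<dots> = neumann (e j) k (kconv \<phi> (e j) (F n))"
        using swap[of "2 ^ j" n] n by (simp add: e_def)
      also have "\<dots> = (\<lambda>x. F n x - (rem (e j) ^^ k) (F n) x)" by (rule neumann_inverts[OF F])
      finally show ?thesis by simp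
    qed
    moreover have "(\<lambda>j. (rem (e j) ^^ k) (F n) x) \<longlonglongrightarrow> 0"
    proof -
      obtain b where b: "b \<ge> 0" "deriv_bound 1 b (F n)" using bsmooth_deriv_bound[OF F] by blast
      have "k \<ge> 1" using \<alpha> by linarith
      then have "deriv_bound 0 (mconst ^ k * \<bar>e j\<bar> ^ 1 * b) ((rem (e j) ^^ k) (F n))" for j
        using b by (intro rem_pow_deriv_bound F) auto
      then have le: "norm ((rem (e j) ^^ k) (F n) x) \<le> mconst ^ k * b * (1 / 2) ^ j" for j
      proof -
        have "norm (pderivs [] ((rem (e j) ^^ k) (F n)) x) \<le> mconst ^ k * \<bar>e j\<bar> ^ 1 * b"
          using \<open>\<And>j. deriv_bound 0 (mconst ^ k * \<bar>e j\<bar> ^ 1 * b) ((rem (e j) ^^ k) (F n))\<close>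
          by (rule deriv_boundD) simp
        then show ?thesis by (simp add: e_def power_divide mult_ac)
      qed
      have "(\<lambda>j. mconst ^ k * b * (1 / 2) ^ j) \<longlonglongrightarrow> mconst ^ k * b * 0"
        by (intro tendsto_intros LIMSEQ_power_zero) simp
      then show ?thesis
        using Lim_null_comparison[OF always_eventually, OF allI, OF le] by simp
    qed
    ultimately have 1: "(\<lambda>j. kconv \<phi> (1 / real n) (G j) x) \<longlonglongrightarrow> F n x"
      using tendsto_diff[OF tendsto_const[of "F n x"], of "\<lambda>j. (rem (e j) ^^ k) (F n) x" 0 sequentially] by simp
    have "(\<lambda>j. kconv \<phi> (1 / real n) (G j) x) \<longlonglongrightarrow> kconv \<phi> (1 / real n) f x"
    proof (rule LIMSEQ_I)
      fix r :: real assume r: "r > 0"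
      define r' where "r' = r / (L1norm \<phi> + 1)"
      have L0: "L1norm \<phi> \<ge> 0" by simp
      have L: "L1norm \<phi> + 1 > 0" using L0 by (rule add_nonneg_pos) simp
      have r': "r' > 0" unfolding r'_def using r L by (rule divide_pos_pos)
      have "L1norm \<phi> * r' < (L1norm \<phi> + 1) * r'" using r' by (intro mult_strict_right_mono) auto
      also have "\<dots> = r" unfolding r'_def using less_imp_neq[OF L] by (intro nonzero_mult_div_cancel_left[THEN trans[OF times_divide_eq_right]]) simp
      finally have r'': "L1norm \<phi> * r' < r" .
      obtain J where J: "\<And>j x. j \<ge> J \<Longrightarrow> norm (G j x - f x) < r'"
        using uniform_limitD[OF lim r'] by (auto simp: eventually_sequentially dist_norm)
      show "\<exists>J. \<forall>j\<ge>J. norm (kconv \<phi> (1 / real n) (G j) x - kconv \<phi> (1 / real n) f x) < r"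
      proof (intro exI[of _ J] allI impI)
        fix j assume j: "j \<ge> J"
        obtain b where b: "\<And>x. norm (G j x) \<le> b" using bsmooth_bound[OF G] by blast
        have "kconv \<phi> (1 / real n) (G j) x - kconv \<phi> (1 / real n) f x = kconv \<phi> (1 / real n) (\<lambda>x. G j x - f x) x"
          unfolding kconv_def right_diff_distrib
          by (rule Bochner_Integration.integral_diff[symmetric];
              rule integrable_kconv[OF int\<phi>]) (use b B fc bsmooth_continuous[OF G] in auto)
        also have "norm \<dots> \<le> L1norm \<phi> * r'"
          by (rule kconv_bound[OF int\<phi>]) (use J[OF j] less_imp_le in blast)
        finally show "norm (kconv \<phi> (1 / real n) (G j) x - kconv \<phi> (1 / real n) f x) < r" using r'' by linarith
      qed
    qed
    with 1 show ?thesis using LIMSEQ_unique by blast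
  qed
  then have "S \<psi> = (LINT x|lborel. f x * \<psi> x)" if "\<psi> \<in> test_functions UNIV" for \<psi>
    using represented_of_mollified[OF S \<phi> fc B _ that] unfolding F_def by blast
  then show ?thesis using f by blast
qed

end

section \<open>Compactly supported distributions\<close>

text \<open>A pointwise form of the Leibniz rule.\<close>

lemma product_deriv_bound:
  fixes \<eta> :: "real^'d::finite \<Rightarrow> complex"
  assumes "bsmooth \<eta>"
  shows "\<exists>C\<ge>0. \<forall>f x B. smooth f \<longrightarrow> B \<ge> 0 \<longrightarrow> (\<forall>v. length v \<le> l \<longrightarrow> norm (pderivs v f x) \<le> B) \<longrightarrow>
    (\<forall>w. length w \<le> l \<longrightarrow> norm (pderivs w (\<lambda>x. \<eta> x * f x) x) \<le> C * B)"
  using assms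
proof (induction l arbitrary: \<eta>)
  case 0
  obtain b where b: "b \<ge> 0" "\<And>x. norm (\<eta> x) \<le> b" using bsmooth_bound[OF 0] by blast
  show ?case
  proof (intro exI[of _ b] conjI allI impI)
    fix f :: "real^'d \<Rightarrow> complex" and x B and w :: "'d list"
    assume B: "B \<ge> 0" "\<forall>v. length v \<le> 0 \<longrightarrow> norm (pderivs v f x) \<le> B" and w: "length w \<le> 0"
    have "norm (\<eta> x) * norm (f x) \<le> b * B"
      using b B(2)[rule_format, of "[]"] by (intro mult_mono) auto
    then show "norm (pderivs w (\<lambda>x. \<eta> x * f x) x) \<le> b * B" using w by (simp add: norm_mult)
  qed (use b in simp)
next
  case (Suc l)
  let ?P = "\<lambda>C \<eta>. C \<ge> 0 \<and> (\<forall>f x B. smooth f \<longrightarrow> B \<ge> 0 \<longrightarrow> (\<forall>v. length v \<le> l \<longrightarrow> norm (pderivs v f x) \<le> B) \<longrightarrow>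
    (\<forall>w. length w \<le> l \<longrightarrow> norm (pderivs w (\<lambda>x. \<eta> x * f x) x) \<le> C * B))"
  obtain C where C: "?P C \<eta>" using Suc.IH[OF Suc.prems] by blast
  have "\<exists>c. ?P c (partial i \<eta>)" for i
    using Suc.IH[OF bsmooth_partial[OF Suc.prems]] by blast
  then obtain c where c: "\<And>i. ?P (c i) (partial i \<eta>)" by metis
  define D where "D = C + (\<Sum>i\<in>UNIV. c i)"
  have D: "C \<ge> 0" "c i \<le> (\<Sum>i\<in>UNIV. c i)" "(\<Sum>i\<in>UNIV. c i) \<ge> 0" for i
    using C c by (auto intro: member_le_sum sum_nonneg)
  show ?case
  proof (intro exI[of _ D] conjI allI impI)
    show "D \<ge> 0" using D by (simp add: D_def)
    fix f :: "real^'d \<Rightarrow> complex" and x B and w :: "'d list"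
    assume f: "smooth f" and B: "B \<ge> 0" "\<forall>v. length v \<le> Suc l \<longrightarrow> norm (pderivs v f x) \<le> B" and w: "length w \<le> Suc l"
    show "norm (pderivs w (\<lambda>x. \<eta> x * f x) x) \<le> D * B"
    proof (cases w rule: rev_cases)
      case Nil
      then have "norm (pderivs w (\<lambda>x. \<eta> x * f x) x) \<le> C * B"
        using conjunct2[OF C, rule_format, OF f B(1), of x w] B(2) by simp
      also have "\<dots> \<le> D * B" using D B by (intro mult_right_mono) (auto simp: D_def)
      finally show ?thesis .
    next
      case (snoc v i)
      have sm: "smooth \<eta>" using Suc.prems by (rule bsmooth_smooth)
      have v: "length v \<le> l" using snoc w by simp
      have "pderivs w (\<lambda>x. \<eta> x * f x) x = pderivs v (\<lambda>x. \<eta> x * partial i f x + partial i \<eta> x * f x) x"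
        using snoc sm f by (simp add: partial_mult smooth_differentiable)
      also have "\<dots> = pderivs v (\<lambda>x. \<eta> x * partial i f x) x + pderivs v (\<lambda>x. partial i \<eta> x * f x) x"
        using sm f by (subst pderivs_add) (auto intro!: smooth_mult smooth_partial)
      also have "norm \<dots> \<le> C * B + c i * B"
      proof (rule norm_triangle_mono)
        have "norm (pderivs u (partial i f) x) \<le> B" if "length u \<le> l" for u
          using B(2)[rule_format, of "u @ [i]"] that by simp
        then show "norm (pderivs v (\<lambda>x. \<eta> x * partial i f x) x) \<le> C * B"
          using C v B(1) smooth_partial[OF f] by blast
        have "norm (pderivs u f x) \<le> B" if "length u \<le> l" for u
          using B(2) that by simp
        then show "norm (pderivs v (\<lambda>x. partial i \<eta> x * f x) x) \<le> c i * B"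
          using c[of i] v B(1) f by blast
      qed
      also have "\<dots> \<le> D * B"
        using mult_right_mono[OF D(2)[of i] B(1)] by (simp add: D_def distrib_right)
      finally show ?thesis .
    qed
  qed
qed

text \<open>The set \<open>K\<close> is the support of the cutoff, which may be larger than the support of \<open>T\<close>.\<close>

lemma dist_ext_finite_order:
  fixes \<Omega> :: "(real^'d::finite) set"
  assumes "open \<Omega>" "T \<in> compact_distributions \<Omega>"
  obtains \<eta> N C where "\<eta> \<in> test_functions \<Omega>" "\<And>f. dist_ext \<Omega> T f = T (\<lambda>x. \<eta> x * f x)"
    "finite_order (dist_ext \<Omega> T) (fun_support \<eta>) N C"
proof -
  have T: "T \<in> distributions \<Omega>" "compact (dist_support \<Omega> T)"
    using assms(2) by (auto simp: compact_distributions_def)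
  have "dist_support \<Omega> T \<subseteq> \<Omega>" by (auto simp: dist_support_def)
  then have ex: "\<exists>\<eta>. \<eta> \<in> cutoffs \<Omega> (dist_support \<Omega> T)"
    using cutoff_exists assms(1) T(2) by blast
  define \<eta> where "\<eta> = (SOME \<eta>. \<eta> \<in> cutoffs \<Omega> (dist_support \<Omega> T))"
  have "\<eta> \<in> cutoffs \<Omega> (dist_support \<Omega> T)" unfolding \<eta>_def using ex by (rule someI_ex)
  then have \<eta>: "\<eta> \<in> test_functions \<Omega>" by (simp add: cutoffs_def)
  have ext: "dist_ext \<Omega> T f = T (\<lambda>x. \<eta> x * f x)" for f by (simp add: dist_ext_def \<eta>_def)
  define K where "K = fun_support \<eta>"
  have K: "compact K" "K \<subseteq> \<Omega>" "closed K"
    using test_functionsD[OF \<eta>] by (auto simp: K_def compact_imp_closed)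
  have \<eta>b: "bsmooth \<eta>" using \<eta> by (rule test_functions_bsmooth)
  have tK: "(\<lambda>x. \<eta> x * f x) \<in> test_functions K" if "smooth f" for f
  proof (rule test_functionsI[OF smooth_mult[OF bsmooth_smooth[OF \<eta>b] that] K(1) order_refl])
    show "\<eta> x * f x = 0" if "x \<notin> K" for x using that by (simp add: K_def fun_support_zero)
  qed
  then have t\<Omega>: "(\<lambda>x. \<eta> x * f x) \<in> test_functions \<Omega>" if "smooth f" for f
    using that K(2) unfolding test_functions_def by blast
  obtain C N where CN: "\<And>f. f \<in> test_functions K \<Longrightarrow>
      norm (T f) \<le> C * (\<Sum>m | mi_order m \<le> N. SUP x. norm (mpartial m f x))"
  proof -
    have "\<forall>K. compact K \<and> K \<subseteq> \<Omega> \<longrightarrow> (\<exists>C N. \<forall>f\<in>test_functions K.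
      norm (T f) \<le> C * (\<Sum>m | mi_order m \<le> N. SUP x. norm (mpartial m f x)))"
      using T(1) by (simp add: distributions_def)
    from this[rule_format, OF conjI[OF K(1,2)]] that show ?thesis by blast
  qed
  have T_add: "T (\<lambda>x. f x + g x) = T f + T g" if "f \<in> test_functions \<Omega>" "g \<in> test_functions \<Omega>" for f g
    using T(1) that by (simp add: distributions_def)
  have T_cmult: "T (\<lambda>x. c * f x) = c * T f" if "f \<in> test_functions \<Omega>" for c f
    using T(1) that by (simp add: distributions_def)
  obtain D where D: "D \<ge> 0" "\<And>f x B w. smooth f \<Longrightarrow> B \<ge> 0 \<Longrightarrow> (\<And>v. length v \<le> N \<Longrightarrow> norm (pderivs v f x) \<le> B) \<Longrightarrow>
    length w \<le> N \<Longrightarrow> norm (pderivs w (\<lambda>x. \<eta> x * f x) x) \<le> D * B"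
    using product_deriv_bound[OF \<eta>b, of N] by blast
  define M where "M = real (card {m :: 'd \<Rightarrow> nat. mi_order m \<le> N})"
  have "finite_order (dist_ext \<Omega> T) K N (\<bar>C\<bar> * (M * D))"
  proof
    show "0 \<le> \<bar>C\<bar> * (M * D)" using D by (simp add: M_def)
    show "dist_ext \<Omega> T (\<lambda>x. f x + g x) = dist_ext \<Omega> T f + dist_ext \<Omega> T g" if "bsmooth f" "bsmooth g" for f g
      unfolding ext distrib_left
      by (rule T_add[OF t\<Omega>[OF bsmooth_smooth[OF that(1)]] t\<Omega>[OF bsmooth_smooth[OF that(2)]]])
    show "dist_ext \<Omega> T (\<lambda>x. c * f x) = c * dist_ext \<Omega> T f" if "bsmooth f" for c f
    proof -
      have "(\<lambda>x. \<eta> x * (c * f x)) = (\<lambda>x. c * (\<eta> x * f x))" by (simp add: mult.left_commute)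
      then show ?thesis
        using T_cmult[OF t\<Omega>[OF bsmooth_smooth[OF that]]] by (simp add: ext)
    qed
    fix f :: "real^'d \<Rightarrow> complex" and B
    assume f: "bsmooth f" and B: "B \<ge> 0" "\<And>w x. length w \<le> N \<Longrightarrow> x \<in> K \<Longrightarrow> norm (pderivs w f x) \<le> B"
    let ?g = "\<lambda>x. \<eta> x * f x"
    have g: "?g \<in> test_functions K" using f by (intro tK bsmooth_smooth)
    have "(SUP x. norm (mpartial m ?g x)) \<le> D * B" if m: "mi_order m \<le> N" for m
    proof (rule cSUP_least)
      fix x
      show "norm (mpartial m ?g x) \<le> D * B"
      proof (cases "x \<in> K")
        case True
        then show ?thesis
          using f B m by (auto simp: mpartial_word length_mi_word bsmooth_smooth intro!: D(2))
      next
        case False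
        have "?g y = 0" if "y \<notin> K" for y using that by (simp add: K_def fun_support_zero)
        then have "mpartial m ?g x = 0"
          unfolding mpartial_word using False by (rule pderivs_zero_off_closed[OF K(3)])
        then show ?thesis using D(1) B(1) by simp
      qed
    qed simp
    then have "(\<Sum>m | mi_order m \<le> N. SUP x. norm (mpartial m ?g x)) \<le> M * (D * B)"
      unfolding M_def by (intro sum_bounded_above) simp
    moreover have "0 \<le> (\<Sum>m | mi_order m \<le> N. SUP x. norm (mpartial m ?g x))"
    proof (intro sum_nonneg)
      fix m
      have "bsmooth ?g" using g by (rule test_functions_bsmooth)
      then obtain b where "\<And>x. norm (mpartial m ?g x) \<le> b"
        unfolding mpartial_word bsmooth_def by blast
      then have "norm (mpartial m ?g 0) \<le> (SUP x. norm (mpartial m ?g x))"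
        by (intro cSUP_upper) (auto intro!: bdd_aboveI)
      then show "0 \<le> (SUP x. norm (mpartial m ?g x))" using norm_ge_zero order_trans by blast
    qed
    ultimately have "C * (\<Sum>m | mi_order m \<le> N. SUP x. norm (mpartial m ?g x)) \<le> \<bar>C\<bar> * (M * (D * B))"
      by (intro mult_mono) auto
    then show "norm (dist_ext \<Omega> T f) \<le> \<bar>C\<bar> * (M * D) * B"
      using CN[OF g] by (simp add: ext mult.assoc)
  qed
  then show ?thesis using that \<eta> ext unfolding K_def by blast
qed

lemma schwartz_decay_upto:
  fixes \<phi> :: "real^'d::finite \<Rightarrow> complex"
  assumes "\<phi> \<in> schwartz"
  obtains C where "C \<ge> 0" "\<And>w x. length w \<le> l \<Longrightarrow> (1 + norm x) ^ M * norm (pderivs w \<phi> x) \<le> C"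
proof (rule bound_over_words[of "\<lambda>w x. (1 + norm x) ^ M * norm (pderivs w \<phi> x)" l])
  show "\<exists>B. \<forall>x. (1 + norm x) ^ M * norm (pderivs w \<phi> x) \<le> B" for w
    using schwartz_decay[OF assms] by metis
qed (use that in blast)

text \<open>At positive distance from \<open>K\<close> the derivatives of the mollifications stay bounded, by the rapid
  decay of \<open>\<phi>\<close>. This is why suprema over \<open>\<Omega>\<close> suffice.\<close>

lemma (in finite_order) mollification_bounded_outside:
  assumes \<phi>: "\<phi> \<in> schwartz" and \<Omega>: "open \<Omega>" "compact K" "K \<subseteq> \<Omega>"
  obtains A where "A \<ge> 0" "\<And>n x w. n > 0 \<Longrightarrow> x \<notin> \<Omega> \<Longrightarrow> length w = k \<Longrightarrow>
    norm (pderivs w (sconv S (dilation \<phi> n)) x) \<le> A"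
proof -
  have "\<exists>\<delta>>0. \<forall>x\<in>K. \<forall>y\<in>- \<Omega>. \<delta> \<le> dist x y"
    using \<Omega> by (intro separate_compact_closed) auto
  then obtain \<delta> where \<delta>: "\<delta> > 0" "\<And>x y. x \<in> K \<Longrightarrow> y \<notin> \<Omega> \<Longrightarrow> \<delta> \<le> dist x y" by auto
  define M where "M = CARD('d) + N + k"
  obtain C' where C': "C' \<ge> 0" "\<And>w x. length w \<le> N + k \<Longrightarrow> (1 + norm x) ^ M * norm (pderivs w \<phi> x) \<le> C'"
    using schwartz_decay_upto[OF \<phi>] by blast
  have \<phi>b: "bsmooth \<phi>" using \<phi> by (rule schwartz_bsmooth)
  show ?thesis
  proof (rule that[of "C * (C' / \<delta> ^ M)"])
    show "0 \<le> C * (C' / \<delta> ^ M)" using C_nonneg C' \<delta> by simp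
    fix n :: nat and x and w :: "'d list" assume n: "n > 0" and x: "x \<notin> \<Omega>" and w: "length w = k"
    have "norm (sconv S (pderivs w (dilation \<phi> n)) x) \<le> C * (C' / \<delta> ^ M)"
    proof (rule sconv_bound)
      show "bsmooth (pderivs w (dilation \<phi> n))" by (intro bsmooth_pderivs dilation_bsmooth \<phi>b)
      show "0 \<le> C' / \<delta> ^ M" using C' \<delta> by simp
      fix v :: "'d list" and y assume v: "length v \<le> N" and y: "y \<in> K"
      let ?D = "norm (pderivs (v @ w) \<phi> (real n *\<^sub>R (x - y)))"
      have n1: "real n \<ge> 1" using n by simp
      have le: "real n * \<delta> \<le> 1 + norm (real n *\<^sub>R (x - y))"
        using \<delta>(2)[OF y x] by (simp add: dist_norm norm_minus_commute mult_left_mono add_increasing)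
      have "pderivs v (pderivs w (dilation \<phi> n)) = (\<lambda>x. of_nat n ^ length (v @ w) * dilation (pderivs (v @ w) \<phi>) n x)"
        unfolding pderivs_pderivs by (rule pderivs_dilation[OF bsmooth_smooth[OF \<phi>b]])
      then have "norm (pderivs v (pderivs w (dilation \<phi> n)) (x - y)) = real n ^ (length (v @ w) + CARD('d)) * ?D"
        by (simp only: dilation_def norm_mult norm_power norm_of_nat power_add mult.assoc)
      also have "\<dots> \<le> real n ^ M * ?D"
        using n1 v w by (intro mult_right_mono power_increasing) (auto simp: M_def)
      also have "\<dots> = ((real n * \<delta>) ^ M * ?D) / \<delta> ^ M" using \<delta>(1) by (simp add: power_mult_distrib)
      also have "\<dots> \<le> C' / \<delta> ^ M"
      proof (rule divide_right_mono)
        have "(real n * \<delta>) ^ M * ?D \<le> (1 + norm (real n *\<^sub>R (x - y))) ^ M * ?D"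
          using le \<delta>(1) by (intro mult_right_mono power_mono) auto
        also have "\<dots> \<le> C'" using v w by (intro C'(2)) simp
        finally show "(real n * \<delta>) ^ M * ?D \<le> C'" .
      qed (use \<delta>(1) in simp)
      finally show "norm (pderivs v (pderivs w (dilation \<phi> n)) (x - y)) \<le> C' / \<delta> ^ M" .
    qed
    then show "norm (pderivs w (sconv S (dilation \<phi> n)) x) \<le> C * (C' / \<delta> ^ M)"
      using pderivs_sconv[OF dilation_bsmooth[OF \<phi>b]] by simp
  qed
qed

section \<open>From Hoelder regularity to growth of the mollifications\<close>

lemma difference_quotient_tendsto:
  fixes f :: "real^'d::finite \<Rightarrow> complex"
  assumes "f differentiable_on UNIV"
  shows "(\<lambda>n. real (Suc n) *\<^sub>R (f (x + (1 / real (Suc n)) *\<^sub>R evec i) - f x)) \<longlonglongrightarrow> partial i f x"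
proof -
  have "((\<lambda>s. f (x + s *\<^sub>R evec i)) has_vector_derivative partial i f (x + 0 *\<^sub>R evec i)) (at 0)"
    by (rule partial_vector_derivative[OF assms])
  then have "((\<lambda>s. norm (f (x + s *\<^sub>R evec i) - f x - s *\<^sub>R partial i f x) / norm s) \<longlongrightarrow> 0) (at 0)"
    unfolding has_vector_derivative_def has_derivative_iff_norm by simp
  then have "((\<lambda>s. norm ((f (x + s *\<^sub>R evec i) - f x) /\<^sub>R s - partial i f x)) \<longlongrightarrow> 0) (at 0)"
  proof (rule Lim_transform_eventually)
    have "norm (f (x + s *\<^sub>R evec i) - f x - s *\<^sub>R partial i f x) / norm s =
      norm ((f (x + s *\<^sub>R evec i) - f x) /\<^sub>R s - partial i f x)" if "s \<noteq> 0" for s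
    proof -
      have "(f (x + s *\<^sub>R evec i) - f x) /\<^sub>R s - partial i f x = (f (x + s *\<^sub>R evec i) - f x - s *\<^sub>R partial i f x) /\<^sub>R s"
        using that by (simp add: scaleR_diff_right)
      then show ?thesis by (simp only: norm_scaleR) (simp add: divide_inverse mult.commute)
    qed
    then show "\<forall>\<^sub>F s in at 0. norm (f (x + s *\<^sub>R evec i) - f x - s *\<^sub>R partial i f x) / norm s =
      norm ((f (x + s *\<^sub>R evec i) - f x) /\<^sub>R s - partial i f x)"
      by (auto simp: eventually_at intro!: exI[of _ 1])
  qed
  then have "((\<lambda>s. (f (x + s *\<^sub>R evec i) - f x) /\<^sub>R s) \<longlongrightarrow> partial i f x) (at 0)"
    by (simp add: LIM_zero_iff tendsto_norm_zero_iff)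
  then have "((\<lambda>n. (f (x + (1 / real (Suc n)) *\<^sub>R evec i) - f x) /\<^sub>R (1 / real (Suc n))) \<longlonglongrightarrow> partial i f x)"
    unfolding tendsto_at_iff_sequentially comp_def
    using LIMSEQ_Suc[OF lim_1_over_n] by (elim allE[of _ "\<lambda>n. 1 / real (Suc n)"]) auto
  then show ?thesis by simp
qed

lemma difference_quotient_bound:
  fixes f :: "real^'d::finite \<Rightarrow> complex"
  assumes "f differentiable_on UNIV"
    and "\<And>s. 0 \<le> s \<Longrightarrow> s \<le> 1 \<Longrightarrow> norm (partial i f (x + s *\<^sub>R evec i)) \<le> B"
  shows "norm (real (Suc n) *\<^sub>R (f (x + (1 / real (Suc n)) *\<^sub>R evec i) - f x)) \<le> B"
proof -
  have "norm (f (x + (1 / real (Suc n)) *\<^sub>R evec i) - f (x + 0 *\<^sub>R evec i)) \<le> B * (1 / real (Suc n))"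
  proof (rule mean_value_bound[where g'="\<lambda>s. partial i f (x + s *\<^sub>R evec i)"])
    fix s :: real assume s: "0 \<le> s" "s \<le> 1 / real (Suc n)"
    have "1 / real (Suc n) \<le> 1" by simp
    then have "s \<le> 1" using s by linarith
    then show "norm (partial i f (x + s *\<^sub>R evec i)) \<le> B" using assms(2) s by blast
    show "((\<lambda>s. f (x + s *\<^sub>R evec i)) has_vector_derivative partial i f (x + s *\<^sub>R evec i)) (at s)"
      by (rule partial_vector_derivative[OF assms(1)])
  qed simp
  then have "real (Suc n) * norm (f (x + (1 / real (Suc n)) *\<^sub>R evec i) - f x) \<le> real (Suc n) * (B * (1 / real (Suc n)))"
    by (intro mult_left_mono) auto
  then show ?thesis by (simp del: of_nat_Suc)
qed

lemma schwartz_partial_integral_zero: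
  fixes \<psi> :: "real^'d::finite \<Rightarrow> complex"
  assumes "\<psi> \<in> schwartz"
  shows "(LINT x|lborel. partial i \<psi> x) = 0"
proof -
  let ?M = "CARD('d) + 2"
  let ?q = "\<lambda>n x. real (Suc n) *\<^sub>R (\<psi> (x + (1 / real (Suc n)) *\<^sub>R evec i) - \<psi> x)"
  have diff: "\<psi> differentiable_on UNIV" using assms by (intro smooth_differentiable schwartz_smooth)
  have \<psi>i: "integrable lborel \<psi>" using assms by (rule schwartz_integrable)
  have \<psi>m: "\<psi> \<in> borel_measurable borel" using assms by (rule schwartz_measurable)
  obtain C where C: "C \<ge> 0" "\<And>x. (1 + norm x) ^ ?M * norm (pderivs [i] \<psi> x) \<le> C"
    using schwartz_decay[OF assms, of ?M "[i]"] by metis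
  have pos: "(1 + norm x) ^ ?M > 0" for x :: "real^'d"
    by (intro zero_less_power add_pos_nonneg) auto
  have b: "norm (partial i \<psi> (x + s *\<^sub>R evec i)) \<le> 2 ^ ?M * C * (1 / (1 + norm x) ^ ?M)"
    if s: "0 \<le> s" "s \<le> 1" for x s
  proof -
    have *: "norm x \<le> norm (x + s *\<^sub>R evec i) + norm (s *\<^sub>R (evec i :: real^'d))"
      using norm_triangle_ineq4[of "x + s *\<^sub>R evec i" "s *\<^sub>R evec i"] by simp
    have "1 + norm x \<le> 2 * (1 + norm (x + s *\<^sub>R evec i))"
    proof -
      have "norm (s *\<^sub>R (evec i :: real^'d)) \<le> 1" using s by simp
      moreover have "0 \<le> norm (x + s *\<^sub>R evec i)" by (rule norm_ge_zero)
      moreover have "1 + a \<le> 2 * (1 + N)" if "a \<le> N + c" "c \<le> 1" "0 \<le> N" for a N c :: real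
        using that by simp
      ultimately show ?thesis using * by blast
    qed
    then have "(1 + norm x) ^ ?M \<le> (2 * (1 + norm (x + s *\<^sub>R evec i))) ^ ?M"
      by (intro power_mono) auto
    then have "(1 + norm x) ^ ?M * norm (partial i \<psi> (x + s *\<^sub>R evec i))
      \<le> 2 ^ ?M * ((1 + norm (x + s *\<^sub>R evec i)) ^ ?M * norm (partial i \<psi> (x + s *\<^sub>R evec i)))"
      unfolding power_mult_distrib mult.assoc[symmetric] by (intro mult_right_mono) auto
    also have "\<dots> \<le> 2 ^ ?M * C" using C(2)[of "x + s *\<^sub>R evec i"] by (intro mult_left_mono) auto
    finally show ?thesis using pos[of x] by (simp only: times_divide_eq_right mult_1_right pos_le_divide_eq mult.commute)
  qed
  have "(\<lambda>n. LINT x|lborel. ?q n x) \<longlonglongrightarrow> (LINT x|lborel. partial i \<psi> x)"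
  proof (rule integral_dominated_convergence[where w="\<lambda>x. 2 ^ ?M * C * (1 / (1 + norm x) ^ ?M)"])
    show "partial i \<psi> \<in> borel_measurable lborel"
      using schwartz_measurable[OF schwartz_pderivs[OF assms, of "[i]"]] by simp
    show "?q n \<in> borel_measurable lborel" for n using \<psi>m by simp
    show "integrable lborel (\<lambda>x::real^'d. 2 ^ ?M * C * (1 / (1 + norm x) ^ ?M))"
      using integrable_weight by (rule integrable_mult_right)
    show "AE x in lborel. (\<lambda>n. ?q n x) \<longlonglongrightarrow> partial i \<psi> x"
      using difference_quotient_tendsto[OF diff] by simp
    show "AE x in lborel. norm (?q n x) \<le> 2 ^ ?M * C * (1 / (1 + norm x) ^ ?M)" for n
      using difference_quotient_bound[OF diff b] by (intro AE_I2) blast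
  qed
  moreover have "(LINT x|lborel. ?q n x) = 0" for n
  proof -
    let ?t = "(1 / real (Suc n)) *\<^sub>R (evec i :: real^'d)"
    have "integrable (distr lborel borel ((+) ?t)) \<psi>" using \<psi>i by (simp only: lborel_distr_plus)
    then have "integrable lborel (\<lambda>x. \<psi> (?t + x))" using \<psi>m by (subst (asm) integrable_distr_eq) auto
    then have "integrable lborel (\<lambda>x. \<psi> (?t + 1 *\<^sub>R x))" by simp
    moreover have "(LINT x|lborel. \<psi> (?t + 1 *\<^sub>R x)) = (LINT x|lborel. \<psi> x)"
      using lborel_integral_affine[OF \<psi>m, of 1 ?t] by simp
    ultimately show ?thesis using \<psi>i by (simp add: add.commute del: of_nat_Suc)
  qed
  ultimately have "(\<lambda>n. 0) \<longlonglongrightarrow> (LINT x|lborel. partial i \<psi> x)" by simp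
  then show ?thesis by (simp add: LIMSEQ_const_iff)
qed

text \<open>Differentiation under the integral sign in one direction, for \<open>g\<close> of finite regularity. That
  the convolution is differentiable is assumed, as \<^const>\<open>partial\<close> refers to the Frechet derivative.\<close>

lemma partial_kconv:
  fixes g w :: "real^'d::finite \<Rightarrow> complex"
  assumes w: "integrable lborel w" and g: "g differentiable_on UNIV" "\<And>x. norm (g x) \<le> b"
    and pg: "continuous_on UNIV (partial i g)" "\<And>x. norm (partial i g x) \<le> B"
    and k: "kconv w e g differentiable_on UNIV"
  shows "partial i (kconv w e g) = kconv w e (partial i g)"
proof
  fix x
  let ?q = "\<lambda>n f x. real (Suc n) *\<^sub>R (f (x + (1 / real (Suc n)) *\<^sub>R evec i) - f x)"
  have gc: "continuous_on UNIV g" using g(1) by (rule differentiable_imp_continuous_on)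
  have i: "integrable lborel (\<lambda>z. w z * g (y - e *\<^sub>R z))" for y by (rule integrable_kconv[OF w gc g(2)])
  have q: "?q n (kconv w e g) x = (LINT z|lborel. w z * ?q n g (x - e *\<^sub>R z))" for n
  proof -
    let ?y = "x + (1 / real (Suc n)) *\<^sub>R evec i"
    have "?q n (kconv w e g) x = real (Suc n) *\<^sub>R ((LINT z|lborel. w z * g (?y - e *\<^sub>R z)) - (LINT z|lborel. w z * g (x - e *\<^sub>R z)))"
      by (simp only: kconv_def)
    also have "\<dots> = (LINT z|lborel. real (Suc n) *\<^sub>R (w z * g (?y - e *\<^sub>R z) - w z * g (x - e *\<^sub>R z)))"
      by (simp only: Bochner_Integration.integral_diff[OF i i] integral_scaleR_right)
    also have "(\<lambda>z. real (Suc n) *\<^sub>R (w z * g (?y - e *\<^sub>R z) - w z * g (x - e *\<^sub>R z))) = (\<lambda>z. w z * ?q n g (x - e *\<^sub>R z))"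
      by (rule ext) (simp add: right_diff_distrib[symmetric] add_diff_eq diff_add_eq del: of_nat_Suc)
    finally show ?thesis .
  qed
  have "(\<lambda>n. LINT z|lborel. w z * ?q n g (x - e *\<^sub>R z)) \<longlonglongrightarrow> (LINT z|lborel. w z * partial i g (x - e *\<^sub>R z))"
  proof (rule integral_dominated_convergence[where w="\<lambda>z. norm (w z) * B"])
    show "(\<lambda>z. w z * partial i g (x - e *\<^sub>R z)) \<in> borel_measurable lborel"
      by (rule borel_measurable_integrable[OF integrable_kconv[OF w pg]])
    have "g \<in> borel_measurable borel" by (rule borel_measurable_continuous_onI[OF gc])
    then show "(\<lambda>z. w z * ?q n g (x - e *\<^sub>R z)) \<in> borel_measurable lborel" for n
      using borel_measurable_integrable[OF w] by simp
    show "integrable lborel (\<lambda>z. norm (w z) * B)" using w by simp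
    show "AE z in lborel. (\<lambda>n. w z * ?q n g (x - e *\<^sub>R z)) \<longlonglongrightarrow> w z * partial i g (x - e *\<^sub>R z)"
      by (intro AE_I2 tendsto_mult[OF tendsto_const] difference_quotient_tendsto g)
    show "AE z in lborel. norm (w z * ?q n g (x - e *\<^sub>R z)) \<le> norm (w z) * B" for n
      unfolding norm_mult by (intro AE_I2 mult_left_mono difference_quotient_bound g pg norm_ge_zero)
  qed
  then have "(\<lambda>n. ?q n (kconv w e g) x) \<longlonglongrightarrow> kconv w e (partial i g) x"
    unfolding q by (simp only: kconv_def)
  with difference_quotient_tendsto[OF k, of x i]
  show "partial i (kconv w e g) x = kconv w e (partial i g) x" by (rule LIMSEQ_unique)
qed

lemma pderivs_kconv_compact_support:
  fixes f w :: "real^'d::finite \<Rightarrow> complex"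
  assumes w: "integrable lborel w" and f: "Ck a f" "compact K" "\<And>x. x \<notin> K \<Longrightarrow> f x = 0"
    and sm: "smooth (kconv w e f)"
  shows "length s \<le> a \<Longrightarrow> pderivs s (kconv w e f) = kconv w e (pderivs s f)"
proof (induction s)
  case (Cons i s)
  have Ck: "Ck (a - length u) (pderivs u f)" if "length u \<le> a" for u
    using f(1) that by (intro Ck_pderivs) simp
  have z: "pderivs u f x = 0" if "x \<notin> K" for u x
    by (rule pderivs_zero_off_closed[OF compact_imp_closed[OF f(2)] f(3) that])
  have s: "length s < a" using Cons.prems by simp
  have "Ck (Suc (a - Suc (length s))) (pderivs s f)"
    using Ck[of s] s by (simp only: Suc_diff_Suc less_imp_le_nat)
  then have d: "pderivs s f differentiable_on UNIV" by simp
  have pc: "continuous_on UNIV (partial i (pderivs s f))"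
    using Ck_continuous[OF Ck[of "i # s"]] Cons.prems by simp
  obtain b where b: "\<And>x. norm (pderivs s f x) \<le> b"
    using bounded_of_compact_support[OF differentiable_imp_continuous_on[OF d] f(2) z] by blast
  obtain B where B: "\<And>x. norm (partial i (pderivs s f) x) \<le> B"
  proof -
    have "partial i (pderivs s f) x = 0" if "x \<notin> K" for x using z[OF that, of "i # s"] by simp
    then show ?thesis using bounded_of_compact_support[OF pc f(2)] that by blast
  qed
  have IH: "pderivs s (kconv w e f) = kconv w e (pderivs s f)" using Cons by simp
  have "kconv w e (pderivs s f) differentiable_on UNIV"
    using smooth_differentiable[OF smooth_pderivs[OF sm, of s]] IH by simp
  from partial_kconv[OF w d b pc B this] show ?case using IH by simp
qed simp

lemma plateau_integral_pos:
  assumes "r > 0"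
  shows "(LINT x|lborel. plateau a r x) > 0" "integrable lborel (plateau a r)"
proof -
  have "integrable lborel (\<lambda>x. of_real (plateau a r x) :: complex)"
    using test_functions_integrable[OF plateau_test[OF assms, of a UNIV]] by simp
  then show i: "integrable lborel (plateau a r)" using integrable_Re[of lborel "\<lambda>x. of_real (plateau a r x)"] by simp
  have "0 < measure lborel (cball a r)" using assms by (simp add: content_cball)
  also have "\<dots> = (LINT x|lborel. indicator (cball a r) x)" by simp
  also have "\<dots> \<le> (LINT x|lborel. plateau a r x)"
  proof (rule integral_mono'[OF i])
    show "indicator (cball a r) x \<le> plateau a r x" for x
      using plateau_eq_1[OF assms, of x a] plateau_nonneg[of a r x]
      by (auto simp: indicator_def dist_norm norm_minus_commute)
  qed (rule plateau_nonneg)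
  finally show "(LINT x|lborel. plateau a r x) > 0" .
qed

text \<open>The fundamental lemma of the calculus of variations, for continuous functions.\<close>

lemma zero_off_closed_of_test_functions:
  fixes f :: "real^'d::finite \<Rightarrow> complex"
  assumes f: "continuous_on UNIV f" "\<And>x. norm (f x) \<le> B" and K: "closed K"
    and zero: "\<And>\<psi>. \<psi> \<in> test_functions (- K) \<Longrightarrow> (LINT x|lborel. f x * \<psi> x) = 0"
    and x: "x \<notin> K"
  shows "f x = 0"
proof (rule ccontr)
  assume nz: "f x \<noteq> 0"
  define \<epsilon> where "\<epsilon> = norm (f x) / 2"
  have \<epsilon>: "\<epsilon> > 0" using nz by (simp add: \<epsilon>_def)
  have "isCont f x" using f(1) by (simp add: continuous_on_eq_continuous_at)
  then obtain d where d: "d > 0" "\<And>y. dist y x < d \<Longrightarrow> dist (f y) (f x) < \<epsilon>"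
    using \<epsilon> unfolding continuous_at_eps_delta by blast
  obtain d' where d': "d' > 0" "cball x d' \<subseteq> - K"
    using open_contains_cball_eq[of "- K"] K x by (auto simp: closed_def)
  define r where "r = min d d' / 3"
  have r: "r > 0" "2 * r < d" "2 * r \<le> d'" using d d' by (auto simp: r_def)
  let ?b = "plateau x r"
  have b: "(\<lambda>y. of_real (?b y)) \<in> test_functions (- K)"
  proof (rule plateau_test[OF r(1)])
    have "cball x (2 * r) \<subseteq> cball x d'" using r(3) by (simp add: subset_cball)
    then show "cball x (2 * r) \<subseteq> - K" using d'(2) by simp
  qed
  have bi: "integrable lborel ?b" "(LINT y|lborel. ?b y) > 0" using plateau_integral_pos[OF r(1)] by auto
  have bc: "integrable lborel (\<lambda>y. of_real (?b y) :: complex)" using bi(1) by simp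
  have i1: "integrable lborel (\<lambda>y. f y * of_real (?b y))"
    using integrable_bounded_mult[OF bc f] by (simp add: mult.commute)
  have i2: "integrable lborel (\<lambda>y. f x * of_real (?b y))" using bc by simp
  have "norm ((LINT y|lborel. f x * of_real (?b y)) - (LINT y|lborel. f y * of_real (?b y))) \<le> (LINT y|lborel. \<epsilon> * ?b y)"
  proof (rule norm_integral_diff_le[OF i2 i1])
    show "integrable lborel (\<lambda>y. \<epsilon> * ?b y)" using bi by simp
    fix y
    show "norm (f x * of_real (?b y) - f y * of_real (?b y)) \<le> \<epsilon> * ?b y"
    proof (cases "norm (y - x) < 2 * r")
      case True
      then have "norm (f x - f y) \<le> \<epsilon>"
        using d(2)[of y] r(2) by (simp add: dist_norm norm_minus_commute)
      then show ?thesis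
        using plateau_nonneg[of x r y]
        by (simp add: left_diff_distrib[symmetric] norm_mult mult_right_mono)
    next
      case False
      then show ?thesis using plateau_eq_0[OF r(1), of y x] by simp
    qed
  qed
  then have "norm (f x) * (LINT y|lborel. ?b y) \<le> \<epsilon> * (LINT y|lborel. ?b y)"
    using bi zero[OF b] by (simp add: norm_mult)
  then have "norm (f x) \<le> \<epsilon>" using bi(2) by simp
  then show False using \<epsilon> by (simp add: \<epsilon>_def)
qed

text \<open>A kernel of total mass zero gains the Hoelder exponent.\<close>

lemma kconv_hoelder_bound:
  fixes g \<psi> :: "real^'d::finite \<Rightarrow> complex"
  assumes \<psi>: "integrable lborel \<psi>" "integrable lborel (\<lambda>z. norm (\<psi> z) * norm z powr \<sigma>)" "(LINT z|lborel. \<psi> z) = 0"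
    and g: "continuous_on UNIV g" "\<And>x. norm (g x) \<le> B"
    and h: "\<And>x t. norm (g x - g t) \<le> H * norm (x - t) powr \<sigma>" and e: "e \<ge> 0"
  shows "norm (kconv \<psi> e g x) \<le> H * (LINT z|lborel. norm (\<psi> z) * norm z powr \<sigma>) * e powr \<sigma>"
proof -
  have "norm (g x - g (x - e *\<^sub>R z)) \<le> H * e powr \<sigma> * norm z powr \<sigma>" for z
    using h[of x "x - e *\<^sub>R z"] e by (simp add: powr_mult mult.assoc)
  from kconv_increment_bound[OF \<psi>(1,2) g this]
  show ?thesis using \<psi>(3) by (simp add: mult_ac)
qed

text \<open>A function that represents \<open>S\<close> vanishes off the support of the cutoff. Hence the formula for
  \<open>S\<close> on test functions extends to the dilations of \<open>\<phi>\<close>, which are not compactly supported.\<close>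

lemma mollification_of_representing_function:
  fixes \<Omega> :: "(real^'d::finite) set"
  assumes \<eta>: "\<eta> \<in> test_functions \<Omega>" and S_eq: "\<And>f. S f = T (\<lambda>x. \<eta> x * f x)"
    and S: "finite_order S (fun_support \<eta>) N C"
    and f: "f \<in> hoelder \<alpha>" "given_by S f"
  shows "x \<notin> fun_support \<eta> \<Longrightarrow> f x = 0"
    and "\<phi> \<in> schwartz \<Longrightarrow> n > 0 \<Longrightarrow> sconv S (dilation \<phi> n) = kconv \<phi> (1 / real n) f"
proof -
  interpret finite_order S "fun_support \<eta>" N C by (rule S)
  let ?K = "fun_support \<eta>"
  have K: "compact ?K" "closed ?K" using test_functionsD[OF \<eta>] by (auto simp: fun_support_def)
  have fc: "continuous_on UNIV f" using f(1) by (rule hoelder_continuous)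
  obtain B where B: "\<And>x. norm (f x) \<le> B" using hoelder_bounded[OF f(1)] by blast
  have zero: "f x = 0" if "x \<notin> ?K" for x
  proof (rule zero_off_closed_of_test_functions[OF fc B K(2) _ that])
    fix \<psi> assume \<psi>: "\<psi> \<in> test_functions (- ?K)"
    have "\<eta> y * \<psi> y = 0" for y
    proof (cases "y \<in> ?K")
      case True
      then have "y \<notin> fun_support \<psi>" using \<psi> by (auto simp: test_functions_def)
      then show ?thesis by (simp add: fun_support_zero)
    qed (simp add: fun_support_zero)
    then have "(\<lambda>x. \<eta> x * \<psi> x) = (\<lambda>x. \<eta> x * 0)" by (intro ext) (simp only: mult_zero_right)
    then have "S \<psi> = S (\<lambda>x. 0)" unfolding S_eq by (rule arg_cong)
    moreover have "\<psi> \<in> test_functions UNIV" using \<psi> by (auto simp: test_functions_def)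
    ultimately show "(LINT x|lborel. f x * \<psi> x) = 0" using f(2) S_zero by (simp add: given_by_def)
  qed
  show "x \<notin> ?K \<Longrightarrow> f x = 0" by (rule zero)
  assume \<phi>: "\<phi> \<in> schwartz" and n: "n > 0"
  have \<phi>m: "\<phi> \<in> borel_measurable borel" using \<phi> by (rule schwartz_measurable)
  have db: "bsmooth (dilation \<phi> n)" using \<phi> by (intro dilation_bsmooth schwartz_bsmooth)
  obtain R where R: "R > 0" "\<And>y. y \<in> ?K \<Longrightarrow> norm y \<le> R"
    using compact_imp_bounded[OF K(1)] by (auto simp: bounded_pos)
  define \<theta> where "\<theta> y = (of_real (plateau 0 R y) :: complex)" for y :: "real^'d"
  have \<theta>: "\<theta> \<in> test_functions UNIV" unfolding \<theta>_def[abs_def] using R(1) by (intro plateau_test) auto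
  have \<theta>1: "\<theta> y = 1" if "y \<in> ?K" for y
    using plateau_eq_1[OF R(1), of y 0] R(2)[OF that] by (simp add: \<theta>_def)
  show "sconv S (dilation \<phi> n) = kconv \<phi> (1 / real n) f"
  proof
    fix x
    let ?g = "\<lambda>y. dilation \<phi> n (x - y)"
    have "(\<lambda>y. \<theta> y * ?g y) \<in> test_functions UNIV"
    proof (rule test_functionsI)
      show "smooth (\<lambda>y. \<theta> y * ?g y)"
        by (intro smooth_mult test_functionsD(1)[OF \<theta>] bsmooth_smooth[OF bsmooth_reflect[OF db]])
      show "compact (fun_support \<theta>)" using \<theta> by (rule test_functionsD)
    qed (simp_all add: fun_support_zero)
    then have "S (\<lambda>y. \<theta> y * ?g y) = (LINT y|lborel. f y * (\<theta> y * ?g y))"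
      using f(2) by (simp add: given_by_def)
    also have "(\<lambda>y. f y * (\<theta> y * ?g y)) = (\<lambda>y. f y * ?g y)"
    proof
      fix y show "f y * (\<theta> y * ?g y) = f y * ?g y"
        using zero[of y] \<theta>1[of y] by (cases "y \<in> ?K") auto
    qed
    also have "(LINT y|lborel. f y * ?g y) = (LINT y|lborel. dilation \<phi> n y * f (x - y))"
      by (intro convolution_commute borel_measurable_continuous_onI fc bsmooth_continuous db)
    also have "\<dots> = kconv \<phi> (1 / real n) f x"
      by (intro convolution_dilation \<phi>m n borel_measurable_continuous_onI fc)
    finally have "S (\<lambda>y. \<theta> y * ?g y) = kconv \<phi> (1 / real n) f x" .
    moreover have "(\<lambda>y. \<eta> y * (\<theta> y * ?g y)) = (\<lambda>y. \<eta> y * ?g y)"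
    proof
      fix y show "\<eta> y * (\<theta> y * ?g y) = \<eta> y * ?g y"
        using fun_support_zero[of y \<eta>] \<theta>1[of y] by (cases "y \<in> ?K") auto
    qed
    ultimately show "sconv S (dilation \<phi> n) x = kconv \<phi> (1 / real n) f x"
      by (simp add: sconv_def S_eq)
  qed
qed

text \<open>For \<open>|m| \<le> [\<alpha>]\<close> the derivatives stay bounded. Otherwise \<open>[\<alpha>]\<close> derivatives fall on \<open>f\<close>, and
  the remaining kernel, a derivative of \<open>\<phi>\<close>, has integral zero and gains the Hoelder exponent.\<close>

theorem mollified_growth_of_hoelder:
  fixes f :: "real^'d::finite \<Rightarrow> complex"
  assumes f: "f \<in> hoelder \<alpha>" and K: "compact K" "\<And>x. x \<notin> K \<Longrightarrow> f x = 0"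
    and \<phi>: "\<phi> \<in> schwartz"
    and sm: "\<And>n. n > 0 \<Longrightarrow> smooth (kconv \<phi> (1 / real n) f)"
    and \<alpha>: "\<alpha> > 0" "real k > \<alpha>" and m: "mi_order m \<le> k"
  shows "\<exists>C. \<forall>n>0. \<forall>x. norm (mpartial m (kconv \<phi> (1 / real n) f) x) \<le> C * real n powr (real k - \<alpha>)"
proof -
  define a where "a = nat \<lfloor>\<alpha>\<rfloor>"
  have fl: "of_int \<lfloor>\<alpha>\<rfloor> = real a" unfolding a_def using \<alpha> by simp
  have a: "real a \<le> \<alpha>" unfolding a_def using \<alpha> by simp
  define \<sigma> where "\<sigma> = \<alpha> - real a"
  have \<sigma>: "\<sigma> \<ge> 0" using a by (simp add: \<sigma>_def)
  define w where "w = mi_word m"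
  have w: "length w \<le> k" using m by (simp add: w_def length_mi_word)
  have fk: "Ck a f"
    and fb: "\<And>m. mi_order m \<le> a \<Longrightarrow> bounded (range (mpartial m f))"
    and fh: "\<And>m. mi_order m = a \<Longrightarrow> \<exists>C. \<forall>x t. x \<noteq> t \<longrightarrow>
       norm (mpartial m f x - mpartial m f t) / norm (x - t) powr \<sigma> \<le> C"
    using f unfolding hoelder_def a_def[symmetric] fl \<sigma>_def by simp_all
  have \<phi>i: "integrable lborel \<phi>" using \<phi> by (rule schwartz_integrable)
  have pk: "pderivs s (kconv \<phi> (1 / real n) f) = kconv \<phi> (1 / real n) (pderivs s f)"
    if "length s \<le> a" "n > 0" for s n
    using pderivs_kconv_compact_support[OF \<phi>i fk K sm[OF that(2)] that(1)] .
  show ?thesis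
  proof (cases "length w \<le> a")
    case True
    obtain B where B: "\<And>x. norm (pderivs w f x) \<le> B"
      using fb[of m] True by (auto simp: mpartial_word w_def length_mi_word bounded_iff)
    show ?thesis
    proof (intro exI[of _ "L1norm \<phi> * B"] allI impI)
      fix n :: nat and x assume n: "n > 0"
      have "norm (mpartial m (kconv \<phi> (1 / real n) f) x) \<le> L1norm \<phi> * B"
        unfolding mpartial_word w_def[symmetric] pk[OF True n] using \<phi>i B by (rule kconv_bound)
      also have "\<dots> \<le> L1norm \<phi> * B * real n powr (real k - \<alpha>)"
      proof -
        have "0 \<le> B" using B norm_ge_zero order_trans by blast
        then have "0 \<le> L1norm \<phi> * B" by (intro mult_nonneg_nonneg) auto
        moreover have "1 \<le> real n powr (real k - \<alpha>)"
          using n \<alpha> by (intro ge_one_powr_ge_zero) auto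
        ultimately show ?thesis using mult_left_mono[of 1] by fastforce
      qed
      finally show "norm (mpartial m (kconv \<phi> (1 / real n) f) x) \<le> L1norm \<phi> * B * real n powr (real k - \<alpha>)" .
    qed
  next
    case False
    \<comment> \<open>The \<open>a\<close> innermost derivatives fall on \<open>f\<close>, the outer ones on \<open>\<phi>\<close>.\<close>
    define p where "p = take (length w - a) w"
    define s where "s = drop (length w - a) w"
    have ws: "w = p @ s" and ls: "length s = a" and lp: "length p = length w - a" "p \<noteq> []"
      using False by (auto simp: p_def s_def)
    obtain m' where m': "s = mi_word m'" using mi_word_suffix[of m p s] ws w_def by auto
    have m'o: "mi_order m' = a" using ls m' by (simp add: length_mi_word)
    define g where "g = pderivs s f"
    have gm: "g = mpartial m' f" by (simp add: g_def m' mpartial_word)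
    have gc: "continuous_on UNIV g"
      using Ck_pderivs[of 0 s f] fk ls by (simp add: g_def)
    obtain B where B: "\<And>x. norm (g x) \<le> B"
      using fb[of m'] m'o gm by (auto simp: bounded_iff)
    have gz: "g x = 0" if "x \<notin> K" for x
      unfolding g_def by (rule pderivs_zero_off_closed[OF compact_imp_closed[OF K(1)] K(2) that])
    obtain H where H: "\<And>x t. x \<noteq> t \<Longrightarrow> norm (g x - g t) / norm (x - t) powr \<sigma> \<le> H"
      using fh[OF m'o] gm by auto
    have h: "norm (g x - g t) \<le> \<bar>H\<bar> * norm (x - t) powr \<sigma>" for x t
    proof (cases "x = t")
      case False
      then have "norm (g x - g t) \<le> H * norm (x - t) powr \<sigma>"
        using H[OF False] by (simp add: pos_divide_le_eq)
      also have "\<dots> \<le> \<bar>H\<bar> * norm (x - t) powr \<sigma>" by (intro mult_right_mono) auto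
      finally show ?thesis .
    qed simp
    have gi: "integrable lborel g" by (rule integrable_of_compact_support[OF gc K(1) gz])
    have gm: "g \<in> borel_measurable borel" by (rule borel_measurable_continuous_onI[OF gc])
    define S where "S = (\<lambda>u. LINT z|lborel. g z * u (1 *\<^sub>R z))"
    interpret S: finite_order S UNIV 0 "L1norm g" unfolding S_def by (rule finite_order_kernel[OF gi])
    have Sk: "sconv S (dilation \<psi> n) = kconv \<psi> (1 / real n) g"
      if "n > 0" "\<psi> \<in> schwartz" for \<psi> n
    proof
      fix x
      have d: "dilation \<psi> n \<in> borel_measurable borel"
        by (intro borel_measurable_continuous_onI bsmooth_continuous dilation_bsmooth schwartz_bsmooth that)
      have "sconv S (dilation \<psi> n) x = (LINT y|lborel. g y * dilation \<psi> n (x - y))"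
        by (simp add: sconv_def S_def)
      also have "\<dots> = (LINT y|lborel. dilation \<psi> n y * g (x - y))"
        by (rule convolution_commute[OF gm d])
      also have "\<dots> = kconv \<psi> (1 / real n) g x"
        by (rule convolution_dilation[OF schwartz_measurable[OF that(2)] gm that(1)])
      finally show "sconv S (dilation \<psi> n) x = kconv \<psi> (1 / real n) g x" .
    qed
    let ?\<psi> = "pderivs p \<phi>"
    have \<psi>: "?\<psi> \<in> schwartz" using \<phi> by (rule schwartz_pderivs)
    have \<psi>0: "(LINT z|lborel. ?\<psi> z) = 0"
    proof -
      obtain i q where "p = i # q" using lp(2) by (cases p) auto
      then show ?thesis using schwartz_partial_integral_zero[OF schwartz_pderivs[OF \<phi>, of q]] by simp
    qed
    define D where "D = \<bar>H\<bar> * (LINT z|lborel. norm (?\<psi> z) * norm z powr \<sigma>)"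
    have D: "D \<ge> 0" unfolding D_def by (intro mult_nonneg_nonneg integral_nonneg_AE) auto
    show ?thesis
    proof (intro exI[of _ D] allI impI)
      fix n :: nat and x assume n: "n > 0"
      have "mpartial m (kconv \<phi> (1 / real n) f) = pderivs p (kconv \<phi> (1 / real n) g)"
        using pk[of s n] ls n by (simp add: mpartial_word w_def[symmetric] ws g_def)
      also have "\<dots> = pderivs p (sconv S (dilation \<phi> n))" using Sk[OF n \<phi>] by simp
      also have "\<dots> = sconv S (pderivs p (dilation \<phi> n))"
        by (intro S.pderivs_sconv dilation_bsmooth schwartz_bsmooth \<phi>)
      also have "\<dots> = (\<lambda>x. of_nat n ^ length p * sconv S (dilation ?\<psi> n) x)"
        unfolding pderivs_dilation[OF schwartz_smooth[OF \<phi>]]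
        by (rule ext) (simp add: sconv_def S.S_cmult[OF bsmooth_reflect[OF dilation_bsmooth[OF schwartz_bsmooth[OF \<psi>]]]])
      finally have "norm (mpartial m (kconv \<phi> (1 / real n) f) x) = real n ^ length p * norm (kconv ?\<psi> (1 / real n) g x)"
        using Sk[OF n \<psi>] by (simp add: norm_mult norm_power)
      also have "norm (kconv ?\<psi> (1 / real n) g x) \<le> D * (1 / real n) powr \<sigma>"
        unfolding D_def
        by (rule kconv_hoelder_bound[OF schwartz_integrable[OF \<psi>] schwartz_integrable_weighted[OF \<psi> \<sigma>] \<psi>0 gc B h]) simp
      also have "real n ^ length p * (D * (1 / real n) powr \<sigma>) = D * real n powr (real (length w) - \<alpha>)"
      proof -
        have "real (length p) = real (length w) - real a" using lp(1) False by simp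
        then have "real n ^ length p * (1 / real n) powr \<sigma> = real n powr (real (length w) - \<alpha>)"
          using n by (simp add: powr_realpow[symmetric] powr_divide powr_minus_divide[symmetric] powr_add[symmetric] \<sigma>_def)
        then show ?thesis by (simp add: mult.left_commute)
      qed
      also have "\<dots> \<le> D * real n powr (real k - \<alpha>)"
        using D n w by (intro mult_left_mono powr_mono) auto
      finally show "norm (mpartial m (kconv \<phi> (1 / real n) f) x) \<le> D * real n powr (real k - \<alpha>)"
        by (simp add: mult_left_mono)
    qed
  qed
qed

section \<open>The characterization\<close>

text \<open>Bounds on \<open>\<Omega>\<close> for large \<open>n\<close> and for each multi-index, combined into one bound on the whole
  space for all \<open>n > 0\<close> and all words.\<close>

lemma uniform_growth_bound:
  fixes F :: "nat \<Rightarrow> real^'d::finite \<Rightarrow> complex"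
  assumes F: "\<And>n. bsmooth (F n)" and \<beta>: "\<beta> \<ge> 0"
    and inside: "\<And>m. mi_order m \<le> k \<Longrightarrow> \<exists>C. \<forall>\<^sub>F n in sequentially.
        (SUP x\<in>\<Omega>. ennreal (norm (mpartial m (F n) x))) \<le> ennreal (C * real n powr \<beta>)"
    and outside: "\<And>n x w. n > 0 \<Longrightarrow> x \<notin> \<Omega> \<Longrightarrow> length w = k \<Longrightarrow> norm (pderivs w (F n) x) \<le> A"
    and A: "A \<ge> 0"
  obtains D where "D \<ge> 0" "\<And>n w x. n > 0 \<Longrightarrow> length w = k \<Longrightarrow> norm (pderivs w (F n) x) \<le> D * real n powr \<beta>"
proof -
  let ?W = "{w :: 'd list. length w = k}"
  have finW: "finite ?W" using finite_lists_length_eq[of "UNIV :: 'd set" k] by simp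
  have "\<exists>C. C \<ge> 0 \<and> (\<forall>\<^sub>F n in sequentially. \<forall>x\<in>\<Omega>. norm (pderivs w (F n) x) \<le> C * real n powr \<beta>)"
    if w: "w \<in> ?W" for w
  proof -
    let ?m = "count (mset w)"
    obtain C where C: "\<forall>\<^sub>F n in sequentially.
        (SUP x\<in>\<Omega>. ennreal (norm (mpartial ?m (F n) x))) \<le> ennreal (C * real n powr \<beta>)"
      using inside[of ?m] w by (auto simp: mi_order_word)
    have "\<forall>\<^sub>F n in sequentially. \<forall>x\<in>\<Omega>. norm (pderivs w (F n) x) \<le> \<bar>C\<bar> * real n powr \<beta>"
      using C
    proof eventually_elim
      case (elim n)
      show ?case
      proof
        fix x assume "x \<in> \<Omega>"
        then have "ennreal (norm (mpartial ?m (F n) x)) \<le> ennreal (C * real n powr \<beta>)"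
          using elim by (meson SUP_upper order_trans)
        also have "\<dots> \<le> ennreal (\<bar>C\<bar> * real n powr \<beta>)"
          by (intro ennreal_leI mult_right_mono) auto
        finally have "norm (mpartial ?m (F n) x) \<le> \<bar>C\<bar> * real n powr \<beta>"
          by (simp add: ennreal_le_iff)
        then show "norm (pderivs w (F n) x) \<le> \<bar>C\<bar> * real n powr \<beta>"
          using pderivs_eq_mpartial[OF bsmooth_smooth[OF F], of w n] by simp
      qed
    qed
    then show ?thesis by (intro exI[of _ "\<bar>C\<bar>"]) simp
  qed
  then have "\<forall>w\<in>?W. \<exists>C. C \<ge> 0 \<and> (\<forall>\<^sub>F n in sequentially. \<forall>x\<in>\<Omega>. norm (pderivs w (F n) x) \<le> C * real n powr \<beta>)"
    by (rule ballI)
  from bchoice[OF this] obtain c where c: "\<And>w. w \<in> ?W \<Longrightarrow> c w \<ge> 0"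
    "\<And>w. w \<in> ?W \<Longrightarrow> \<forall>\<^sub>F n in sequentially. \<forall>x\<in>\<Omega>. norm (pderivs w (F n) x) \<le> c w * real n powr \<beta>"
    by auto
  have "\<forall>\<^sub>F n in sequentially. \<forall>w\<in>?W. \<forall>x\<in>\<Omega>. norm (pderivs w (F n) x) \<le> c w * real n powr \<beta>"
    using finW c(2) by (intro eventually_ball_finite) auto
  then obtain n0 where n0: "\<And>n w x. n \<ge> n0 \<Longrightarrow> w \<in> ?W \<Longrightarrow> x \<in> \<Omega> \<Longrightarrow> norm (pderivs w (F n) x) \<le> c w * real n powr \<beta>"
    unfolding eventually_sequentially by blast
  have "\<forall>n. \<exists>b. b \<ge> 0 \<and> deriv_bound k b (F n)"
    using bsmooth_deriv_bound[OF F] by blast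
  from choice[OF this] obtain b where b: "\<And>n. b n \<ge> 0" "\<And>n. deriv_bound k (b n) (F n)" by auto
  define s1 where "s1 = (\<Sum>w\<in>?W. c w)"
  define s2 where "s2 = (\<Sum>n<n0. b n)"
  have s: "s1 \<ge> 0" "s2 \<ge> 0" unfolding s1_def s2_def using c(1) b(1) by (auto intro: sum_nonneg)
  show ?thesis
  proof (rule that[of "s1 + s2 + A"])
    show "s1 + s2 + A \<ge> 0" using s A by simp
    fix n :: nat and w :: "'d list" and x assume n: "n > 0" and w: "length w = k"
    have one: "1 \<le> real n powr \<beta>" using n \<beta> by (intro ge_one_powr_ge_zero) auto
    have key: "y \<le> (s1 + s2 + A) * real n powr \<beta>" if "y \<le> s1 * real n powr \<beta> \<or> y \<le> s2 \<or> y \<le> A" for y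
    proof -
      define t where "t = (s1 + s2 + A) * real n powr \<beta>"
      have "s1 * real n powr \<beta> \<le> t"
        unfolding t_def using s A by (intro mult_right_mono) auto
      moreover have "(s1 + s2 + A) * 1 \<le> t"
        unfolding t_def using s A one by (intro mult_left_mono) auto
      moreover from this have "s2 \<le> t" "A \<le> t" using s A by simp_all
      ultimately have "y \<le> t" using that order_trans by metis
      then show ?thesis by (simp add: t_def)
    qed
    consider "x \<notin> \<Omega>" | "x \<in> \<Omega>" "n \<ge> n0" | "n < n0" by fastforce
    then show "norm (pderivs w (F n) x) \<le> (s1 + s2 + A) * real n powr \<beta>"
    proof cases
      case 1
      then show ?thesis using outside[OF n 1 w] key by blast
    next
      case 2
      have "c w \<le> s1" unfolding s1_def using w c(1) finW by (intro member_le_sum) auto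
      then have "c w * real n powr \<beta> \<le> s1 * real n powr \<beta>" by (intro mult_right_mono) auto
      moreover have "norm (pderivs w (F n) x) \<le> c w * real n powr \<beta>" using n0[of n w x] 2 w by simp
      ultimately show ?thesis using key order_trans by blast
    next
      case 3
      have "b n \<le> s2" unfolding s2_def using 3 b(1) by (intro member_le_sum) auto
      moreover have "norm (pderivs w (F n) x) \<le> b n" using b(2) w by (rule deriv_boundD)
      ultimately show ?thesis using key order_trans by blast
    qed
  qed
qed

theorem proposition1p1:
  fixes \<Omega> :: "(real^'d::finite) set"
    and T :: "(real^'d \<Rightarrow> complex) \<Rightarrow> complex"
    and \<phi> :: "real^'d \<Rightarrow> complex"
    and \<alpha> :: real and k :: nat
  assumes "open \<Omega>"
    and "T \<in> compact_distributions \<Omega>"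
    and "\<phi> \<in> schwartz"
    and "(LINT x|lborel. \<phi> x) = 1"
    and "\<alpha> > 0" and "\<alpha> \<notin> \<nat>"
    and "real k > \<alpha>"
  shows "(\<exists>f\<in>hoelder \<alpha>. given_by (dist_ext \<Omega> T) f) \<longleftrightarrow>
    (\<forall>m. mi_order m \<le> k \<longrightarrow>
      (\<exists>C. \<forall>\<^sub>F n in sequentially.
        (SUP x\<in>\<Omega>. ennreal (norm (mpartial m (dist_conv \<Omega> T (dilation \<phi> n)) x)))
          \<le> ennreal (C * real n powr (real k - \<alpha>))))"
proof -
  obtain \<eta> N C where \<eta>: "\<eta> \<in> test_functions \<Omega>"
    and S_eq: "\<And>f. dist_ext \<Omega> T f = T (\<lambda>x. \<eta> x * f x)"
    and S: "finite_order (dist_ext \<Omega> T) (fun_support \<eta>) N C"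
    using dist_ext_finite_order[OF assms(1,2)] by blast
  interpret finite_order "dist_ext \<Omega> T" "fun_support \<eta>" N C by (rule S)
  interpret mollifier \<phi> by (rule schwartz_mollifier[OF assms(3,4)])
  have conv: "dist_conv \<Omega> T g = sconv (dist_ext \<Omega> T) g" for g
    by (rule ext) (simp add: dist_conv_def sconv_def)
  have \<phi>b: "bsmooth \<phi>" using assms(3) by (rule schwartz_bsmooth)
  have Fb: "bsmooth (sconv (dist_ext \<Omega> T) (dilation \<phi> n))" for n
    by (intro bsmooth_sconv dilation_bsmooth \<phi>b)
  show ?thesis
  proof (intro iffI allI impI)
    fix m :: "'d \<Rightarrow> nat"
    assume "\<exists>f\<in>hoelder \<alpha>. given_by (dist_ext \<Omega> T) f" and m: "mi_order m \<le> k"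
    then obtain f where f: "f \<in> hoelder \<alpha>" "given_by (dist_ext \<Omega> T) f" by blast
    have zero: "f x = 0" if "x \<notin> fun_support \<eta>" for x
      by (rule mollification_of_representing_function(1)[OF \<eta> S_eq S f that])
    have eq: "sconv (dist_ext \<Omega> T) (dilation \<phi> n) = kconv \<phi> (1 / real n) f" if "n > 0" for n
      by (rule mollification_of_representing_function(2)[OF \<eta> S_eq S f assms(3) that])
    have "smooth (kconv \<phi> (1 / real n) f)" if "n > 0" for n
      using bsmooth_smooth[OF Fb, of n] eq[OF that] by simp
    from mollified_growth_of_hoelder[OF f(1) test_functionsD(2)[OF \<eta>] zero assms(3) this assms(5,7) m]
    obtain D where D: "\<And>n x. n > 0 \<Longrightarrow> norm (mpartial m (kconv \<phi> (1 / real n) f) x) \<le> D * real n powr (real k - \<alpha>)"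
      by blast
    have "\<forall>\<^sub>F n in sequentially.
        (SUP x\<in>\<Omega>. ennreal (norm (mpartial m (dist_conv \<Omega> T (dilation \<phi> n)) x)))
          \<le> ennreal (D * real n powr (real k - \<alpha>))"
      using eventually_gt_at_top[of 0]
    proof eventually_elim
      case (elim n)
      show ?case unfolding conv eq[OF elim] by (intro SUP_least ennreal_leI D elim)
    qed
    then show "\<exists>C. \<forall>\<^sub>F n in sequentially.
        (SUP x\<in>\<Omega>. ennreal (norm (mpartial m (dist_conv \<Omega> T (dilation \<phi> n)) x)))
          \<le> ennreal (C * real n powr (real k - \<alpha>))" by blast
  next
    assume growth: "\<forall>m. mi_order m \<le> k \<longrightarrow> (\<exists>C. \<forall>\<^sub>F n in sequentially.
        (SUP x\<in>\<Omega>. ennreal (norm (mpartial m (dist_conv \<Omega> T (dilation \<phi> n)) x)))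
          \<le> ennreal (C * real n powr (real k - \<alpha>)))"
    obtain A where A: "A \<ge> 0" "\<And>n x w. n > 0 \<Longrightarrow> x \<notin> \<Omega> \<Longrightarrow> length w = k \<Longrightarrow>
      norm (pderivs w (sconv (dist_ext \<Omega> T) (dilation \<phi> n)) x) \<le> A"
      using mollification_bounded_outside[OF assms(3,1) test_functionsD(2,3)[OF \<eta>]] by metis
    obtain D where D: "D \<ge> 0" "\<And>n w x. n > 0 \<Longrightarrow> length w = k \<Longrightarrow>
      norm (pderivs w (sconv (dist_ext \<Omega> T) (dilation \<phi> n)) x) \<le> D * real n powr (real k - \<alpha>)"
      by (rule uniform_growth_bound[OF Fb _ growth[unfolded conv, rule_format] A(2,1)]) (use assms in auto)
    show "\<exists>f\<in>hoelder \<alpha>. given_by (dist_ext \<Omega> T) f"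
      unfolding given_by_def
      by (rule hoelder_of_mollified_growth[OF S \<phi>b assms(5-7) D])
  qed
qed

end
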